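(* Assume that $\mu$ satisfies a Poincaré inequality with best constant $c_{\mathrm{P}}(\mu)<\infty$ and that the following Lyapunov condition holds: there exist a continuous function $U:\mathcal{X}\to[1,+\infty)$ in $\mathbb{D}_e(\mathcal{L})$, a nonnegative function $\phi$ and a constant $b>0$ such that $$-\frac{\mathcal{L}U}U\ge\phi-b,\qquad\mu\text{-a.s.}$$ Suppose moreover that $\|\phi\|_2:=(\int\phi^2d\mu)^{1/2}<\infty$. Then for any $a\ge2$ and every probability measure $\nu$ on $\mathcal{X}$, $$\|\phi(\nu-\mu)\|_{TV}\le\big(1+2b\,c_{\mathrm{P}}(\mu)\big)\frac{a+1}{a-1}\,I(\nu|\mu)+a\sqrt2\,\|\phi\|_2\sqrt{c_{\mathrm{P}}(\mu)\,I(\nu|\mu)}$$ and $$\|\sqrt\phi(\nu-\mu)\|_{TV}^2\le2\Big[3\big(1+2b\,c_{\mathrm{P}}(\mu)\big)+2\sqrt2\,\|\phi\|_2\,c_{\mathrm{P}}(\mu)\Big]I(\nu|\mu).$$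
   Context: Setting: $\mathcal{X}$ is a complete separable metric space; $((X_t)_{t\ge0},\mathbb{P}_\mu)$ is an $\mathcal{X}$-valued Markov process with invariant probability measure $\mu$, reversible (its transition semigroup $(P_t)$ is symmetric on $L^2(\mu)$), with $\mathbb{P}_\mu$-a.s. càdlàg paths; $\mu$ is ergodic (if $f$ is bounded measurable with $P_tf=f$ $\mu$-a.e. for all $t\ge 0$, then $f$ is $\mu$-a.e. constant) and $(P_t)$ is strongly continuous on $L^2(\mu)$, with generator $\mathcal{L}$. $(\mathcal{E},\mathbb{D}(\mathcal{E}))$ is the associated Dirichlet form, i.e. the closure of $\mathcal{E}(g,g)=\langle-\mathcal{L}g,g\rangle_\mu$. Extended domain: a continuous $h$ is in $\mathbb{D}_e(\mathcal{L})$ if there is a measurable $g$ with $\int_0^t|g|(X_s)\,ds<+\infty$ $\mathbb{P}_\mu$-a.s. and $h(X_t)-h(X_0)-\int_0^tg(X_s)\,ds$ a local $\mathbb{P}_\mu$-martingale; then $\mathcal{L}h:=g$ (unique up to $\mu$-equivalence). Poincaré inequality with best constant $c_{\mathrm{P}}(\mu)$: $\mathrm{Var}_\mu(g)\le c_{\mathrm{P}}(\mu)\,\mathcal{E}(g,g)$ for all $g$ in the $L^2(\mu)$-domain of $\mathcal{L}$, with $c_{\mathrm{P}}(\mu)$ the smallest such constant. $I(\nu|\mu)=\mathcal{E}(\sqrt f,\sqrt f)$ if $\nu=f\mu$ with $\sqrt f\in\mathbb{D}(\mathcal{E})$, and $+\infty$ otherwise. $\|\psi(\nu-\mu)\|_{TV}=\sup_{|u|\le\psi}\int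 u\,d(\nu-\mu)$, which equals $\int\psi|f-1|\,d\mu$ when $\nu=f\mu$. *)

theory Defs
  imports "HOL-Probability.Probability"
begin

subsection \<open>Processes in continuous time\<close>

text \<open>Time is \<open>[0,\<infinity>)\<close>: processes are indexed by real numbers, and only nonnegative indices matter.
  Filtrations are indexed by \<open>[0,\<infinity>]\<close>, so that the library notion of stopping time covers
  \<open>[0,\<infinity>]\<close>-valued stopping times.\<close>

definition cadlag :: "(real \<Rightarrow> 'a::topological_space) \<Rightarrow> bool" where
  "cadlag p \<longleftrightarrow> (\<forall>t\<ge>0. continuous (at_right t) p) \<and> (\<forall>t>0. \<exists>l. (p \<longlongrightarrow> l) (at_left t))"

definition martingale_ct ::
    "'w measure \<Rightarrow> (ennreal \<Rightarrow> 'w measure) \<Rightarrow> (real \<Rightarrow> 'w \<Rightarrow> real) \<Rightarrow> bool" where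
  "martingale_ct M F Z \<longleftrightarrow>
     (\<forall>t\<ge>0. Z t \<in> borel_measurable (F (ennreal t)) \<and> integrable M (Z t)) \<and>
     (\<forall>s\<ge>0. \<forall>t\<ge>s. AE \<omega> in M. real_cond_exp M (F (ennreal s)) (Z t) \<omega> = Z s \<omega>)"

definition stopped :: "(real \<Rightarrow> 'w \<Rightarrow> real) \<Rightarrow> ('w \<Rightarrow> ennreal) \<Rightarrow> real \<Rightarrow> 'w \<Rightarrow> real" where
  "stopped Z T t \<omega> = Z (enn2real (min (ennreal t) (T \<omega>))) \<omega>"

definition local_martingale_ct ::
    "'w measure \<Rightarrow> (ennreal \<Rightarrow> 'w measure) \<Rightarrow> (real \<Rightarrow> 'w \<Rightarrow> real) \<Rightarrow> bool" where
  "local_martingale_ct M F Z \<longleftrightarrow>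
     (\<forall>t\<ge>0. Z t \<in> borel_measurable (F (ennreal t))) \<and>
     (\<exists>T :: nat \<Rightarrow> 'w \<Rightarrow> ennreal.
        (\<forall>n. stopping_time F (T n)) \<and>
        (AE \<omega> in M. incseq (\<lambda>n. T n \<omega>) \<and> (\<lambda>n. T n \<omega>) \<longlonglongrightarrow> \<infinity>) \<and>
        (\<forall>n. martingale_ct M F (stopped Z (T n))))"

subsection \<open>The Markov semigroup on square-integrable functions\<close>

text \<open>Elements of \<open>L\<^sup>2(\<mu>)\<close> are represented by functions; every notion below is invariant under
  modification on \<open>\<mu>\<close>-null sets.\<close>

definition L2 :: "'a measure \<Rightarrow> ('a \<Rightarrow> real) set" where
  "L2 \<mu> = {f \<in> borel_measurable \<mu>. integrable \<mu> (\<lambda>x. (f x)\<^sup>2)}"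

definition L2_norm :: "'a measure \<Rightarrow> ('a \<Rightarrow> real) \<Rightarrow> real" where
  "L2_norm \<mu> f = sqrt (LINT x|\<mu>. (f x)\<^sup>2)"

definition semigroup_op ::
    "(real \<Rightarrow> 'a \<Rightarrow> 'a measure) \<Rightarrow> real \<Rightarrow> ('a \<Rightarrow> real) \<Rightarrow> 'a \<Rightarrow> real" where
  "semigroup_op P t f x = (LINT y|P t x. f y)"

text \<open>The Markov process of the setting, with law \<open>P\<^sub>\<mu>\<close> realised as the probability measure \<open>M\<close> on an
  arbitrary sample space. The Markov property is required relative to a filtration \<open>F\<close> to which
  \<open>X\<close> is adapted; \<open>F\<close> may be the natural filtration or an augmentation of it. Since only the law
  started from \<open>\<mu>\<close> is given, the semigroup laws of the transition kernels are required for
  \<open>\<mu>\<close>-almost every starting point.\<close>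

locale reversible_markov_process =
  prob_space M + filtration "space M" F
  for M :: "'w measure" and F :: "ennreal \<Rightarrow> 'w measure" +
  fixes X :: "real \<Rightarrow> 'w \<Rightarrow> 'a::polish_space"
    and P :: "real \<Rightarrow> 'a \<Rightarrow> 'a measure"
    and \<mu> :: "'a measure"
  assumes sub_algebra: "\<And>t. subalgebra M (F t)"
    and adapted: "\<And>t. 0 \<le> t \<Longrightarrow> X t \<in> F (ennreal t) \<rightarrow>\<^sub>M borel"
    and cadlag_paths: "AE \<omega> in M. cadlag (\<lambda>t. X t \<omega>)"
    and prob_space_mu: "prob_space \<mu>"
    and sets_mu: "sets \<mu> = sets borel"
    and initial_law: "distr M borel (X 0) = \<mu>"
    and kernel: "\<And>t. 0 \<le> t \<Longrightarrow> P t \<in> borel \<rightarrow>\<^sub>M prob_algebra borel"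
    and kernel_zero: "AE x in \<mu>. P 0 x = return borel x"
    and chapman_kolmogorov:
      "\<And>s t. 0 \<le> s \<Longrightarrow> 0 \<le> t \<Longrightarrow> AE x in \<mu>. P (s + t) x = P s x \<bind> P t"
    and markov: "\<And>s t f. 0 \<le> s \<Longrightarrow> 0 \<le> t \<Longrightarrow> f \<in> borel_measurable borel \<Longrightarrow> bounded (range f) \<Longrightarrow>
      AE \<omega> in M. real_cond_exp M (F (ennreal s)) (\<lambda>\<omega>. f (X (s + t) \<omega>)) \<omega>
                  = semigroup_op P t f (X s \<omega>)"
    and invariant: "\<And>t. 0 \<le> t \<Longrightarrow> \<mu> \<bind> P t = \<mu>"
    and reversible: "\<And>t f g. 0 \<le> t \<Longrightarrow> f \<in> L2 \<mu> \<Longrightarrow> g \<in> L2 \<mu> \<Longrightarrow>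
      (LINT x|\<mu>. f x * semigroup_op P t g x) = (LINT x|\<mu>. semigroup_op P t f x * g x)"
    and ergodic: "\<And>f. f \<in> borel_measurable borel \<Longrightarrow> bounded (range f) \<Longrightarrow>
      (\<forall>t\<ge>0. AE x in \<mu>. semigroup_op P t f x = f x) \<Longrightarrow> \<exists>c. AE x in \<mu>. f x = c"
    and strongly_continuous: "\<And>f. f \<in> L2 \<mu> \<Longrightarrow>
      ((\<lambda>t. L2_norm \<mu> (\<lambda>x. semigroup_op P t f x - f x)) \<longlongrightarrow> 0) (at_right 0)"

text \<open>\<open>L2_generator \<mu> P f g\<close>: \<open>f\<close> belongs to the \<open>L\<^sup>2(\<mu>)\<close>-domain of the generator, with image \<open>g\<close>.\<close>

definition L2_generator ::
    "'a measure \<Rightarrow> (real \<Rightarrow> 'a \<Rightarrow> 'a measure) \<Rightarrow> ('a \<Rightarrow> real) \<Rightarrow> ('a \<Rightarrow> real) \<Rightarrow> bool" where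
  "L2_generator \<mu> P f g \<longleftrightarrow> f \<in> L2 \<mu> \<and> g \<in> L2 \<mu> \<and>
     ((\<lambda>t. L2_norm \<mu> (\<lambda>x. (semigroup_op P t f x - f x) / t - g x)) \<longlongrightarrow> 0) (at_right 0)"

subsection \<open>Dirichlet form\<close>

text \<open>The closure of the quadratic form \<open>\<langle>-\<L>g, g\<rangle>\<^sub>\<mu>\<close>: \<open>f\<close> lies in the domain iff it is the \<open>L\<^sup>2\<close>-limit
  of a form-Cauchy sequence in the domain of the generator, and the value of the form at \<open>f\<close> is
  the limit of the values along such a sequence. It does not depend on the sequence since the form
  is closable.\<close>

definition form_approx ::
    "'a measure \<Rightarrow> (real \<Rightarrow> 'a \<Rightarrow> 'a measure) \<Rightarrow> ('a \<Rightarrow> real) \<Rightarrow>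
     (nat \<Rightarrow> 'a \<Rightarrow> real) \<Rightarrow> (nat \<Rightarrow> 'a \<Rightarrow> real) \<Rightarrow> bool" where
  "form_approx \<mu> P f u v \<longleftrightarrow>
     (\<forall>n. L2_generator \<mu> P (u n) (v n)) \<and>
     (\<lambda>n. L2_norm \<mu> (\<lambda>x. u n x - f x)) \<longlonglongrightarrow> 0 \<and>
     (\<forall>e>0. \<exists>N. \<forall>m\<ge>N. \<forall>n\<ge>N. (LINT x|\<mu>. - (v m x - v n x) * (u m x - u n x)) < e)"

definition dirichlet_domain ::
    "'a measure \<Rightarrow> (real \<Rightarrow> 'a \<Rightarrow> 'a measure) \<Rightarrow> ('a \<Rightarrow> real) set" where
  "dirichlet_domain \<mu> P = {f \<in> L2 \<mu>. \<exists>u v. form_approx \<mu> P f u v}"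

definition dirichlet_form ::
    "'a measure \<Rightarrow> (real \<Rightarrow> 'a \<Rightarrow> 'a measure) \<Rightarrow> ('a \<Rightarrow> real) \<Rightarrow> real" where
  "dirichlet_form \<mu> P f =
     (THE e. \<exists>u v. form_approx \<mu> P f u v \<and> (\<lambda>n. LINT x|\<mu>. - v n x * u n x) \<longlonglongrightarrow> e)"

text \<open>The best constant is \<open>\<infinity>\<close> if there is no Poincare inequality.\<close>

definition poincare_constant :: "'a measure \<Rightarrow> (real \<Rightarrow> 'a \<Rightarrow> 'a measure) \<Rightarrow> ennreal" where
  "poincare_constant \<mu> P = Inf {c. \<forall>g h. L2_generator \<mu> P g h \<longrightarrow>
     ennreal (LINT x|\<mu>. (g x - (LINT y|\<mu>. g y))\<^sup>2) \<le> c * ennreal (dirichlet_form \<mu> P g)}"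

definition fisher_information ::
    "'a measure \<Rightarrow> (real \<Rightarrow> 'a \<Rightarrow> 'a measure) \<Rightarrow> 'a measure \<Rightarrow> ennreal" where
  "fisher_information \<mu> P \<nu> =
     (let r = (\<lambda>x. sqrt (enn2real (RN_deriv \<mu> \<nu> x))) in
      if absolutely_continuous \<mu> \<nu> \<and> r \<in> dirichlet_domain \<mu> P
      then ennreal (dirichlet_form \<mu> P r) else \<infinity>)"

subsection \<open>Extended generator\<close>

text \<open>\<open>extended_generator M F X h g\<close>: the continuous function \<open>h\<close> belongs to the extended domain, and
  \<open>g\<close> is a version of its image.\<close>

definition extended_generator ::
    "'w measure \<Rightarrow> (ennreal \<Rightarrow> 'w measure) \<Rightarrow> (real \<Rightarrow> 'w \<Rightarrow> 'a::topological_space) \<Rightarrow>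
     ('a \<Rightarrow> real) \<Rightarrow> ('a \<Rightarrow> real) \<Rightarrow> bool" where
  "extended_generator M F X h g \<longleftrightarrow>
     continuous_on UNIV h \<and> g \<in> borel_measurable borel \<and>
     (AE \<omega> in M. \<forall>t\<ge>0. set_integrable lborel {0..t} (\<lambda>s. g (X s \<omega>))) \<and>
     local_martingale_ct M F
       (\<lambda>t \<omega>. h (X t \<omega>) - h (X 0 \<omega>) - (LINT s:{0..t}|lborel. g (X s \<omega>)))"

subsection \<open>Weighted total variation\<close>

text \<open>The value of \<open>\<parallel>\<psi>(\<nu> - \<mu>)\<parallel>\<close> may be \<open>\<infinity>\<close>. The supremum runs over the measurable \<open>u\<close> for which
  \<open>\<integral>u d(\<nu> - \<mu>)\<close> is meaningful, i.e. which are integrable for both measures.\<close>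

definition weighted_tv :: "('a \<Rightarrow> real) \<Rightarrow> 'a measure \<Rightarrow> 'a measure \<Rightarrow> ennreal" where
  "weighted_tv \<psi> \<nu> \<mu> =
     (SUP u \<in> {u \<in> borel_measurable \<mu>. (\<forall>x. \<bar>u x\<bar> \<le> \<psi> x) \<and> integrable \<mu> u \<and> integrable \<nu> u}.
        ennreal ((LINT x|\<nu>. u x) - (LINT x|\<mu>. u x)))"

definition ennsqrt :: "ennreal \<Rightarrow> ennreal" where
  "ennsqrt x = (if x = \<infinity> then \<infinity> else ennreal (sqrt (enn2real x)))"

end

theory Submission
  imports Defs
begin

text \<open>With \<open>g = sqrt f\<close>, \<open>f = d\<nu>/d\<mu>\<close>, the elementary bound
  \<open>\<bar>g\<^sup>2 - 1\<bar> \<le> (a + 1)/(a - 1) (g - 1)\<^sup>2 + a \<bar>g - 1\<bar>\<close> for \<open>a \<ge> 2\<close>, the Cauchy-Schwarz inequality and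
  \<open>\<integral> (g - 1)\<^sup>2 d\<mu> \<le> 2 Var(g) \<le> 2 c\<^sub>P I\<close> reduce both estimates to
  \<open>\<integral> \<phi> h\<^sup>2 d\<mu> \<le> \<E>(h, h) + b \<integral> h\<^sup>2 d\<mu>\<close> for \<open>h = g - 1\<close>.

  Since \<open>\<L>U \<le> (b - \<phi>) U\<close>, a Gronwall estimate for the paths of the stopped martingale followed by Fatou's
  lemma gives \<open>P\<^sub>tU + \<integral>\<^sub>0\<^sup>t P\<^sub>r(\<phi>U) dr \<le> U / (1 - b t)\<close> as soon as \<open>b t < 1\<close>; no stochastic calculus
  is involved. Reversibility and \<open>2 \<bar>h(x) h(y)\<bar> \<le> h(x)\<^sup>2 U(y)/U(x) + h(y)\<^sup>2 U(x)/U(y)\<close> yield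
  \<open>\<langle>h, P\<^sub>th\<rangle> \<le> \<integral> h\<^sup>2 P\<^sub>tU / U d\<mu>\<close>. Inserting the first estimate in the second, dividing by \<open>t\<close> and letting
  \<open>t \<rightarrow> 0\<close> gives the inequality on the domain of the generator, and closability of the form extends it.\<close>

subsection \<open>Square-integrable functions\<close>

text \<open>\<open>U\<close> lies only in the extended domain, so neither \<open>U\<close> nor
  \<open>LU\<close> need be integrable, and the kernels obey their semigroup laws only almost
  everywhere. The estimate for \<open>U\<close> is therefore never stated pointwise: it is an
  expectation under \<open>M\<close>, weighted by \<open>k (X 0) / U (X 0)\<close>, which cancels
  the possibly non-integrable \<open>U (X 0)\<close> and leaves a bound by the integral of
  \<open>k\<close>. Bounds that could be infinite stay nonnegative integrals, and truncations are
  removed by Fatou's lemma.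

  The factor \<open>1 / (1 - b * t)\<close> replaces the sharper exponential of
  \<open>b * t\<close>; both are \<open>1 + b * t\<close> to first order, which is all that the
  derivative at \<open>t = 0\<close> sees.

  \<open>\<phi> * U\<close> need not be square-integrable, so strong continuity cannot be applied to
  it; bounded minorants of \<open>\<phi> * U\<close> and of \<open>h^2 / U\<close> are used in the
  limit \<open>t -> 0\<close>, and their product recovers \<open>\<phi> * h^2\<close>.

  Only the first inequality uses the elementary bound. The second factors \<open>g^2 - 1\<close>
  into \<open>g - 1\<close> and \<open>g + 1\<close>, the latter of norm at most 2; this gives the
  constant \<open>4 * (1 + 2 * b * cP)\<close>, below the stated one.\<close>

lemma psd_cross_term_bound:
  fixes A B c :: real
  assumes psd: "\<And>s r. 0 \<le> s\<^sup>2 * A + 2 * s * r * c + r\<^sup>2 * B"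
  shows "c\<^sup>2 \<le> A * B"
proof -
  have A: "0 \<le> A" and B: "0 \<le> B"
    using psd[of 1 0] psd[of 0 1] by auto
  \<comment> \<open>The discriminant argument without division: the form at \<open>(B, -c)\<close>
    and at \<open>(-c, A)\<close> equals \<open>A * B - c^2\<close> times \<open>B\<close> and times
    \<open>A\<close>. The degenerate case \<open>A = B = 0\<close> is settled at
    \<open>(1, -c)\<close>.\<close>
  have 1: "0 \<le> B * (A * B - c\<^sup>2)" and 2: "0 \<le> A * (A * B - c\<^sup>2)"
    using psd[of B "-c"] psd[of "-c" A] by (auto simp: power2_eq_square algebra_simps)
  show ?thesis
  proof (cases "A = 0 \<and> B = 0")
    case True
    then show ?thesis using psd[of 1 "-c"] by (simp add: power2_eq_square)
  next
    case False
    then have "A * B - c\<^sup>2 \<ge> 0"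
      using A B 1 2 by (metis order_le_less zero_le_mult_iff order.strict_iff_order not_le)
    then show ?thesis by simp
  qed
qed

lemma L2_D [dest]: "f \<in> L2 \<mu> \<Longrightarrow> f \<in> borel_measurable \<mu>" "f \<in> L2 \<mu> \<Longrightarrow> integrable \<mu> (\<lambda>x. (f x)\<^sup>2)"
  by (auto simp: L2_def)

lemma L2_mult_integrable:
  assumes "f \<in> L2 \<mu>" "g \<in> L2 \<mu>"
  shows "integrable \<mu> (\<lambda>x. f x * g x)"
proof (rule Bochner_Integration.integrable_bound)
  show "integrable \<mu> (\<lambda>x. (f x)\<^sup>2 + (g x)\<^sup>2)" using assms by auto
  show "(\<lambda>x. f x * g x) \<in> borel_measurable \<mu>" using assms[THEN L2_D(1)] by auto
  have "\<bar>f x * g x\<bar> \<le> (f x)\<^sup>2 + (g x)\<^sup>2" for x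
  proof -
    have "2 * (\<bar>f x\<bar> * \<bar>g x\<bar>) \<le> (f x)\<^sup>2 + (g x)\<^sup>2"
      using sum_squares_bound[of "\<bar>f x\<bar>" "\<bar>g x\<bar>"] by (simp add: mult.assoc)
    moreover have "0 \<le> \<bar>f x\<bar> * \<bar>g x\<bar>" by simp
    ultimately show ?thesis unfolding abs_mult by linarith
  qed
  then show "AE x in \<mu>. norm (f x * g x) \<le> norm ((f x)\<^sup>2 + (g x)\<^sup>2)"
    by auto
qed

lemma L2_lincomb:
  assumes "f \<in> L2 \<mu>" "g \<in> L2 \<mu>"
  shows "(\<lambda>x. a * f x + b * g x) \<in> L2 \<mu>"
proof -
  have "integrable \<mu> (\<lambda>x. a\<^sup>2 * (f x)\<^sup>2 + 2 * a * b * (f x * g x) + b\<^sup>2 * (g x)\<^sup>2)"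
    by (intro Bochner_Integration.integrable_add integrable_mult_right L2_mult_integrable L2_D(2) assms)
  moreover have "(a * f x + b * g x)\<^sup>2 = a\<^sup>2 * (f x)\<^sup>2 + 2 * a * b * (f x * g x) + b\<^sup>2 * (g x)\<^sup>2" for x
    by (simp add: power2_eq_square algebra_simps)
  ultimately show ?thesis
    using assms[THEN L2_D(1)] by (auto simp: L2_def)
qed

lemma L2_diff: "f \<in> L2 \<mu> \<Longrightarrow> g \<in> L2 \<mu> \<Longrightarrow> (\<lambda>x. f x - g x) \<in> L2 \<mu>"
  using L2_lincomb[of f \<mu> g 1 "-1"] by simp

lemma L2_add: "f \<in> L2 \<mu> \<Longrightarrow> g \<in> L2 \<mu> \<Longrightarrow> (\<lambda>x. f x + g x) \<in> L2 \<mu>"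
  using L2_lincomb[of f \<mu> g 1 1] by simp

lemma L2_cmult: "f \<in> L2 \<mu> \<Longrightarrow> (\<lambda>x. c * f x) \<in> L2 \<mu>"
  using L2_lincomb[of f \<mu> f c 0] by simp

lemma L2_mono:
  assumes "f \<in> L2 \<mu>" "g \<in> borel_measurable \<mu>" "\<And>x. \<bar>g x\<bar> \<le> \<bar>f x\<bar>"
  shows "g \<in> L2 \<mu>"
proof -
  have "integrable \<mu> (\<lambda>x. (g x)\<^sup>2)"
    by (rule Bochner_Integration.integrable_bound[OF L2_D(2)[OF assms(1)]])
      (use assms in \<open>auto simp: abs_le_square_iff[symmetric]\<close>)
  with assms show ?thesis by (auto simp: L2_def)
qed

lemma L2_abs: "f \<in> L2 \<mu> \<Longrightarrow> (\<lambda>x. \<bar>f x\<bar>) \<in> L2 \<mu>"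
  by (rule L2_mono[of f \<mu>]) (auto dest: L2_D(1))

lemma (in finite_measure) L2_bounded:
  assumes "f \<in> borel_measurable M" "\<And>x. \<bar>f x\<bar> \<le> B"
  shows "f \<in> L2 M"
proof -
  have "(\<lambda>_. B) \<in> L2 M" by (simp add: L2_def)
  moreover have "\<bar>f x\<bar> \<le> \<bar>B\<bar>" for x using assms(2)[of x] by linarith
  ultimately show ?thesis using assms(1) by (auto intro: L2_mono)
qed

lemma (in finite_measure) L2_const: "(\<lambda>_. c) \<in> L2 M"
  by (auto intro: L2_bounded[of _ "\<bar>c\<bar>"])

lemma (in finite_measure) L2_integrable:
  assumes "f \<in> L2 M"
  shows "integrable M f"
  using L2_mult_integrable[OF assms L2_const[of 1]] by simp

lemma L2_norm_nonneg [simp]: "0 \<le> L2_norm \<mu> f"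
  by (simp add: L2_norm_def)

lemma L2_norm_sq: "(L2_norm \<mu> f)\<^sup>2 = (LINT x|\<mu>. (f x)\<^sup>2)"
  by (simp add: L2_norm_def)

lemma L2_norm_minus_commute: "L2_norm \<mu> (\<lambda>x. f x - g x) = L2_norm \<mu> (\<lambda>x. g x - f x)"
  by (simp add: L2_norm_def power2_commute)

lemma L2_lincomb_integral:
  assumes "f \<in> L2 \<mu>" "g \<in> L2 \<mu>"
  shows "(LINT x|\<mu>. (a * f x + b * g x)\<^sup>2)
    = a\<^sup>2 * (LINT x|\<mu>. (f x)\<^sup>2) + 2 * a * b * (LINT x|\<mu>. f x * g x) + b\<^sup>2 * (LINT x|\<mu>. (g x)\<^sup>2)"
proof -
  have "(LINT x|\<mu>. (a * f x + b * g x)\<^sup>2)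
    = (LINT x|\<mu>. a\<^sup>2 * (f x)\<^sup>2 + 2 * a * b * (f x * g x) + b\<^sup>2 * (g x)\<^sup>2)"
    by (intro Bochner_Integration.integral_cong) (auto simp: power2_eq_square algebra_simps)
  also have "\<dots> = a\<^sup>2 * (LINT x|\<mu>. (f x)\<^sup>2) + 2 * a * b * (LINT x|\<mu>. f x * g x) + b\<^sup>2 * (LINT x|\<mu>. (g x)\<^sup>2)"
    using assms L2_mult_integrable[OF assms] by (auto simp: L2_D(2))
  finally show ?thesis .
qed

text \<open>The discriminant bound for the integral of \<open>(s * f + r * g)^2\<close> as a
  quadratic form in \<open>s\<close> and \<open>r\<close>; the Dirichlet form is treated later by
  the same scalar lemma.\<close>

lemma L2_Cauchy_Schwarz:
  assumes "f \<in> L2 \<mu>" "g \<in> L2 \<mu>"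
  shows "\<bar>LINT x|\<mu>. f x * g x\<bar> \<le> L2_norm \<mu> f * L2_norm \<mu> g"
proof -
  have "(LINT x|\<mu>. f x * g x)\<^sup>2 \<le> (LINT x|\<mu>. (f x)\<^sup>2) * (LINT x|\<mu>. (g x)\<^sup>2)"
  proof (rule psd_cross_term_bound)
    show "0 \<le> s\<^sup>2 * (LINT x|\<mu>. (f x)\<^sup>2) + 2 * s * r * (LINT x|\<mu>. f x * g x) + r\<^sup>2 * (LINT x|\<mu>. (g x)\<^sup>2)"
      for s r
      unfolding L2_lincomb_integral[OF assms, symmetric] by simp
  qed
  then have "sqrt ((LINT x|\<mu>. f x * g x)\<^sup>2) \<le> sqrt ((LINT x|\<mu>. (f x)\<^sup>2) * (LINT x|\<mu>. (g x)\<^sup>2))"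
    by (rule real_sqrt_le_mono)
  then show ?thesis by (simp add: L2_norm_def real_sqrt_mult)
qed

lemma L2_norm_triangle:
  assumes "f \<in> L2 \<mu>" "g \<in> L2 \<mu>"
  shows "L2_norm \<mu> (\<lambda>x. f x + g x) \<le> L2_norm \<mu> f + L2_norm \<mu> g"
proof (rule power2_le_imp_le)
  have "(L2_norm \<mu> (\<lambda>x. f x + g x))\<^sup>2 = (L2_norm \<mu> f)\<^sup>2 + 2 * (LINT x|\<mu>. f x * g x) + (L2_norm \<mu> g)\<^sup>2"
    using L2_lincomb_integral[OF assms, of 1 1] by (simp add: L2_norm_sq)
  also have "\<dots> \<le> (L2_norm \<mu> f)\<^sup>2 + 2 * (L2_norm \<mu> f * L2_norm \<mu> g) + (L2_norm \<mu> g)\<^sup>2"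
    using L2_Cauchy_Schwarz[OF assms] by simp
  finally show "(L2_norm \<mu> (\<lambda>x. f x + g x))\<^sup>2 \<le> (L2_norm \<mu> f + L2_norm \<mu> g)\<^sup>2"
    by (simp add: power2_sum)
qed simp

lemma L2_norm_diff_triangle:
  assumes "f \<in> L2 \<mu>" "g \<in> L2 \<mu>"
  shows "\<bar>L2_norm \<mu> f - L2_norm \<mu> g\<bar> \<le> L2_norm \<mu> (\<lambda>x. f x - g x)"
  using L2_norm_triangle[OF L2_diff[OF assms] assms(2)]
    L2_norm_triangle[OF L2_diff[OF assms(2,1)] assms(1)] L2_norm_minus_commute[of \<mu> f g]
  by simp

lemma L2_norm_tendsto:
  assumes "eventually (\<lambda>n. f n \<in> L2 \<mu>) F" "g \<in> L2 \<mu>"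
    and "((\<lambda>n. L2_norm \<mu> (\<lambda>x. f n x - g x)) \<longlongrightarrow> 0) F"
  shows "((\<lambda>n. L2_norm \<mu> (f n)) \<longlongrightarrow> L2_norm \<mu> g) F"
  by (rule Lim_transform_eq[THEN iffD2, OF _ tendsto_const[of "L2_norm \<mu> g"]],
      rule Lim_null_comparison[OF _ assms(3)], rule eventually_mono[OF assms(1)])
    (use L2_norm_diff_triangle[OF _ assms(2)] in auto)

text \<open>The filter is arbitrary because both the limit at 0 from the right and limits of
  sequences occur. Membership in \<open>L2 \<mu>\<close> is asked only eventually, as
  \<open>semigroup_op P t\<close> is controlled for nonnegative \<open>t\<close> alone.\<close>

lemma L2_inner_tendsto:
  assumes f: "eventually (\<lambda>n. f n \<in> L2 \<mu>) F" and g: "g \<in> L2 \<mu>" and h: "h \<in> L2 \<mu>"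
    and lim: "((\<lambda>n. L2_norm \<mu> (\<lambda>x. f n x - g x)) \<longlongrightarrow> 0) F"
  shows "((\<lambda>n. LINT x|\<mu>. f n x * h x) \<longlongrightarrow> (LINT x|\<mu>. g x * h x)) F"
proof (rule LIM_zero_cancel, rule Lim_null_comparison)
  show "((\<lambda>n. L2_norm \<mu> (\<lambda>x. f n x - g x) * L2_norm \<mu> h) \<longlongrightarrow> 0) F"
    by (rule tendsto_mult_left_zero[OF lim])
  show "eventually (\<lambda>n. norm ((LINT x|\<mu>. f n x * h x) - (LINT x|\<mu>. g x * h x))
      \<le> L2_norm \<mu> (\<lambda>x. f n x - g x) * L2_norm \<mu> h) F"
  proof (rule eventually_mono[OF f])
    fix n assume f: "f n \<in> L2 \<mu>"
    have "(LINT x|\<mu>. f n x * h x) - (LINT x|\<mu>. g x * h x) = (LINT x|\<mu>. (f n x - g x) * h x)"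
      by (subst Bochner_Integration.integral_diff[symmetric])
        (use f g h in \<open>auto intro!: L2_mult_integrable simp: algebra_simps\<close>)
    then show "norm ((LINT x|\<mu>. f n x * h x) - (LINT x|\<mu>. g x * h x))
        \<le> L2_norm \<mu> (\<lambda>x. f n x - g x) * L2_norm \<mu> h"
      using L2_Cauchy_Schwarz[OF L2_diff[OF f g] h] by simp
  qed
qed

subsection \<open>The two-point law of the process\<close>

context reversible_markov_process
begin

sublocale mu: prob_space \<mu>
  by (rule prob_space_mu)

declare sets_mu [measurable_cong]

lemma X_measurable: "0 \<le> t \<Longrightarrow> X t \<in> borel_measurable M"
  using measurable_from_subalg[OF sub_algebra adapted] .

lemma kernel_subprob: "0 \<le> t \<Longrightarrow> P t \<in> borel \<rightarrow>\<^sub>M subprob_algebra borel"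
  by (rule measurable_prob_algebraD[OF kernel])

lemma prob_space_kernel: "0 \<le> t \<Longrightarrow> prob_space (P t x)"
  using measurable_space[OF kernel, of t x] by (auto simp: space_prob_algebra)

lemma sets_kernel_borel [simp]: "0 \<le> t \<Longrightarrow> sets (P t x) = sets borel"
  using measurable_space[OF kernel, of t x] by (auto simp: space_prob_algebra)

lemma borel_measurable_mu: "borel_measurable \<mu> = borel_measurable borel"
  by (rule measurable_cong_sets[OF sets_mu refl])

lemma space_mu: "space \<mu> = UNIV"
  using sets_eq_imp_space_eq[OF sets_mu] by simp

lemma semigroup_op_measurable:
  assumes "0 \<le> t" "f \<in> borel_measurable borel"
  shows "semigroup_op P t f \<in> borel_measurable borel"
  unfolding semigroup_op_def
  by (rule measurable_compose[OF kernel_subprob[OF assms(1)]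
        integral_measurable_subprob_algebra[OF assms(2)]])

lemma kernel_nn_integral_measurable:
  assumes "0 \<le> t" "f \<in> borel_measurable borel"
  shows "(\<lambda>x. \<integral>\<^sup>+y. f y \<partial>P t x) \<in> borel_measurable borel"
  by (rule measurable_compose[OF kernel_subprob[OF assms(1)]
        nn_integral_measurable_subprob_algebra[OF assms(2)]])

text \<open>The event \<open>X 0 \<in> A\<close> belongs to \<open>F 0\<close>, so the conditional
  expectation in the Markov property can be tested against it; the initial law then turns the result
  into an integral over \<mu>.\<close>

lemma two_point_indicator:
  assumes t: "0 \<le> t" and [measurable]: "A \<in> sets borel" "B \<in> sets borel"
  shows "(\<integral>\<^sup>+\<omega>. indicator A (X 0 \<omega>) * indicator B (X t \<omega>) \<partial>M)
    = (\<integral>\<^sup>+x. indicator A x * emeasure (P t x) B \<partial>\<mu>)"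
proof -
  note X_measurable[OF t, measurable] X_measurable[of 0, simplified, measurable]
    adapted[of 0, simplified, measurable]
  interpret sub: finite_measure_subalgebra M "F 0"
    by standard (rule sub_algebra)
  let ?p = "semigroup_op P t (indicator B)"
  have p: "?p x = measure (P t x) B" for x
    using prob_space.emeasure_space_1[OF prob_space_kernel[OF t]] t
    by (simp add: semigroup_op_def sets_eq_imp_space_eq[OF sets_kernel_borel[OF t]])
  have p_meas [measurable]: "?p \<in> borel_measurable borel"
    by (rule semigroup_op_measurable[OF t]) simp
  have p_bound: "0 \<le> ?p x" "?p x \<le> 1" for x
    unfolding p using prob_space.prob_le_1[OF prob_space_kernel[OF t]] by auto
  have "(LINT \<omega>|M. indicator A (X 0 \<omega>) * indicator B (X t \<omega>))
      = (LINT \<omega>|M. indicator A (X 0 \<omega>) * real_cond_exp M (F 0) (\<lambda>\<omega>. indicator B (X t \<omega>)) \<omega>)"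
    by (rule sub.real_cond_exp_intg(2)[symmetric])
      (auto intro!: integrable_const_bound[where B=1] simp: indicator_def)
  also have "\<dots> = (LINT \<omega>|M. indicator A (X 0 \<omega>) * ?p (X 0 \<omega>))"
  proof (rule integral_cong_AE)
    have "AE \<omega> in M. real_cond_exp M (F (ennreal 0)) (\<lambda>\<omega>. indicator B (X (0 + t) \<omega>)) \<omega> = ?p (X 0 \<omega>)"
      by (rule markov) (use t in \<open>auto intro!: boundedI[where B=1] simp: indicator_def\<close>)
    then show "AE \<omega> in M. indicator A (X 0 \<omega>) * real_cond_exp M (F 0) (\<lambda>\<omega>. indicator B (X t \<omega>)) \<omega>
        = indicator A (X 0 \<omega>) * ?p (X 0 \<omega>)"
      by auto
  qed auto
  also have "\<dots> = (LINT x|distr M borel (X 0). indicator A x * ?p x)"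
    by (rule integral_distr[symmetric]) auto
  finally have eq: "(LINT \<omega>|M. indicator A (X 0 \<omega>) * indicator B (X t \<omega>)) = (LINT x|\<mu>. indicator A x * ?p x)"
    by (simp add: initial_law)
  have "(\<integral>\<^sup>+\<omega>. indicator A (X 0 \<omega>) * indicator B (X t \<omega>) \<partial>M)
      = (\<integral>\<^sup>+\<omega>. ennreal (indicator A (X 0 \<omega>) * indicator B (X t \<omega>)) \<partial>M)"
    by (intro nn_integral_cong) (auto simp: indicator_def)
  also have "\<dots> = ennreal (LINT \<omega>|M. indicator A (X 0 \<omega>) * indicator B (X t \<omega>))"
    by (rule nn_integral_eq_integral)
      (auto intro!: integrable_const_bound[where B=1] simp: indicator_def)
  also have "\<dots> = (\<integral>\<^sup>+x. ennreal (indicator A x * ?p x) \<partial>\<mu>)"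
    unfolding eq using p_bound
    by (intro nn_integral_eq_integral[symmetric] mu.integrable_const_bound[where B=1])
       (auto simp: indicator_def)
  also have "\<dots> = (\<integral>\<^sup>+x. indicator A x * emeasure (P t x) B \<partial>\<mu>)"
    by (intro nn_integral_cong)
      (auto simp: indicator_def p finite_measure.emeasure_eq_measure[OF prob_space.finite_measure[OF prob_space_kernel[OF t]]])
  finally show ?thesis .
qed

text \<open>The rectangle identity is extended one argument at a time, so that no measure on a
  product space is needed: for fixed \<open>B\<close> both sides are measures in \<open>A\<close>,
  which are integrated against \<open>f\<close>; for fixed \<open>f\<close> the same is done in
  \<open>B\<close> and \<open>g\<close>.\<close>

lemma two_point_nn_integral:
  assumes t: "0 \<le> t" and [measurable]: "f \<in> borel_measurable borel" "g \<in> borel_measurable borel"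
  shows "(\<integral>\<^sup>+\<omega>. f (X 0 \<omega>) * g (X t \<omega>) \<partial>M) = (\<integral>\<^sup>+x. f x * (\<integral>\<^sup>+y. g y \<partial>P t x) \<partial>\<mu>)"
proof -
  note X_measurable[OF t, measurable] X_measurable[of 0, simplified, measurable]
  note kernel_subprob[OF t, measurable] kernel_nn_integral_measurable[OF t, measurable]
  have f_indicator: "(\<integral>\<^sup>+\<omega>. indicator B (X t \<omega>) * f (X 0 \<omega>) \<partial>M) = (\<integral>\<^sup>+x. emeasure (P t x) B * f x \<partial>\<mu>)"
    if [measurable]: "B \<in> sets borel" for B
  proof -
    have "distr (density M (\<lambda>\<omega>. indicator B (X t \<omega>))) borel (X 0) = density \<mu> (\<lambda>x. emeasure (P t x) B)"
    proof (rule measure_eqI)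
      fix A assume "A \<in> sets (distr (density M (\<lambda>\<omega>. indicator B (X t \<omega>))) borel (X 0))"
      then have [measurable]: "A \<in> sets borel" by simp
      have "emeasure (distr (density M (\<lambda>\<omega>. indicator B (X t \<omega>))) borel (X 0)) A
        = (\<integral>\<^sup>+\<omega>. indicator B (X t \<omega>) * indicator (X 0 -` A \<inter> space M) \<omega> \<partial>M)"
        by (simp add: emeasure_distr emeasure_density)
      also have "\<dots> = (\<integral>\<^sup>+\<omega>. indicator A (X 0 \<omega>) * indicator B (X t \<omega>) \<partial>M)"
        by (intro nn_integral_cong) (auto simp: indicator_def)
      also have "\<dots> = (\<integral>\<^sup>+x. indicator A x * emeasure (P t x) B \<partial>\<mu>)"
        by (rule two_point_indicator[OF t]) auto
      also have "\<dots> = emeasure (density \<mu> (\<lambda>x. emeasure (P t x) B)) A"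
        by (subst emeasure_density) (auto simp: mult.commute sets_mu)
      finally show "emeasure (distr (density M (\<lambda>\<omega>. indicator B (X t \<omega>))) borel (X 0)) A
        = emeasure (density \<mu> (\<lambda>x. emeasure (P t x) B)) A" .
    qed (simp add: sets_mu)
    from arg_cong[OF this, of "\<lambda>N. integral\<^sup>N N f"] show ?thesis
      by (simp add: nn_integral_distr nn_integral_density)
  qed
  have bind_kernel: "P t \<in> density \<mu> f \<rightarrow>\<^sub>M subprob_algebra borel"
    by simp
  have "distr (density M (\<lambda>\<omega>. f (X 0 \<omega>))) borel (X t) = density \<mu> f \<bind> P t"
  proof (rule measure_eqI)
    show "sets (distr (density M (\<lambda>\<omega>. f (X 0 \<omega>))) borel (X t)) = sets (density \<mu> f \<bind> P t)"
      by (subst sets_bind[where N=borel]) (auto simp: space_mu sets_kernel_borel[OF t])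
    fix B assume "B \<in> sets (distr (density M (\<lambda>\<omega>. f (X 0 \<omega>))) borel (X t))"
    then have [measurable]: "B \<in> sets borel" by simp
    have "emeasure (distr (density M (\<lambda>\<omega>. f (X 0 \<omega>))) borel (X t)) B
        = (\<integral>\<^sup>+\<omega>. f (X 0 \<omega>) * indicator (X t -` B \<inter> space M) \<omega> \<partial>M)"
      by (simp add: emeasure_distr emeasure_density)
    also have "\<dots> = (\<integral>\<^sup>+\<omega>. indicator B (X t \<omega>) * f (X 0 \<omega>) \<partial>M)"
      by (intro nn_integral_cong) (auto simp: indicator_def)
    also have "\<dots> = (\<integral>\<^sup>+x. f x * emeasure (P t x) B \<partial>\<mu>)"
      by (subst f_indicator) (auto simp: mult.commute)
    also have "\<dots> = (\<integral>\<^sup>+x. emeasure (P t x) B \<partial>density \<mu> f)"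
      by (subst nn_integral_density) auto
    also have "\<dots> = emeasure (density \<mu> f \<bind> P t) B"
      by (subst emeasure_bind[OF _ bind_kernel]) (auto simp: space_mu)
    finally show "emeasure (distr (density M (\<lambda>\<omega>. f (X 0 \<omega>))) borel (X t)) B = emeasure (density \<mu> f \<bind> P t) B" .
  qed
  from arg_cong[OF this, of "\<lambda>N. integral\<^sup>N N g"] show ?thesis
    by (simp add: nn_integral_distr nn_integral_density nn_integral_bind[OF _ bind_kernel])
qed

lemma nn_integral_kernel_mu:
  assumes t: "0 \<le> t" and [measurable]: "g \<in> borel_measurable borel"
  shows "(\<integral>\<^sup>+x. \<integral>\<^sup>+y. g y \<partial>P t x \<partial>\<mu>) = (\<integral>\<^sup>+x. g x \<partial>\<mu>)"
proof -
  have "P t \<in> \<mu> \<rightarrow>\<^sub>M subprob_algebra borel"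
    using kernel_subprob[OF t] by simp
  then have "(\<integral>\<^sup>+x. g x \<partial>(\<mu> \<bind> P t)) = (\<integral>\<^sup>+x. \<integral>\<^sup>+y. g y \<partial>P t x \<partial>\<mu>)"
    by (intro nn_integral_bind) auto
  then show ?thesis by (simp add: invariant[OF t])
qed

lemma law_X:
  assumes t: "0 \<le> t"
  shows "distr M borel (X t) = \<mu>"
proof (rule measure_eqI)
  fix A assume "A \<in> sets (distr M borel (X t))"
  then have [measurable]: "A \<in> sets borel" by simp
  note X_measurable[OF t, measurable]
  have "emeasure (distr M borel (X t)) A = (\<integral>\<^sup>+\<omega>. 1 * indicator A (X t \<omega>) \<partial>M)"
    using nn_integral_distr[of "X t" M borel "indicator A"] by simp
  also have "\<dots> = (\<integral>\<^sup>+x. indicator A x \<partial>\<mu>)"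
    using two_point_nn_integral[OF t, of "\<lambda>_. 1" "indicator A"] nn_integral_kernel_mu[OF t, of "indicator A"] by simp
  finally show "emeasure (distr M borel (X t)) A = emeasure \<mu> A"
    by (simp add: sets_mu)
qed (simp add: sets_mu)

lemma integral_law:
  fixes f :: "'a \<Rightarrow> real"
  assumes "0 \<le> t" "f \<in> borel_measurable borel"
  shows "(LINT \<omega>|M. f (X t \<omega>)) = (LINT x|\<mu>. f x)"
  using integral_distr[OF X_measurable[OF assms(1)], of f] assms by (simp add: law_X)

lemma integrable_law:
  fixes f :: "'a \<Rightarrow> real"
  assumes "0 \<le> t" "f \<in> borel_measurable borel"
  shows "integrable M (\<lambda>\<omega>. f (X t \<omega>)) \<longleftrightarrow> integrable \<mu> f"
  using integrable_distr_eq[OF X_measurable[OF assms(1)], of f] assms by (simp add: law_X)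

lemma AE_law:
  assumes "0 \<le> t" "AE x in \<mu>. Q x"
  shows "AE \<omega> in M. Q (X t \<omega>)"
  by (rule AE_distrD[OF X_measurable[OF assms(1)]], unfold law_X[OF assms(1)], rule assms(2))

text \<open>By invariance the integral of \<open>\<bar>g\<bar>\<close> under \<open>P t x\<close>
  averages over \<mu> to the integral of \<open>\<bar>g\<bar>\<close>, hence is finite for almost
  every \<open>x\<close>. At the exceptional points the Bochner integral in
  \<open>semigroup_op\<close> takes its default value 0, which is why linearity of the semigroup is
  only claimed almost everywhere.\<close>

lemma AE_kernel_integrable:
  fixes g :: "'a \<Rightarrow> real"
  assumes t: "0 \<le> t" and g: "integrable \<mu> g"
  shows "AE x in \<mu>. integrable (P t x) g"
proof -
  have g_meas [measurable]: "g \<in> borel_measurable borel"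
    using borel_measurable_integrable[OF g] by (simp add: borel_measurable_mu)
  have "(\<integral>\<^sup>+x. \<integral>\<^sup>+y. ennreal \<bar>g y\<bar> \<partial>P t x \<partial>\<mu>) = (\<integral>\<^sup>+x. ennreal \<bar>g x\<bar> \<partial>\<mu>)"
    by (rule nn_integral_kernel_mu[OF t]) measurable
  also have "\<dots> < \<infinity>"
    using g by (simp add: integrable_iff_bounded)
  finally have fin: "(\<integral>\<^sup>+x. \<integral>\<^sup>+y. ennreal \<bar>g y\<bar> \<partial>P t x \<partial>\<mu>) \<noteq> \<infinity>"
    by (rule less_imp_neq)
  have "(\<lambda>x. \<integral>\<^sup>+y. ennreal \<bar>g y\<bar> \<partial>P t x) \<in> borel_measurable \<mu>"
    unfolding borel_measurable_mu by (rule kernel_nn_integral_measurable[OF t]) measurable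
  from nn_integral_PInf_AE[OF this fin]
  have "AE x in \<mu>. (\<integral>\<^sup>+y. ennreal \<bar>g y\<bar> \<partial>P t x) \<noteq> \<infinity>" .
  then show ?thesis
  proof eventually_elim
    case (elim x)
    have "g \<in> borel_measurable (P t x)"
      using g_meas measurable_cong_sets[OF sets_kernel_borel[OF t, of x] refl, of borel] by blast
    with elim show ?case
      by (simp add: integrable_iff_bounded top.not_eq_extremum)
  qed
qed

lemma semigroup_op_lincomb:
  fixes f g :: "'a \<Rightarrow> real"
  assumes t: "0 \<le> t" and f: "integrable \<mu> f" and g: "integrable \<mu> g"
  shows "AE x in \<mu>. semigroup_op P t (\<lambda>y. a * f y + b * g y) x
    = a * semigroup_op P t f x + b * semigroup_op P t g x"
  using AE_kernel_integrable[OF t f] AE_kernel_integrable[OF t g]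
  by eventually_elim (simp add: semigroup_op_def)

text \<open>Jensen's inequality under \<open>P t x\<close>, obtained as Cauchy-Schwarz against the
  constant 1, and then integrated using the invariance of \<mu>.\<close>

lemma semigroup_op_L2:
  assumes t: "0 \<le> t" and g: "g \<in> L2 \<mu>"
  shows "semigroup_op P t g \<in> L2 \<mu>"
proof -
  have g_meas [measurable]: "g \<in> borel_measurable borel"
    using L2_D(1)[OF g] borel_measurable_mu by blast
  have "AE x in \<mu>. ennreal ((semigroup_op P t g x)\<^sup>2) \<le> (\<integral>\<^sup>+y. ennreal ((g y)\<^sup>2) \<partial>P t x)"
    using AE_kernel_integrable[OF t L2_D(2)[OF g]]
  proof eventually_elim
    case (elim x)
    interpret Px: prob_space "P t x" by (rule prob_space_kernel[OF t])
    have "g \<in> borel_measurable (P t x)"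
      using g_meas measurable_cong_sets[OF sets_kernel_borel[OF t, of x] refl, of borel] by blast
    with elim have "g \<in> L2 (P t x)" by (simp add: L2_def)
    then have "\<bar>semigroup_op P t g x\<bar> \<le> L2_norm (P t x) g"
      using L2_Cauchy_Schwarz[of g "P t x" "\<lambda>_. 1"] Px.L2_const[of 1]
      by (simp add: semigroup_op_def L2_norm_def Px.prob_space)
    then have "(semigroup_op P t g x)\<^sup>2 \<le> (LINT y|P t x. (g y)\<^sup>2)"
      unfolding L2_norm_sq[symmetric] by (metis L2_norm_nonneg abs_le_square_iff abs_of_nonneg)
    then show ?case
      using elim by (simp add: nn_integral_eq_integral ennreal_leI)
  qed
  then have "(\<integral>\<^sup>+x. ennreal ((semigroup_op P t g x)\<^sup>2) \<partial>\<mu>) \<le> (\<integral>\<^sup>+x. \<integral>\<^sup>+y. ennreal ((g y)\<^sup>2) \<partial>P t x \<partial>\<mu>)"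
    by (rule nn_integral_mono_AE)
  also have "\<dots> = (\<integral>\<^sup>+x. ennreal ((g x)\<^sup>2) \<partial>\<mu>)"
    by (rule nn_integral_kernel_mu[OF t]) measurable
  also have "\<dots> < \<infinity>"
    using L2_D(2)[OF g] by (simp add: integrable_iff_bounded)
  finally have fin: "(\<integral>\<^sup>+x. ennreal ((semigroup_op P t g x)\<^sup>2) \<partial>\<mu>) < \<infinity>" .
  have meas: "semigroup_op P t g \<in> borel_measurable \<mu>"
    unfolding borel_measurable_mu by (rule semigroup_op_measurable[OF t g_meas])
  have "integrable \<mu> (\<lambda>x. (semigroup_op P t g x)\<^sup>2)"
    using fin meas by (intro integrableI_bounded) simp_all
  with meas show ?thesis
    by (simp add: L2_def)
qed

lemma two_point_integrable:
  assumes t: "0 \<le> t" and f: "f \<in> L2 \<mu>" and g: "g \<in> L2 \<mu>"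
  shows "integrable M (\<lambda>\<omega>. f (X 0 \<omega>) * g (X t \<omega>))"
proof -
  have [measurable]: "f \<in> borel_measurable borel" "g \<in> borel_measurable borel"
    using L2_D(1)[OF f] L2_D(1)[OF g] borel_measurable_mu by auto
  note X_measurable[OF t, measurable] X_measurable[of 0, simplified, measurable]
  have "(\<lambda>\<omega>. f (X 0 \<omega>)) \<in> L2 M" "(\<lambda>\<omega>. g (X t \<omega>)) \<in> L2 M"
    using L2_D(2)[OF f] L2_D(2)[OF g] integrable_law[of 0 "\<lambda>x. (f x)\<^sup>2"] integrable_law[OF t, of "\<lambda>x. (g x)\<^sup>2"]
    by (auto simp: L2_def)
  then show ?thesis by (rule L2_mult_integrable)
qed

lemma two_point_nonneg:
  assumes t: "0 \<le> t" and f: "f \<in> L2 \<mu>" and g: "g \<in> L2 \<mu>"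
    and nonneg: "\<And>x. 0 \<le> f x" "\<And>x. 0 \<le> g x"
  shows "(LINT x|\<mu>. f x * semigroup_op P t g x) = (LINT \<omega>|M. f (X 0 \<omega>) * g (X t \<omega>))"
proof -
  have [measurable]: "f \<in> borel_measurable borel" "g \<in> borel_measurable borel"
    using L2_D(1)[OF f] L2_D(1)[OF g] borel_measurable_mu by auto
  note X_measurable[OF t, measurable] X_measurable[of 0, simplified, measurable]
  have Pg: "0 \<le> semigroup_op P t g x" for x
    by (simp add: semigroup_op_def nonneg)
  have "ennreal (LINT x|\<mu>. f x * semigroup_op P t g x) = (\<integral>\<^sup>+x. ennreal (f x * semigroup_op P t g x) \<partial>\<mu>)"
    by (intro nn_integral_eq_integral[symmetric] L2_mult_integrable f semigroup_op_L2[OF t g])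
      (simp add: nonneg Pg)
  also have "\<dots> = (\<integral>\<^sup>+x. ennreal (f x) * (\<integral>\<^sup>+y. ennreal (g y) \<partial>P t x) \<partial>\<mu>)"
    by (rule nn_integral_cong_AE, use AE_kernel_integrable[OF t mu.L2_integrable[OF g]] in eventually_elim)
      (simp add: nn_integral_eq_integral nonneg semigroup_op_def ennreal_mult)
  also have "\<dots> = (\<integral>\<^sup>+\<omega>. ennreal (f (X 0 \<omega>)) * ennreal (g (X t \<omega>)) \<partial>M)"
    by (rule two_point_nn_integral[OF t, symmetric]) auto
  also have "\<dots> = (\<integral>\<^sup>+\<omega>. ennreal (f (X 0 \<omega>) * g (X t \<omega>)) \<partial>M)"
    by (simp add: ennreal_mult nonneg)
  also have "\<dots> = ennreal (LINT \<omega>|M. f (X 0 \<omega>) * g (X t \<omega>))"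
    by (intro nn_integral_eq_integral two_point_integrable t f g) (simp add: nonneg)
  finally show ?thesis
    by (simp add: nonneg Pg)
qed

text \<open>Moves inner products with the semigroup to path space, where the Lyapunov estimate lives
  and where reversibility becomes the exchange of \<open>X 0\<close> and \<open>X t\<close>. The
  split into positive and negative parts is due to \<open>two_point_nonneg\<close>;
  square-integrability keeps the four pieces finite.\<close>

lemma two_point_integral:
  assumes t: "0 \<le> t" and f: "f \<in> L2 \<mu>" and g: "g \<in> L2 \<mu>"
  shows "(LINT x|\<mu>. f x * semigroup_op P t g x) = (LINT \<omega>|M. f (X 0 \<omega>) * g (X t \<omega>))"
proof -
  define p :: "('a \<Rightarrow> real) \<Rightarrow> 'a \<Rightarrow> real" where "p = (\<lambda>h x. max 0 (h x))"
  define n :: "('a \<Rightarrow> real) \<Rightarrow> 'a \<Rightarrow> real" where "n = (\<lambda>h x. max 0 (- h x))"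
  have L2_pn: "p h \<in> L2 \<mu>" "n h \<in> L2 \<mu>" if h: "h \<in> L2 \<mu>" for h
  proof -
    have [measurable]: "h \<in> borel_measurable \<mu>" by (rule L2_D(1)[OF h])
    show "p h \<in> L2 \<mu>" by (rule L2_mono[OF h]) (simp_all add: p_def)
    show "n h \<in> L2 \<mu>" by (rule L2_mono[OF h]) (simp_all add: n_def)
  qed
  have pn_nonneg: "0 \<le> p h x" "0 \<le> n h x" for h x by (simp_all add: p_def n_def)
  have h_eq: "h x = p h x - n h x" for h x by (simp add: p_def n_def)
  have expand: "f x * g y = p f x * p g y - p f x * n g y - n f x * p g y + n f x * n g y" for x y
  proof -
    have "f x * g y = (p f x - n f x) * (p g y - n g y)" by (simp only: h_eq[symmetric])
    then show ?thesis by (simp add: algebra_simps)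
  qed
  have "AE x in \<mu>. semigroup_op P t g x = semigroup_op P t (p g) x - semigroup_op P t (n g) x"
    using semigroup_op_lincomb[OF t mu.L2_integrable[OF L2_pn(1)[OF g]] mu.L2_integrable[OF L2_pn(2)[OF g]], of 1 "-1"]
    by (simp add: h_eq[symmetric])
  then have eq: "AE x in \<mu>. f x * semigroup_op P t g x = p f x * semigroup_op P t (p g) x
      - p f x * semigroup_op P t (n g) x - n f x * semigroup_op P t (p g) x + n f x * semigroup_op P t (n g) x"
  proof eventually_elim
    case (elim x)
    have "f x * semigroup_op P t g x = (p f x - n f x) * (semigroup_op P t (p g) x - semigroup_op P t (n g) x)"
      by (simp only: h_eq[symmetric] elim)
    then show ?case by (simp add: algebra_simps)
  qed
  note meas [measurable] = semigroup_op_L2[OF t g, THEN L2_D(1)] f[THEN L2_D(1)]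
    L2_pn(1)[OF f, THEN L2_D(1)] L2_pn(2)[OF f, THEN L2_D(1)]
    semigroup_op_L2[OF t L2_pn(1)[OF g], THEN L2_D(1)] semigroup_op_L2[OF t L2_pn(2)[OF g], THEN L2_D(1)]
  have "(LINT x|\<mu>. f x * semigroup_op P t g x) = (LINT x|\<mu>. p f x * semigroup_op P t (p g) x
      - p f x * semigroup_op P t (n g) x - n f x * semigroup_op P t (p g) x + n f x * semigroup_op P t (n g) x)"
    by (rule integral_cong_AE[OF _ _ eq]) measurable
  also have "\<dots> = (LINT x|\<mu>. p f x * semigroup_op P t (p g) x) - (LINT x|\<mu>. p f x * semigroup_op P t (n g) x)
      - (LINT x|\<mu>. n f x * semigroup_op P t (p g) x) + (LINT x|\<mu>. n f x * semigroup_op P t (n g) x)"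
    using L2_mult_integrable[OF L2_pn(1)[OF f] semigroup_op_L2[OF t L2_pn(1)[OF g]]]
      L2_mult_integrable[OF L2_pn(1)[OF f] semigroup_op_L2[OF t L2_pn(2)[OF g]]]
      L2_mult_integrable[OF L2_pn(2)[OF f] semigroup_op_L2[OF t L2_pn(1)[OF g]]]
      L2_mult_integrable[OF L2_pn(2)[OF f] semigroup_op_L2[OF t L2_pn(2)[OF g]]]
    by simp
  also have "\<dots> = (LINT \<omega>|M. p f (X 0 \<omega>) * p g (X t \<omega>)) - (LINT \<omega>|M. p f (X 0 \<omega>) * n g (X t \<omega>))
      - (LINT \<omega>|M. n f (X 0 \<omega>) * p g (X t \<omega>)) + (LINT \<omega>|M. n f (X 0 \<omega>) * n g (X t \<omega>))"
    by (simp only: two_point_nonneg[OF t L2_pn(1)[OF f] L2_pn(1)[OF g] pn_nonneg(1) pn_nonneg(1)]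
      two_point_nonneg[OF t L2_pn(1)[OF f] L2_pn(2)[OF g] pn_nonneg(1) pn_nonneg(2)]
      two_point_nonneg[OF t L2_pn(2)[OF f] L2_pn(1)[OF g] pn_nonneg(2) pn_nonneg(1)]
      two_point_nonneg[OF t L2_pn(2)[OF f] L2_pn(2)[OF g] pn_nonneg(2) pn_nonneg(2)])
  also have "\<dots> = (LINT \<omega>|M. p f (X 0 \<omega>) * p g (X t \<omega>) - p f (X 0 \<omega>) * n g (X t \<omega>)
      - n f (X 0 \<omega>) * p g (X t \<omega>) + n f (X 0 \<omega>) * n g (X t \<omega>))"
    using two_point_integrable[OF t L2_pn(1)[OF f] L2_pn(1)[OF g]]
      two_point_integrable[OF t L2_pn(1)[OF f] L2_pn(2)[OF g]]
      two_point_integrable[OF t L2_pn(2)[OF f] L2_pn(1)[OF g]]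
      two_point_integrable[OF t L2_pn(2)[OF f] L2_pn(2)[OF g]]
    by simp
  finally show ?thesis by (simp only: expand[symmetric])
qed

end

subsection \<open>The Lyapunov function along stopped paths\<close>

lemma set_integral_mono_subset:
  fixes f :: "'b \<Rightarrow> real"
  assumes int: "set_integrable M B f" and A: "A \<in> sets M" "A \<subseteq> B" and nonneg: "\<And>x. 0 \<le> f x"
  shows "(LINT x:A|M. f x) \<le> (LINT x:B|M. f x)"
  unfolding set_lebesgue_integral_def
  using int set_integrable_subset[OF int A] A(2) nonneg
  by (intro integral_mono) (auto simp: set_integrable_def indicator_def)

text \<open>Serves to evaluate a jointly measurable process at a random time.\<close>

lemma measurable_uncurried_compose:
  assumes "(\<lambda>(s, x). h s x) \<in> A \<Otimes>\<^sub>M B \<rightarrow>\<^sub>M C" "f \<in> N \<rightarrow>\<^sub>M A" "g \<in> N \<rightarrow>\<^sub>M B"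
  shows "(\<lambda>z. h (f z) (g z)) \<in> N \<rightarrow>\<^sub>M C"
  using measurable_compose[OF measurable_Pair[OF assms(2,3)] assms(1)] by simp

text \<open>No iteration is needed because \<open>b t < 1\<close>: integrating \<open>y \<le> w + b v\<close>, with \<open>v\<close> the integral of \<open>y\<close>
  over \<open>[0,t]\<close>, gives \<open>(1 - b t) v \<le> \<integral> w\<close>.\<close>

lemma pathwise_gronwall:
  fixes u w lu \<phi> \<tau> :: "real \<Rightarrow> real"
  assumes t: "0 \<le> t" and b: "0 \<le> b" "b * t < 1"
    and \<tau>: "\<And>s. 0 \<le> s \<Longrightarrow> 0 \<le> \<tau> s" "\<And>s. 0 \<le> s \<Longrightarrow> \<tau> s \<le> s"
      "\<And>r s. 0 \<le> r \<Longrightarrow> r \<le> \<tau> s \<Longrightarrow> 0 \<le> s \<Longrightarrow> \<tau> r = r"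
    and u_nonneg: "\<And>r. 0 \<le> u r" and \<phi>_nonneg: "\<And>r. 0 \<le> \<phi> r"
    and u_meas [measurable]: "u \<in> borel_measurable borel" "(\<lambda>s. u (\<tau> s)) \<in> borel_measurable borel"
    and \<phi>_meas [measurable]: "\<phi> \<in> borel_measurable borel"
    and lu_int: "\<And>s. 0 \<le> s \<Longrightarrow> set_integrable lborel {0..s} lu"
    and lu_le: "AE r in lborel. 0 \<le> r \<longrightarrow> lu r \<le> (b - \<phi> r) * u r"
    and w: "\<And>s. 0 \<le> s \<Longrightarrow> w s = u (\<tau> s) - (LINT r:{0..\<tau> s}|lborel. lu r)"
    and w_int: "set_integrable lborel {0..t} w"
  shows "set_integrable lborel {0..\<tau> t} (\<lambda>r. \<phi> r * u r)"
    and "u (\<tau> t) + (LINT r:{0..\<tau> t}|lborel. \<phi> r * u r)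
      \<le> w t + b / (1 - b * t) * (LINT s:{0..t}|lborel. w s)"
proof -
  define y where "y s = u (\<tau> s)" for s
  define a where "a s = (LINT r:{0..\<tau> s}|lborel. lu r)" for s
  \<comment> \<open>\<open>A\<close> bounds the drift integral up to every stopped time before
    \<open>t\<close>, so that integrability of \<open>w\<close> passes to
    \<open>y = w + a\<close>.\<close>
  define A where "A = (LINT r:{0..t}|lborel. \<bar>lu r\<bar>)"
  have y_meas [measurable]: "y \<in> borel_measurable borel" unfolding y_def by measurable
  have a_le: "\<bar>a s\<bar> \<le> A" if "s \<in> {0..t}" for s
  proof -
    have sub: "{0..\<tau> s} \<subseteq> {0..t}" using that \<tau>(2)[of s] by auto
    have int: "set_integrable lborel {0..t} (\<lambda>r. \<bar>lu r\<bar>)"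
      using lu_int[OF t] by (rule set_integrable_abs)
    have "\<bar>a s\<bar> \<le> (LINT r:{0..\<tau> s}|lborel. \<bar>lu r\<bar>)"
      unfolding a_def using set_integral_norm_bound[OF lu_int[OF \<tau>(1)[of s]]] that by simp
    also have "\<dots> \<le> A"
      unfolding A_def using sub by (intro set_integral_mono_subset int) auto
    finally show ?thesis .
  qed
  have y_eq: "y s = w s + a s" if "0 \<le> s" for s
    using w[OF that] by (simp add: y_def a_def)
  have y_int: "set_integrable lborel {0..t} y"
    unfolding set_integrable_def
  proof (rule Bochner_Integration.integrable_bound)
    show "integrable lborel (\<lambda>s. indicator {0..t} s *\<^sub>R (\<bar>w s\<bar> + A))"
    proof -
      have "set_integrable lborel {0..t} (\<lambda>_. A)"
        using t by (simp add: set_integrable_def integrable_real_indicator)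
      from set_integral_add(1)[OF set_integrable_abs[OF w_int] this] show ?thesis
        by (simp add: set_integrable_def)
    qed
    have "norm (indicator {0..t} s *\<^sub>R y s) \<le> norm (indicator {0..t} s *\<^sub>R (\<bar>w s\<bar> + A))" for s
      using a_le[of s] y_eq[of s] by (cases "s \<in> {0..t}") auto
    then show "AE s in lborel. norm (indicator {0..t} s *\<^sub>R y s) \<le> norm (indicator {0..t} s *\<^sub>R (\<bar>w s\<bar> + A))"
      by simp
  qed simp
  define v where "v = (LINT s:{0..t}|lborel. y s)"
  have step: "set_integrable lborel {0..\<tau> s} (\<lambda>r. \<phi> r * u r)
      \<and> y s + (LINT r:{0..\<tau> s}|lborel. \<phi> r * u r) \<le> w s + b * v" if s: "s \<in> {0..t}" for s
  proof -
    have s0: "0 \<le> s" and sub: "{0..\<tau> s} \<subseteq> {0..t}" using s \<tau>(2)[of s] by auto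
    \<comment> \<open>Up to \<open>\<tau> s\<close> the stopped path has not yet departed from the
      path itself, so the drift inequality for \<open>u\<close> can be read as one for
      \<open>y\<close>.\<close>
    have yu: "y r = u r" if "r \<in> {0..\<tau> s}" for r
      using that \<tau>(3)[of r s] s0 by (simp add: y_def)
    have y_int': "set_integrable lborel {0..\<tau> s} y"
      by (rule set_integrable_subset[OF y_int]) (use sub in auto)
    have bound_int: "set_integrable lborel {0..\<tau> s} (\<lambda>r. b * y r - lu r)"
      by (intro set_integral_diff(1) set_integrable_mult_right y_int' lu_int \<tau>(1) s0)
    have le: "AE r in lborel. r \<in> {0..\<tau> s} \<longrightarrow> \<phi> r * u r \<le> b * y r - lu r"
      using lu_le by eventually_elim (auto simp: yu algebra_simps)
    \<comment> \<open>\<open>\<phi> * u\<close> is nonnegative and dominated by the integrable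
      \<open>b * y - lu\<close>: its integrability is a consequence of the drift inequality.\<close>
    have phi_int: "set_integrable lborel {0..\<tau> s} (\<lambda>r. \<phi> r * u r)"
      unfolding set_integrable_def
    proof (rule Bochner_Integration.integrable_bound)
      show "integrable lborel (\<lambda>r. indicator {0..\<tau> s} r *\<^sub>R (b * y r - lu r))"
        using bound_int by (simp add: set_integrable_def)
      show "AE r in lborel. norm (indicator {0..\<tau> s} r *\<^sub>R (\<phi> r * u r))
          \<le> norm (indicator {0..\<tau> s} r *\<^sub>R (b * y r - lu r))"
        using le
      proof eventually_elim
        case (elim r)
        have "0 \<le> \<phi> r * u r" using u_nonneg \<phi>_nonneg by simp
        with elim show ?case by (cases "r \<in> {0..\<tau> s}") auto
      qed
    qed simp
    have "(LINT r:{0..\<tau> s}|lborel. \<phi> r * u r) \<le> (LINT r:{0..\<tau> s}|lborel. b * y r - lu r)"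
      unfolding set_lebesgue_integral_def
      by (rule integral_mono_AE, use phi_int bound_int in \<open>simp_all add: set_integrable_def\<close>,
          use le in eventually_elim) (auto simp: indicator_def)
    also have "\<dots> = b * (LINT r:{0..\<tau> s}|lborel. y r) - a s"
      unfolding a_def using y_int' lu_int[OF \<tau>(1)[OF s0]]
      by (subst set_integral_diff(2)) (auto intro: set_integrable_mult_right simp: set_lebesgue_integral_def)
    \<comment> \<open>\<open>y\<close> is nonnegative, so its integral may be extended from
      \<open>\<tau> s\<close> to \<open>t\<close>. The bound then involves the single number
      \<open>v\<close>, independent of \<open>s\<close>.\<close>
    also have "\<dots> \<le> b * v - a s"
    proof -
      have "(LINT r:{0..\<tau> s}|lborel. y r) \<le> v"
        unfolding v_def using sub
        by (intro set_integral_mono_subset y_int) (auto simp: y_def u_nonneg)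
      from mult_left_mono[OF this b(1)] show ?thesis by simp
    qed
    finally show ?thesis using phi_int y_eq[OF s0] by simp
  qed
  have phi_nonneg: "0 \<le> (LINT r:{0..\<tau> s}|lborel. \<phi> r * u r)" for s
    unfolding set_lebesgue_integral_def
    by (rule integral_nonneg_AE) (simp add: u_nonneg \<phi>_nonneg)
  have const_int: "set_integrable lborel {0..t} (\<lambda>_. b * v)"
    using t by (simp add: set_integrable_def integrable_real_indicator)
  have y_le: "y s \<le> w s + b * v" if "s \<in> {0..t}" for s
    using step[OF that] phi_nonneg[of s] by linarith
  have "v \<le> (LINT s:{0..t}|lborel. w s + b * v)"
    by (subst (1) v_def, rule set_integral_mono[OF y_int set_integral_add(1)[OF w_int const_int]]) (rule y_le)
  also have "\<dots> = (LINT s:{0..t}|lborel. w s) + (b * v) * t"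
    using t by (simp add: set_integral_add(2)[OF w_int const_int]) (simp add: set_lebesgue_integral_def)
  finally have "v * (1 - b * t) \<le> (LINT s:{0..t}|lborel. w s)" by (simp add: algebra_simps)
  then have v_le: "v \<le> (LINT s:{0..t}|lborel. w s) / (1 - b * t)"
    using b(2) by (simp add: pos_le_divide_eq)
  show "set_integrable lborel {0..\<tau> t} (\<lambda>r. \<phi> r * u r)" using step[of t] t by simp
  have "u (\<tau> t) + (LINT r:{0..\<tau> t}|lborel. \<phi> r * u r) \<le> w t + b * v"
    using step[of t] t by (simp add: y_def)
  also have "\<dots> \<le> w t + b * ((LINT s:{0..t}|lborel. w s) / (1 - b * t))"
    using mult_left_mono[OF v_le b(1)] by simp
  finally show "u (\<tau> t) + (LINT r:{0..\<tau> t}|lborel. \<phi> r * u r)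
      \<le> w t + b / (1 - b * t) * (LINT s:{0..t}|lborel. w s)" by simp
qed

section \<open>Joint measurability of the paths and almost sure properties at almost every
  time\<close>

context reversible_markov_process
begin

text \<open>Time integrals and stopped values require joint measurability, while only almost sure
  path regularity is given. Right-continuity makes the value at \<open>s\<close> the limit of values
  at grid points approaching \<open>s\<close> from the right, and each approximation is a countable
  gluing of the measurable maps \<open>X t\<close>.\<close>

lemma cadlag_modification:
  obtains X' where "(\<lambda>(s, \<omega>). X' s \<omega>) \<in> borel_measurable (borel \<Otimes>\<^sub>M M)"
    and "AE \<omega> in M. \<forall>s\<ge>0. X' s \<omega> = X s \<omega>"
proof -
  obtain N where N: "{\<omega> \<in> space M. \<not> cadlag (\<lambda>t. X t \<omega>)} \<subseteq> N" "N \<in> null_sets M"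
    using cadlag_paths unfolding eventually_ae_filter by auto
  have N_sets [measurable]: "N \<in> sets M" using N(2) by auto
  \<comment> \<open>On the null set \<open>N\<close> the path is replaced by a constant, so that the
    approximations converge at every point and not only almost surely; \<open>max 0\<close> freezes
    negative times at 0.\<close>
  define X' where "X' s \<omega> = (if \<omega> \<in> N then undefined else X (max 0 s) \<omega>)" for s \<omega>
  \<comment> \<open>With \<open>Suc n\<close> in place of \<open>n\<close> the chosen grid point
    lies strictly to the right of the time, as the filter \<open>at_right\<close> demands.\<close>
  define grid where "grid k n = real (Suc n) / real (Suc k)" for k n
  define idx where "idx k s = nat \<lfloor>max 0 s * real (Suc k)\<rfloor>" for k s
  define Y where "Y k = (\<lambda>(s, \<omega>). if \<omega> \<in> N then undefined else X (grid k (idx k s)) \<omega>)" for k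
  have "(\<lambda>(s, \<omega>). X' s \<omega>) \<in> borel_measurable (borel \<Otimes>\<^sub>M M)"
  proof (rule borel_measurable_LIMSEQ_metric)
    fix k
    have [measurable]: "X (grid k n) \<in> borel_measurable M" for n
      by (rule X_measurable) (simp add: grid_def)
    have [measurable]: "idx k \<in> borel \<rightarrow>\<^sub>M count_space UNIV"
      unfolding idx_def by measurable
    have "(\<lambda>x. X (grid k n) (snd x)) \<in> borel_measurable (borel \<Otimes>\<^sub>M M)" for n
      by measurable
    moreover have "(\<lambda>x. idx k (fst x)) \<in> borel \<Otimes>\<^sub>M M \<rightarrow>\<^sub>M count_space UNIV"
      by measurable
    ultimately have "(\<lambda>x. X (grid k (idx k (fst x))) (snd x)) \<in> borel_measurable (borel \<Otimes>\<^sub>M M)"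
      by (rule measurable_compose_countable)
    moreover have "{x \<in> space (borel \<Otimes>\<^sub>M M). snd x \<in> N} \<in> sets (borel \<Otimes>\<^sub>M M)"
      by measurable
    ultimately show "Y k \<in> borel_measurable (borel \<Otimes>\<^sub>M M)"
      unfolding Y_def case_prod_beta
      by (intro measurable_If measurable_const) simp_all
  next
    fix x :: "real \<times> 'w" assume x: "x \<in> space (borel \<Otimes>\<^sub>M M)"
    obtain s \<omega> where [simp]: "x = (s, \<omega>)" by (cases x)
    have \<omega>: "\<omega> \<in> space M" using x by (simp add: space_pair_measure)
    show "(\<lambda>k. Y k x) \<longlonglongrightarrow> (case x of (s, \<omega>) \<Rightarrow> X' s \<omega>)"
    proof (cases "\<omega> \<in> N")
      case True
      then show ?thesis by (simp add: Y_def X'_def)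
    next
      case False
      let ?s = "max 0 s"
      have "cadlag (\<lambda>t. X t \<omega>)" using N(1) \<omega> False by auto
      then have cont: "((\<lambda>t. X t \<omega>) \<longlongrightarrow> X ?s \<omega>) (at_right ?s)"
        by (auto simp: cadlag_def continuous_within)
      have gt: "?s < grid k (idx k s)" and le: "grid k (idx k s) \<le> ?s + 1 / real (Suc k)" for k
      proof -
        define c where "c = real (Suc k)"
        have c: "0 < c" by (simp add: c_def)
        have idx: "real (idx k s) = of_int \<lfloor>?s * c\<rfloor>"
          using c by (simp add: idx_def c_def)
        have bounds: "?s * c < real (Suc (idx k s))" "real (idx k s) \<le> ?s * c"
          unfolding of_nat_Suc idx by linarith+
        show "?s < grid k (idx k s)"
          unfolding grid_def c_def[symmetric] using bounds(1) c by (simp only: pos_less_divide_eq)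
        have "real (idx k s) / c \<le> ?s"
          using bounds(2) c by (simp only: pos_divide_le_eq)
        then show "grid k (idx k s) \<le> ?s + 1 / real (Suc k)"
          unfolding grid_def c_def[symmetric] of_nat_Suc[of "idx k s"] by (simp only: add_divide_distrib)
      qed
      have "(\<lambda>k. grid k (idx k s)) \<longlonglongrightarrow> ?s"
      proof (rule real_tendsto_sandwich[OF _ _ tendsto_const[of ?s]])
        show "(\<lambda>k. ?s + 1 / real (Suc k)) \<longlonglongrightarrow> ?s"
          using tendsto_add[OF tendsto_const[of ?s] LIMSEQ_inverse_real_of_nat] by (simp add: inverse_eq_divide)
      qed (use gt le in \<open>auto intro!: always_eventually less_imp_le\<close>)
      then have "filterlim (\<lambda>k. grid k (idx k s)) (at_right ?s) sequentially"
        using gt by (simp add: filterlim_at less_imp_neq[THEN not_sym] del: max_less_iff_conj)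
      from filterlim_compose[OF cont this] show ?thesis
        using False by (simp add: Y_def X'_def)
    qed
  qed
  moreover have "AE \<omega> in M. \<forall>s\<ge>0. X' s \<omega> = X s \<omega>"
    using AE_not_in[OF N(2)] by eventually_elim (simp add: X'_def)
  ultimately show ?thesis by (rule that)
qed

text \<open>At each fixed time the exceptional event is null because \<open>X s\<close> has law
  \<mu>; Fubini exchanges the two quantifiers. It carries the drift condition, known only
  \<mu>-almost everywhere, to almost every time along almost every path.\<close>

lemma AE_path:
  assumes X'[measurable]: "(\<lambda>(s, \<omega>). X' s \<omega>) \<in> borel_measurable (borel \<Otimes>\<^sub>M M)"
    and X'_eq: "AE \<omega> in M. \<forall>s\<ge>0. X' s \<omega> = X s \<omega>"
    and Q: "AE x in \<mu>. Q x"
  shows "AE \<omega> in M. AE s in lborel. 0 \<le> s \<longrightarrow> Q (X' s \<omega>)"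
proof -
  interpret L: pair_sigma_finite lborel M ..
  obtain N where N: "{x \<in> space \<mu>. \<not> Q x} \<subseteq> N" "N \<in> null_sets \<mu>"
    using Q unfolding eventually_ae_filter by auto
  have [measurable]: "N \<in> sets borel" using N(2) sets_mu by auto
  let ?R = "\<lambda>(s, \<omega>). 0 \<le> s \<longrightarrow> X' s \<omega> \<notin> N"
  have "AE s in lborel. AE \<omega> in M. ?R (s, \<omega>)"
  proof (rule AE_I2)
    fix s :: real
    show "AE \<omega> in M. ?R (s, \<omega>)"
    proof (cases "0 \<le> s")
      case True
      show ?thesis using AE_law[OF True AE_not_in[OF N(2)]] X'_eq
        by eventually_elim auto
    qed simp
  qed
  moreover have "{x \<in> space (lborel \<Otimes>\<^sub>M M). ?R x} \<in> sets (lborel \<Otimes>\<^sub>M M)" by measurable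
  ultimately have "AE \<omega> in M. AE s in lborel. ?R (s, \<omega>)"
    using L.AE_commute[of "\<lambda>s \<omega>. ?R (s, \<omega>)"] by simp
  then show ?thesis
  proof eventually_elim
    case (elim \<omega>)
    then show ?case
      by eventually_elim (use N(1) space_mu in auto)
  qed
qed

end

text \<open>For a martingale this bounds the first absolute moment at an earlier time by the one at
  a later time.\<close>

lemma (in sigma_finite_subalgebra) nn_integral_real_cond_exp_le:
  assumes [measurable]: "f \<in> borel_measurable M"
  shows "(\<integral>\<^sup>+x. ennreal \<bar>real_cond_exp M F f x\<bar> \<partial>M) \<le> (\<integral>\<^sup>+x. ennreal \<bar>f x\<bar> \<partial>M)"
proof -
  have "(\<integral>\<^sup>+x. ennreal \<bar>real_cond_exp M F f x\<bar> \<partial>M) \<le> (\<integral>\<^sup>+x. nn_cond_exp M F (\<lambda>x. ennreal \<bar>f x\<bar>) x \<partial>M)"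
    by (rule nn_integral_mono_AE[OF real_cond_exp_abs]) measurable
  also have "\<dots> = (\<integral>\<^sup>+x. ennreal \<bar>f x\<bar> \<partial>M)"
    using nn_cond_exp_intg[of "\<lambda>_. 1" "\<lambda>x. ennreal \<bar>f x\<bar>"] by simp
  finally show ?thesis .
qed

lemma set_lebesgue_integral_singleton_lborel:
  fixes f :: "real \<Rightarrow> real"
  shows "(LINT r:{a}|lborel. f r) = 0"
proof -
  have "AE r in lborel. indicator {a} r *\<^sub>R f r = 0"
    using AE_lborel_singleton[of a] by eventually_elim simp
  then show ?thesis unfolding set_lebesgue_integral_def by (rule integral_eq_zero_AE)
qed

lemma stopped_time_props:
  fixes s :: real and T :: ennreal
  assumes "0 \<le> s"
  shows "0 \<le> enn2real (min (ennreal s) T)" "enn2real (min (ennreal s) T) \<le> s"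
    "ennreal (enn2real (min (ennreal s) T)) = min (ennreal s) T"
    "0 \<le> r \<Longrightarrow> r \<le> enn2real (min (ennreal s) T) \<Longrightarrow> enn2real (min (ennreal r) T) = r"
proof -
  show 1: "0 \<le> enn2real (min (ennreal s) T)" by simp
  have "min (ennreal s) T \<le> ennreal s" by simp
  then show 2: "enn2real (min (ennreal s) T) \<le> s"
    using assms by (metis enn2real_ennreal enn2real_mono ennreal_less_top)
  have "min (ennreal s) T < top" by (simp add: min_less_iff_disj)
  then show 3: "ennreal (enn2real (min (ennreal s) T)) = min (ennreal s) T"
    by (rule ennreal_enn2real)
  assume r: "0 \<le> r" "r \<le> enn2real (min (ennreal s) T)"
  then have "ennreal r \<le> min (ennreal s) T"
    by (subst 3[symmetric]) (rule ennreal_leI)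
  then have "ennreal r \<le> T" by (simp only: min.bounded_iff)
  then have "min (ennreal r) T = ennreal r" by (rule min_absorb1)
  then show "enn2real (min (ennreal r) T) = r" using r by simp
qed

section \<open>Expectation bound for the stopped Lyapunov function\<close>

context reversible_markov_process
begin

text \<open>The weight \<open>\<kappa> (X 0)\<close> is bounded and known at time 0, so it passes
  through the conditional expectation given \<open>F 0\<close> and the mean remains that of
  \<open>Z 0 = 0\<close>. The last bound refers to the fixed end time \<open>t\<close>, hence is
  uniform in \<open>s\<close> and allows Fubini on \<open>[0, t]\<close>.\<close>

lemma weighted_martingale:
  assumes mart: "martingale_ct M F Z" and Z0: "\<And>\<omega>. \<omega> \<in> space M \<Longrightarrow> Z 0 \<omega> = 0"
    and s: "0 \<le> s" "s \<le> t"
    and \<kappa>_meas: "\<kappa> \<in> borel_measurable borel" and \<kappa>: "\<And>x. 0 \<le> \<kappa> x" "\<And>x. \<kappa> x \<le> K"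
  shows "integrable M (\<lambda>\<omega>. \<kappa> (X 0 \<omega>) * Z s \<omega>)" "(LINT \<omega>|M. \<kappa> (X 0 \<omega>) * Z s \<omega>) = 0"
    "(\<integral>\<^sup>+\<omega>. ennreal \<bar>\<kappa> (X 0 \<omega>) * Z s \<omega>\<bar> \<partial>M) \<le> ennreal K * (\<integral>\<^sup>+\<omega>. ennreal \<bar>Z t \<omega>\<bar> \<partial>M)"
proof -
  note \<kappa>_meas [measurable] X_measurable[of 0, simplified, measurable] adapted[of 0, simplified, measurable]
  interpret sub: finite_measure_subalgebra M "F u" for u by standard (rule sub_algebra)
  have Z_int: "integrable M (Z u)" if "0 \<le> u" for u
    using mart that unfolding martingale_ct_def by blast
  have Z_mart: "AE \<omega> in M. real_cond_exp M (F (ennreal u)) (Z v) \<omega> = Z u \<omega>" if "0 \<le> u" "u \<le> v" for u v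
    using mart that unfolding martingale_ct_def by blast
  have [measurable]: "Z u \<in> borel_measurable M" if "0 \<le> u" for u
    using Z_int[OF that] by simp
  show int: "integrable M (\<lambda>\<omega>. \<kappa> (X 0 \<omega>) * Z s \<omega>)"
  proof (rule Bochner_Integration.integrable_bound)
    show "integrable M (\<lambda>\<omega>. K * Z s \<omega>)" using Z_int[OF s(1)] by simp
    show "(\<lambda>\<omega>. \<kappa> (X 0 \<omega>) * Z s \<omega>) \<in> borel_measurable M" using s by measurable
    have "\<bar>\<kappa> x\<bar> \<le> \<bar>K\<bar>" for x using \<kappa>[of x] by simp
    then show "AE \<omega> in M. norm (\<kappa> (X 0 \<omega>) * Z s \<omega>) \<le> norm (K * Z s \<omega>)"
      by (simp add: abs_mult mult_right_mono)
  qed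
  have K: "0 \<le> K" using \<kappa> order_trans by blast
  have "(LINT \<omega>|M. \<kappa> (X 0 \<omega>) * Z s \<omega>) = (LINT \<omega>|M. \<kappa> (X 0 \<omega>) * real_cond_exp M (F 0) (Z s) \<omega>)"
    using s by (intro sub.real_cond_exp_intg(2)[symmetric] int) measurable
  also have "\<dots> = (LINT \<omega>|M. \<kappa> (X 0 \<omega>) * Z 0 \<omega>)"
    by (rule integral_cong_AE) (use Z_mart[of 0 s] s in auto)
  also have "\<dots> = 0"
    using Z0 by (subst Bochner_Integration.integral_cong[of M M _ "\<lambda>_. 0"]) auto
  finally show "(LINT \<omega>|M. \<kappa> (X 0 \<omega>) * Z s \<omega>) = 0" .
  have "(\<integral>\<^sup>+\<omega>. ennreal \<bar>\<kappa> (X 0 \<omega>) * Z s \<omega>\<bar> \<partial>M) \<le> (\<integral>\<^sup>+\<omega>. ennreal K * ennreal \<bar>Z s \<omega>\<bar> \<partial>M)"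
    by (intro nn_integral_mono, subst ennreal_mult[symmetric])
      (auto simp: abs_mult K \<kappa> intro!: ennreal_leI mult_right_mono)
  also have "\<dots> = ennreal K * (\<integral>\<^sup>+\<omega>. ennreal \<bar>Z s \<omega>\<bar> \<partial>M)"
    using s by (intro nn_integral_cmult) measurable
  also have "(\<integral>\<^sup>+\<omega>. ennreal \<bar>Z s \<omega>\<bar> \<partial>M) = (\<integral>\<^sup>+\<omega>. ennreal \<bar>real_cond_exp M (F (ennreal s)) (Z t) \<omega>\<bar> \<partial>M)"
    by (rule nn_integral_cong_AE) (use Z_mart[OF s] in auto)
  also have "\<dots> \<le> (\<integral>\<^sup>+\<omega>. ennreal \<bar>Z t \<omega>\<bar> \<partial>M)"
    using s by (intro sub.nn_integral_real_cond_exp_le) simp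
  finally show "(\<integral>\<^sup>+\<omega>. ennreal \<bar>\<kappa> (X 0 \<omega>) * Z s \<omega>\<bar> \<partial>M) \<le> ennreal K * (\<integral>\<^sup>+\<omega>. ennreal \<bar>Z t \<omega>\<bar> \<partial>M)"
    by (simp add: mult_left_mono)
qed

text \<open>The pathwise Gronwall bound is linear in \<open>W\<close>, so its expectation only
  involves the mean of \<open>\<kappa> (X' 0) * W s\<close>, and this mean is the same number
  \<open>c\<close> at every time in \<open>[0, t]\<close>. The condition
  \<open>\<kappa> x * U x \<le> K\<close> makes the starting value \<open>U (X 0)\<close> integrable
  after weighting.\<close>

lemma lyapunov_stopped:
  fixes U LU \<phi> \<kappa> :: "'a \<Rightarrow> real" and T :: "'w \<Rightarrow> ennreal"
  defines "\<tau> \<equiv> \<lambda>s \<omega>. enn2real (min (ennreal s) (T \<omega>))"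
  assumes X'[measurable]: "(\<lambda>(s, \<omega>). X' s \<omega>) \<in> borel_measurable (borel \<Otimes>\<^sub>M M)"
    and X'_eq: "AE \<omega> in M. \<forall>s\<ge>0. X' s \<omega> = X s \<omega>"
    and t: "0 \<le> t" and b: "0 \<le> b" "b * t < 1"
    and U_meas [measurable]: "U \<in> borel_measurable borel" and U_ge: "\<And>x. 1 \<le> U x"
    and LU_meas [measurable]: "LU \<in> borel_measurable borel"
    and \<phi>_meas [measurable]: "\<phi> \<in> borel_measurable borel" and \<phi>_nonneg: "\<And>x. 0 \<le> \<phi> x"
    and drift: "AE x in \<mu>. LU x \<le> (b - \<phi> x) * U x"
    and LU_int: "AE \<omega> in M. \<forall>s\<ge>0. set_integrable lborel {0..s} (\<lambda>r. LU (X r \<omega>))"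
    and T: "stopping_time F T"
    and mart: "martingale_ct M F
      (stopped (\<lambda>t \<omega>. U (X t \<omega>) - U (X 0 \<omega>) - (LINT s:{0..t}|lborel. LU (X s \<omega>))) T)"
    and \<kappa>_meas [measurable]: "\<kappa> \<in> borel_measurable borel"
    and \<kappa>: "\<And>x. 0 \<le> \<kappa> x" "\<And>x. \<kappa> x * U x \<le> K"
  shows "(\<integral>\<^sup>+\<omega>. ennreal (\<kappa> (X' 0 \<omega>)) * (ennreal (U (X' (\<tau> t \<omega>) \<omega>))
      + (\<integral>\<^sup>+r\<in>{0..\<tau> t \<omega>}. ennreal (\<phi> (X' r \<omega>) * U (X' r \<omega>)) \<partial>lborel)) \<partial>M)
    \<le> ennreal ((LINT x|\<mu>. \<kappa> x * U x) / (1 - b * t))"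
proof -
  interpret L: pair_sigma_finite lborel M ..
  define Z where "Z = stopped (\<lambda>t \<omega>. U (X t \<omega>) - U (X 0 \<omega>) - (LINT s:{0..t}|lborel. LU (X s \<omega>))) T"
  define C where "C = ennreal K * (\<integral>\<^sup>+\<omega>. ennreal \<bar>Z t \<omega>\<bar> \<partial>M)"
  define c where "c = (LINT x|\<mu>. \<kappa> x * U x)"
  define W where "W s \<omega> = U (X' (\<tau> s \<omega>) \<omega>) - (LINT r:{0..\<tau> s \<omega>}|lborel. LU (X' r \<omega>))" for s \<omega>
  \<comment> \<open>The weight is attached before any integration, because \<open>W s\<close> may
    fail to be integrable together with \<open>U (X 0)\<close>.\<close>
  define G where "G s \<omega> = indicator {0..t} s * (\<kappa> (X' 0 \<omega>) * W s \<omega>)" for s \<omega>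
  have \<kappa>_le: "\<kappa> x \<le> K" for x
    using \<kappa>[of x] mult_left_mono[OF U_ge[of x] \<kappa>(1)[of x]] by simp
  have K: "0 \<le> K" using \<kappa>(1) \<kappa>_le order_trans by blast
  have [measurable]: "T \<in> borel_measurable M"
    by (rule measurable_stopping_time[OF T]) (use sub_algebra in \<open>auto simp: subalgebra_def\<close>)
  have \<tau>_meas [measurable]: "(\<lambda>x. \<tau> (fst x) (snd x)) \<in> borel_measurable (borel \<Otimes>\<^sub>M M)"
    unfolding \<tau>_def by measurable
  note X'_comp = measurable_uncurried_compose[OF X']
  have X'0 [measurable]: "X' 0 \<in> borel_measurable M"
    by (rule X'_comp[of "\<lambda>_. 0" M "\<lambda>\<omega>. \<omega>"]) auto
  have [measurable]: "(\<lambda>x. X' (\<tau> (fst x) (snd x)) (snd x)) \<in> borel_measurable (borel \<Otimes>\<^sub>M M)"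
    by (rule X'_comp) measurable
  have [measurable]: "(\<lambda>y. X' (snd y) (snd (fst y))) \<in> borel_measurable ((borel \<Otimes>\<^sub>M M) \<Otimes>\<^sub>M lborel)"
    by (rule X'_comp) measurable
  have W_meas [measurable]: "(\<lambda>x. W (fst x) (snd x)) \<in> borel_measurable (borel \<Otimes>\<^sub>M M)"
  proof -
    have "(\<lambda>(x, r). indicator {0..\<tau> (fst x) (snd x)} r *\<^sub>R LU (X' r (snd x)))
        \<in> borel_measurable ((borel \<Otimes>\<^sub>M M) \<Otimes>\<^sub>M lborel)"
      unfolding indicator_def atLeastAtMost_iff case_prod_beta by measurable
    from lborel.borel_measurable_lebesgue_integral[OF this]
    show ?thesis unfolding W_def set_lebesgue_integral_def by measurable
  qed
  have G_meas [measurable]: "(\<lambda>(s, \<omega>). G s \<omega>) \<in> borel_measurable (borel \<Otimes>\<^sub>M M)"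
    unfolding G_def case_prod_beta by measurable
  have W_eq: "AE \<omega> in M. \<forall>s\<ge>0. W s \<omega> = U (X 0 \<omega>) + Z s \<omega>"
    using X'_eq
  proof eventually_elim
    case (elim \<omega>)
    show ?case
    proof (intro allI impI)
      fix s :: real assume s: "0 \<le> s"
      have \<tau>0: "0 \<le> \<tau> s \<omega>" by (simp add: \<tau>_def)
      have "(LINT r:{0..\<tau> s \<omega>}|lborel. LU (X' r \<omega>)) = (LINT r:{0..\<tau> s \<omega>}|lborel. LU (X r \<omega>))"
        by (rule set_lebesgue_integral_cong) (use elim in auto)
      then show "W s \<omega> = U (X 0 \<omega>) + Z s \<omega>"
        using elim \<tau>0 by (simp add: W_def Z_def stopped_def \<tau>_def)
    qed
  qed
  have Z0: "Z 0 \<omega> = 0" for \<omega>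
    using set_lebesgue_integral_singleton_lborel[of 0 "\<lambda>s. LU (X s \<omega>)"]
    by (simp add: Z_def stopped_def)
  note mart = mart[folded Z_def]
  have C_fin: "C < \<infinity>"
  proof -
    have "integrable M (Z t)" using mart t by (auto simp: martingale_ct_def)
    then show ?thesis unfolding C_def by (simp add: integrable_iff_bounded ennreal_mult_less_top)
  qed
  have \<kappa>U_int: "integrable \<mu> (\<lambda>x. \<kappa> x * U x)"
  proof (rule mu.integrable_const_bound[where B=K])
    have "0 \<le> \<kappa> x * U x" for x using \<kappa>(1)[of x] U_ge[of x] by simp
    then show "AE x in \<mu>. norm (\<kappa> x * U x) \<le> K" using \<kappa>(2) by simp
  qed measurable
  \<comment> \<open>\<open>W s\<close> is \<open>U (X 0)\<close> plus the martingale, whose weighted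
    mean is 0; this leaves \<open>c\<close>. The third bound does not depend on \<open>s\<close>
    inside \<open>[0, t]\<close> and makes \<open>G\<close> integrable for the product
    measure.\<close>
  have slice: "integrable M (G s)" "(LINT \<omega>|M. G s \<omega>) = indicator {0..t} s * c"
    "(\<integral>\<^sup>+\<omega>. ennreal \<bar>G s \<omega>\<bar> \<partial>M) \<le> (ennreal c + C) * indicator {0..t} s" for s
  proof -
    have "integrable M (G s) \<and> (LINT \<omega>|M. G s \<omega>) = indicator {0..t} s * c
      \<and> (\<integral>\<^sup>+\<omega>. ennreal \<bar>G s \<omega>\<bar> \<partial>M) \<le> (ennreal c + C) * indicator {0..t} s"
    proof (cases "s \<in> {0..t}")
      case True
      then have s: "0 \<le> s" "s \<le> t" by auto
      let ?H = "\<lambda>\<omega>. \<kappa> (X 0 \<omega>) * U (X 0 \<omega>) + \<kappa> (X 0 \<omega>) * Z s \<omega>"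
      note wm = weighted_martingale[OF mart Z0 s \<kappa>_meas \<kappa>(1) \<kappa>_le, folded C_def]
      have H1: "integrable M (\<lambda>\<omega>. \<kappa> (X 0 \<omega>) * U (X 0 \<omega>))" "(LINT \<omega>|M. \<kappa> (X 0 \<omega>) * U (X 0 \<omega>)) = c"
        using \<kappa>U_int integrable_law[of 0 "\<lambda>x. \<kappa> x * U x"] integral_law[of 0 "\<lambda>x. \<kappa> x * U x"]
        by (simp_all add: c_def)
      have [measurable]: "G s \<in> borel_measurable M"
        using measurable_compose[OF measurable_Pair1' G_meas, of s] by simp
      have GH: "AE \<omega> in M. G s \<omega> = ?H \<omega>"
        using W_eq X'_eq by eventually_elim (use s in \<open>simp add: G_def algebra_simps\<close>)
      have H_int: "integrable M ?H" using H1(1) wm(1) by simp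
      have H_meas [measurable]: "?H \<in> borel_measurable M" using H_int by (rule borel_measurable_integrable)
      have "integrable M (G s)"
        using H_int integrable_cong_AE[OF _ _ GH] by simp
      moreover have "(LINT \<omega>|M. G s \<omega>) = c"
        using integral_cong_AE[OF _ _ GH] H1 wm by simp
      moreover have "(\<integral>\<^sup>+\<omega>. ennreal \<bar>G s \<omega>\<bar> \<partial>M) \<le> ennreal c + C"
      proof -
        have "(\<integral>\<^sup>+\<omega>. ennreal \<bar>G s \<omega>\<bar> \<partial>M) \<le> (\<integral>\<^sup>+\<omega>. ennreal (\<kappa> (X 0 \<omega>) * U (X 0 \<omega>)) + ennreal \<bar>\<kappa> (X 0 \<omega>) * Z s \<omega>\<bar> \<partial>M)"
        proof (rule nn_integral_mono_AE, use GH in eventually_elim)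
          case (elim \<omega>)
          have "0 \<le> \<kappa> (X 0 \<omega>) * U (X 0 \<omega>)" using \<kappa>(1) U_ge[of "X 0 \<omega>"] by simp
          then have "ennreal \<bar>G s \<omega>\<bar> \<le> ennreal (\<kappa> (X 0 \<omega>) * U (X 0 \<omega>) + \<bar>\<kappa> (X 0 \<omega>) * Z s \<omega>\<bar>)"
            unfolding elim by (intro ennreal_leI) linarith
          also have "\<dots> = ennreal (\<kappa> (X 0 \<omega>) * U (X 0 \<omega>)) + ennreal \<bar>\<kappa> (X 0 \<omega>) * Z s \<omega>\<bar>"
            using \<open>0 \<le> \<kappa> (X 0 \<omega>) * U (X 0 \<omega>)\<close> by (intro ennreal_plus) auto
          finally show ?case .
        qed
        also have "\<dots> = (\<integral>\<^sup>+\<omega>. ennreal (\<kappa> (X 0 \<omega>) * U (X 0 \<omega>)) \<partial>M) + (\<integral>\<^sup>+\<omega>. ennreal \<bar>\<kappa> (X 0 \<omega>) * Z s \<omega>\<bar> \<partial>M)"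
          using H1(1) wm(1) by (intro nn_integral_add) (auto dest: borel_measurable_integrable)
        also have "(\<integral>\<^sup>+\<omega>. ennreal (\<kappa> (X 0 \<omega>) * U (X 0 \<omega>)) \<partial>M) = ennreal c"
        proof -
          have "0 \<le> \<kappa> x * U x" for x using \<kappa>(1)[of x] U_ge[of x] by simp
          then show ?thesis using H1 by (subst nn_integral_eq_integral) auto
        qed
        finally show ?thesis by (rule order_trans) (intro add_left_mono wm(3))
      qed
      ultimately show ?thesis using True by simp
    next
      case False
      then show ?thesis by (simp add: G_def[abs_def])
    qed
    then show "integrable M (G s)" "(LINT \<omega>|M. G s \<omega>) = indicator {0..t} s * c"
      "(\<integral>\<^sup>+\<omega>. ennreal \<bar>G s \<omega>\<bar> \<partial>M) \<le> (ennreal c + C) * indicator {0..t} s" by auto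
  qed
  have G_int: "integrable (lborel \<Otimes>\<^sub>M M) (\<lambda>(s, \<omega>). G s \<omega>)"
  proof (rule integrableI_bounded)
    show "(\<lambda>(s, \<omega>). G s \<omega>) \<in> borel_measurable (lborel \<Otimes>\<^sub>M M)" by measurable
    have "(\<integral>\<^sup>+x. ennreal (norm (case x of (s, \<omega>) \<Rightarrow> G s \<omega>)) \<partial>(lborel \<Otimes>\<^sub>M M))
        = (\<integral>\<^sup>+s. \<integral>\<^sup>+\<omega>. ennreal \<bar>G s \<omega>\<bar> \<partial>M \<partial>lborel)"
      by (subst nn_integral_fst[symmetric]) auto
    also have "\<dots> \<le> (\<integral>\<^sup>+s. (ennreal c + C) * indicator {0..t} s \<partial>lborel)"
      by (intro nn_integral_mono slice(3))
    also have "\<dots> = (ennreal c + C) * ennreal t"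
      using t by (subst nn_integral_cmult_indicator) auto
    also have "\<dots> < \<infinity>" using C_fin by (simp add: ennreal_mult_less_top)
    finally show "(\<integral>\<^sup>+x. ennreal (norm (case x of (s, \<omega>) \<Rightarrow> G s \<omega>)) \<partial>(lborel \<Otimes>\<^sub>M M)) < \<infinity>" .
  qed
  \<comment> \<open>\<open>R\<close> is the Gronwall bound times the weight. Its mean is
    \<open>c + b / (1 - b * t) * (t * c)\<close>, which is \<open>c / (1 - b * t)\<close>.\<close>
  define R where "R \<omega> = G t \<omega> + b / (1 - b * t) * (LINT s|lborel. G s \<omega>)" for \<omega>
  have int_G: "(LINT \<omega>|M. (LINT s|lborel. G s \<omega>)) = t * c"
  proof -
    have "(LINT \<omega>|M. (LINT s|lborel. G s \<omega>)) = (LINT s|lborel. (LINT \<omega>|M. G s \<omega>))"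
      using L.integral_fst[OF G_int] L.integral_snd[OF G_int] by simp
    also have "\<dots> = t * c" using t by (simp add: slice(2))
    finally show ?thesis .
  qed
  have R_int: "integrable M R" "(LINT \<omega>|M. R \<omega>) = c / (1 - b * t)"
  proof -
    show "integrable M R"
      unfolding R_def using slice(1)[of t] L.integrable_snd[OF G_int] by simp
    have "(LINT \<omega>|M. R \<omega>) = c + b / (1 - b * t) * (t * c)"
      unfolding R_def using slice[of t] L.integrable_snd[OF G_int] int_G t by simp
    also have "\<dots> = c / (1 - b * t)" using b(2) by (simp add: field_simps)
    finally show "(LINT \<omega>|M. R \<omega>) = c / (1 - b * t)" .
  qed
  have main: "AE \<omega> in M. ennreal (\<kappa> (X' 0 \<omega>)) * (ennreal (U (X' (\<tau> t \<omega>) \<omega>))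
      + (\<integral>\<^sup>+r\<in>{0..\<tau> t \<omega>}. ennreal (\<phi> (X' r \<omega>) * U (X' r \<omega>)) \<partial>lborel)) \<le> ennreal (R \<omega>) \<and> 0 \<le> R \<omega>"
    using AE_path[OF X' X'_eq drift] LU_int X'_eq L.AE_integrable_snd[OF G_int] AE_space
  proof eventually_elim
    case (elim \<omega>)
    have [measurable]: "(\<lambda>s. X' s \<omega>) \<in> borel_measurable borel"
      using elim(5) by (intro X'_comp) auto
    have [measurable]: "(\<lambda>s. \<tau> s \<omega>) \<in> borel_measurable borel"
      unfolding \<tau>_def by measurable
    have [measurable]: "(\<lambda>s. X' (\<tau> s \<omega>) \<omega>) \<in> borel_measurable borel"
      using elim(5) by (intro X'_comp) auto
    show ?case
    \<comment> \<open>Where the weight vanishes, integrability of \<open>G\<close> gives no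
      information on \<open>W\<close>, but there both sides are 0. Elsewhere the weight can be
      divided out.\<close>
    proof (cases "\<kappa> (X' 0 \<omega>) = 0")
      case True
      then show ?thesis by (simp add: R_def G_def)
    next
      case False
      define k where "k = \<kappa> (X' 0 \<omega>)"
      have k: "0 < k" using False \<kappa>(1)[of "X' 0 \<omega>"] by (simp add: k_def)
      have G_eq: "G s \<omega> = k * (indicator {0..t} s *\<^sub>R W s \<omega>)" for s by (simp add: G_def k_def)
      have W_int: "set_integrable lborel {0..t} (\<lambda>s. W s \<omega>)"
        using elim(4) k unfolding set_integrable_def G_eq by simp
      have LU_int': "set_integrable lborel {0..s} (\<lambda>r. LU (X' r \<omega>))" if "0 \<le> s" for s
      proof -
        have "set_integrable lborel {0..s} (\<lambda>r. LU (X r \<omega>))" using elim(2) that by blast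
        moreover have "set_integrable lborel {0..s} (\<lambda>r. LU (X r \<omega>)) = set_integrable lborel {0..s} (\<lambda>r. LU (X' r \<omega>))"
          by (rule set_integrable_cong) (use elim(3) in auto)
        ultimately show ?thesis by simp
      qed
      have U_nonneg: "0 \<le> U x" for x using U_ge[of x] by simp
      have \<tau>_props: "0 \<le> \<tau> s \<omega>" "\<tau> s \<omega> \<le> s" if "0 \<le> s" for s
        using stopped_time_props(1,2)[OF that, where T="T \<omega>"] unfolding \<tau>_def by auto
      have \<tau>_idem: "\<tau> r \<omega> = r" if "0 \<le> r" "r \<le> \<tau> s \<omega>" "0 \<le> s" for r s
        using stopped_time_props(4)[OF that(3,1), where T="T \<omega>"] that(2) unfolding \<tau>_def by blast
      have meas: "(\<lambda>r. U (X' r \<omega>)) \<in> borel_measurable borel"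
        "(\<lambda>s. U (X' (\<tau> s \<omega>) \<omega>)) \<in> borel_measurable borel"
        "(\<lambda>r. \<phi> (X' r \<omega>)) \<in> borel_measurable borel"
        by measurable
      have W_def': "W s \<omega> = U (X' (\<tau> s \<omega>) \<omega>) - (LINT r:{0..\<tau> s \<omega>}|lborel. LU (X' r \<omega>))" for s
        by (simp add: W_def)
      note gronwall = pathwise_gronwall[where u="\<lambda>r. U (X' r \<omega>)" and \<phi>="\<lambda>r. \<phi> (X' r \<omega>)"
          and lu="\<lambda>r. LU (X' r \<omega>)" and w="\<lambda>s. W s \<omega>" and \<tau>="\<lambda>s. \<tau> s \<omega>",
          OF t b _ _ _ U_nonneg \<phi>_nonneg meas _ elim(1) W_def' W_int]
      have gron: "set_integrable lborel {0..\<tau> t \<omega>} (\<lambda>r. \<phi> (X' r \<omega>) * U (X' r \<omega>))"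
        by (rule gronwall(1), erule \<tau>_props(1), erule \<tau>_props(2), erule (2) \<tau>_idem, erule LU_int')
      have gron_le: "U (X' (\<tau> t \<omega>) \<omega>) + (LINT r:{0..\<tau> t \<omega>}|lborel. \<phi> (X' r \<omega>) * U (X' r \<omega>))
          \<le> W t \<omega> + b / (1 - b * t) * (LINT s:{0..t}|lborel. W s \<omega>)"
        by (rule gronwall(2), erule \<tau>_props(1), erule \<tau>_props(2), erule (2) \<tau>_idem, erule LU_int')
      let ?I = "LINT r:{0..\<tau> t \<omega>}|lborel. \<phi> (X' r \<omega>) * U (X' r \<omega>)"
      have nonneg: "0 \<le> indicator {0..\<tau> t \<omega>} r *\<^sub>R (\<phi> (X' r \<omega>) * U (X' r \<omega>))" for r
        by (simp add: U_nonneg \<phi>_nonneg)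
      have I_nonneg: "0 \<le> ?I"
        unfolding set_lebesgue_integral_def by (rule integral_nonneg_AE) (rule AE_I2, rule nonneg)
      have I_eq: "(\<integral>\<^sup>+r\<in>{0..\<tau> t \<omega>}. ennreal (\<phi> (X' r \<omega>) * U (X' r \<omega>)) \<partial>lborel) = ennreal ?I"
      proof -
        have "(\<integral>\<^sup>+r\<in>{0..\<tau> t \<omega>}. ennreal (\<phi> (X' r \<omega>) * U (X' r \<omega>)) \<partial>lborel)
          = (\<integral>\<^sup>+r. ennreal (indicator {0..\<tau> t \<omega>} r *\<^sub>R (\<phi> (X' r \<omega>) * U (X' r \<omega>))) \<partial>lborel)"
          by (intro nn_integral_cong) (simp add: indicator_def)
        also have "\<dots> = ennreal ?I"
          using gron unfolding set_integrable_def set_lebesgue_integral_def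
          by (rule nn_integral_eq_integral) (rule AE_I2, rule nonneg)
        finally show ?thesis .
      qed
      have "k * (U (X' (\<tau> t \<omega>) \<omega>) + ?I) \<le> k * (W t \<omega> + b / (1 - b * t) * (LINT s:{0..t}|lborel. W s \<omega>))"
        using gron_le k by (intro mult_left_mono) auto
      also have "\<dots> = R \<omega>"
        using t by (simp add: R_def G_eq set_lebesgue_integral_def algebra_simps)
      finally have le: "k * (U (X' (\<tau> t \<omega>) \<omega>) + ?I) \<le> R \<omega>" .
      moreover have "0 \<le> k * (U (X' (\<tau> t \<omega>) \<omega>) + ?I)"
        using k I_nonneg U_nonneg by simp
      ultimately have R_nonneg: "0 \<le> R \<omega>" by linarith
      show ?thesis
        using k I_nonneg U_nonneg le R_nonneg unfolding I_eq k_def[symmetric]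
        by (auto simp: ennreal_mult[symmetric] ennreal_plus[symmetric] simp del: ennreal_plus intro!: ennreal_leI)
    qed
  qed
  have "(\<integral>\<^sup>+\<omega>. ennreal (\<kappa> (X' 0 \<omega>)) * (ennreal (U (X' (\<tau> t \<omega>) \<omega>))
      + (\<integral>\<^sup>+r\<in>{0..\<tau> t \<omega>}. ennreal (\<phi> (X' r \<omega>) * U (X' r \<omega>)) \<partial>lborel)) \<partial>M) \<le> (\<integral>\<^sup>+\<omega>. ennreal (R \<omega>) \<partial>M)"
    using main by (intro nn_integral_mono_AE) auto
  also have "\<dots> = ennreal (c / (1 - b * t))"
    using main R_int by (subst nn_integral_eq_integral) auto
  finally show ?thesis by (simp add: c_def)
qed

end

subsection \<open>Comparison of the Lyapunov function with the energy\<close>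

text \<open>Fatou's lemma for sequences that become constant at almost every point. Localisation is
  of this kind, since \<open>T n\<close> eventually exceeds a fixed time, and so are the truncations
  \<open>min y (real n)\<close>.\<close>

lemma nn_integral_le_eventually_eq:
  fixes f :: "nat \<Rightarrow> 'b \<Rightarrow> ennreal"
  assumes "\<And>n. f n \<in> borel_measurable M" and "AE x in M. eventually (\<lambda>n. f n x = g x) sequentially"
    and "\<And>n. (\<integral>\<^sup>+x. f n x \<partial>M) \<le> C"
  shows "(\<integral>\<^sup>+x. g x \<partial>M) \<le> C"
proof -
  have "(\<integral>\<^sup>+x. g x \<partial>M) = (\<integral>\<^sup>+x. liminf (\<lambda>n. f n x) \<partial>M)"
    by (rule nn_integral_cong_AE, use assms(2) in eventually_elim)
      (metis lim_imp_Liminf tendsto_eventually trivial_limit_sequentially)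
  also have "\<dots> \<le> liminf (\<lambda>n. \<integral>\<^sup>+x. f n x \<partial>M)"
    by (rule nn_integral_liminf[OF assms(1)])
  also have "\<dots> \<le> C"
    by (rule Liminf_le) (use assms(3) in auto)
  finally show ?thesis .
qed

lemma eventually_min_real_eq: "eventually (\<lambda>n. min y (real n) = y) sequentially"
proof -
  obtain N :: nat where "y \<le> real N" using real_arch_simple by blast
  then show ?thesis
    by (intro eventually_sequentiallyI[of N]) (metis min_absorb1 of_nat_mono order_trans)
qed

context reversible_markov_process
begin

text \<open>The bound for the stopped process does not depend on the localising time. Almost surely
  \<open>T n\<close> exceeds \<open>t\<close> for large \<open>n\<close>, and from then on the
  stopped integrand is the unstopped one, so no continuity of the path is used in the limit.\<close>

lemma lyapunov_bounded_weight:
  fixes U LU \<phi> \<kappa> :: "'a \<Rightarrow> real"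
  assumes X'[measurable]: "(\<lambda>(s, \<omega>). X' s \<omega>) \<in> borel_measurable (borel \<Otimes>\<^sub>M M)"
    and X'_eq: "AE \<omega> in M. \<forall>s\<ge>0. X' s \<omega> = X s \<omega>"
    and t: "0 \<le> t" and b: "0 \<le> b" "b * t < 1"
    and gen: "extended_generator M F X U LU" and U_ge: "\<And>x. 1 \<le> U x"
    and \<phi>_meas [measurable]: "\<phi> \<in> borel_measurable borel" and \<phi>_nonneg: "\<And>x. 0 \<le> \<phi> x"
    and drift: "AE x in \<mu>. LU x \<le> (b - \<phi> x) * U x"
    and \<kappa>_meas [measurable]: "\<kappa> \<in> borel_measurable borel"
    and \<kappa>: "\<And>x. 0 \<le> \<kappa> x" "\<And>x. \<kappa> x * U x \<le> K"
  shows "(\<integral>\<^sup>+\<omega>. ennreal (\<kappa> (X' 0 \<omega>)) * (ennreal (U (X' t \<omega>))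
      + (\<integral>\<^sup>+r\<in>{0..t}. ennreal (\<phi> (X' r \<omega>) * U (X' r \<omega>)) \<partial>lborel)) \<partial>M)
    \<le> ennreal ((LINT x|\<mu>. \<kappa> x * U x) / (1 - b * t))"
proof -
  have U_meas [measurable]: "U \<in> borel_measurable borel"
    using gen by (auto simp: extended_generator_def intro: borel_measurable_continuous_onI)
  have LU_meas: "LU \<in> borel_measurable borel"
    and LU_int: "AE \<omega> in M. \<forall>s\<ge>0. set_integrable lborel {0..s} (\<lambda>r. LU (X r \<omega>))"
    using gen by (auto simp: extended_generator_def)
  obtain T where T: "\<And>n. stopping_time F (T n)"
    and T_lim: "AE \<omega> in M. incseq (\<lambda>n. T n \<omega>) \<and> (\<lambda>n. T n \<omega>) \<longlonglongrightarrow> \<infinity>"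
    and mart: "\<And>n. martingale_ct M F
      (stopped (\<lambda>t \<omega>. U (X t \<omega>) - U (X 0 \<omega>) - (LINT s:{0..t}|lborel. LU (X s \<omega>))) (T n))"
    using gen unfolding extended_generator_def local_martingale_ct_def by blast
  define \<tau> where "\<tau> n \<omega> = enn2real (min (ennreal t) (T n \<omega>))" for n \<omega>
  have [measurable]: "T n \<in> borel_measurable M" for n
    by (rule measurable_stopping_time[OF T]) (use sub_algebra in \<open>auto simp: subalgebra_def\<close>)
  have [measurable]: "\<tau> n \<in> borel_measurable M" for n
    unfolding \<tau>_def by measurable
  note X'_comp = measurable_uncurried_compose[OF X']
  have [measurable]: "X' 0 \<in> borel_measurable M"
    by (rule X'_comp[of "\<lambda>_. 0" M "\<lambda>\<omega>. \<omega>"]) auto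
  have [measurable]: "(\<lambda>\<omega>. X' (\<tau> n \<omega>) \<omega>) \<in> borel_measurable M" for n
    by (rule X'_comp) auto
  have [measurable]: "(\<lambda>y. X' (snd y) (fst y)) \<in> borel_measurable (M \<Otimes>\<^sub>M lborel)"
    by (rule X'_comp) measurable
  have [measurable]: "(\<lambda>\<omega>. \<integral>\<^sup>+r\<in>{0..\<tau> n \<omega>}. ennreal (\<phi> (X' r \<omega>) * U (X' r \<omega>)) \<partial>lborel) \<in> borel_measurable M" for n
  proof -
    have "(\<lambda>(\<omega>, r). ennreal (\<phi> (X' r \<omega>) * U (X' r \<omega>)) * indicator {0..\<tau> n \<omega>} r) \<in> borel_measurable (M \<Otimes>\<^sub>M lborel)"
      unfolding indicator_def atLeastAtMost_iff case_prod_beta by measurable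
    from lborel.borel_measurable_nn_integral[OF this] show ?thesis by simp
  qed
  show ?thesis
  proof (rule nn_integral_le_eventually_eq)
    fix n
    show "(\<lambda>\<omega>. ennreal (\<kappa> (X' 0 \<omega>)) * (ennreal (U (X' (\<tau> n \<omega>) \<omega>))
      + (\<integral>\<^sup>+r\<in>{0..\<tau> n \<omega>}. ennreal (\<phi> (X' r \<omega>) * U (X' r \<omega>)) \<partial>lborel))) \<in> borel_measurable M"
      by measurable
    show "(\<integral>\<^sup>+\<omega>. ennreal (\<kappa> (X' 0 \<omega>)) * (ennreal (U (X' (\<tau> n \<omega>) \<omega>))
      + (\<integral>\<^sup>+r\<in>{0..\<tau> n \<omega>}. ennreal (\<phi> (X' r \<omega>) * U (X' r \<omega>)) \<partial>lborel)) \<partial>M)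
      \<le> ennreal ((LINT x|\<mu>. \<kappa> x * U x) / (1 - b * t))"
      unfolding \<tau>_def
      by (rule lyapunov_stopped[OF X' X'_eq t b U_meas U_ge LU_meas \<phi>_meas \<phi>_nonneg drift LU_int T mart \<kappa>_meas \<kappa>])
  next
    show "AE \<omega> in M. \<forall>\<^sub>F n in sequentially.
        ennreal (\<kappa> (X' 0 \<omega>)) * (ennreal (U (X' (\<tau> n \<omega>) \<omega>))
          + (\<integral>\<^sup>+r\<in>{0..\<tau> n \<omega>}. ennreal (\<phi> (X' r \<omega>) * U (X' r \<omega>)) \<partial>lborel))
        = ennreal (\<kappa> (X' 0 \<omega>)) * (ennreal (U (X' t \<omega>))
          + (\<integral>\<^sup>+r\<in>{0..t}. ennreal (\<phi> (X' r \<omega>) * U (X' r \<omega>)) \<partial>lborel))"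
      using T_lim
    proof eventually_elim
      case (elim \<omega>)
      have "\<forall>\<^sub>F n in sequentially. ennreal t < T n \<omega>"
        using elim by (intro order_tendstoD(1)[where y=\<infinity>]) auto
      then show ?case
      proof eventually_elim
        case (elim n)
        then have "min (ennreal t) (T n \<omega>) = ennreal t" by (intro min_absorb1 less_imp_le)
        then have "\<tau> n \<omega> = t" using t by (simp add: \<tau>_def)
        then show ?case by simp
      qed
    qed
  qed
qed

text \<open>The weight \<open>min k n / U\<close> is admissible with \<open>K = n\<close> because
  \<open>U\<close> cancels; the same cancellation turns the right-hand side into the integral of
  \<open>min k n\<close>, which is at most that of \<open>k\<close>.\<close>

lemma lyapunov_weight:
  fixes U LU \<phi> k :: "'a \<Rightarrow> real"
  assumes X'[measurable]: "(\<lambda>(s, \<omega>). X' s \<omega>) \<in> borel_measurable (borel \<Otimes>\<^sub>M M)"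
    and X'_eq: "AE \<omega> in M. \<forall>s\<ge>0. X' s \<omega> = X s \<omega>"
    and t: "0 \<le> t" and b: "0 \<le> b" "b * t < 1"
    and gen: "extended_generator M F X U LU" and U_ge: "\<And>x. 1 \<le> U x"
    and \<phi>_meas [measurable]: "\<phi> \<in> borel_measurable borel" and \<phi>_nonneg: "\<And>x. 0 \<le> \<phi> x"
    and drift: "AE x in \<mu>. LU x \<le> (b - \<phi> x) * U x"
    and k_int: "integrable \<mu> k" and k_nonneg: "\<And>x. 0 \<le> k x"
  shows "(\<integral>\<^sup>+\<omega>. ennreal (k (X' 0 \<omega>) / U (X' 0 \<omega>)) * (ennreal (U (X' t \<omega>))
      + (\<integral>\<^sup>+r\<in>{0..t}. ennreal (\<phi> (X' r \<omega>) * U (X' r \<omega>)) \<partial>lborel)) \<partial>M)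
    \<le> ennreal ((LINT x|\<mu>. k x) / (1 - b * t))"
proof (rule nn_integral_le_eventually_eq)
  have U_meas [measurable]: "U \<in> borel_measurable borel"
    using gen by (auto simp: extended_generator_def intro: borel_measurable_continuous_onI)
  have k_meas [measurable]: "k \<in> borel_measurable borel"
    using borel_measurable_integrable[OF k_int] by (simp add: borel_measurable_mu)
  note X'_comp = measurable_uncurried_compose[OF X']
  have [measurable]: "X' s \<in> borel_measurable M" for s
    by (rule X'_comp[of "\<lambda>_. s" M "\<lambda>\<omega>. \<omega>"]) auto
  have [measurable]: "(\<lambda>y. X' (snd y) (fst y)) \<in> borel_measurable (M \<Otimes>\<^sub>M lborel)"
    by (rule X'_comp) measurable
  have [measurable]: "(\<lambda>\<omega>. \<integral>\<^sup>+r\<in>{0..t}. ennreal (\<phi> (X' r \<omega>) * U (X' r \<omega>)) \<partial>lborel) \<in> borel_measurable M"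
  proof -
    have "(\<lambda>(\<omega>, r). ennreal (\<phi> (X' r \<omega>) * U (X' r \<omega>)) * indicator {0..t} r) \<in> borel_measurable (M \<Otimes>\<^sub>M lborel)"
      unfolding case_prod_beta by measurable
    from lborel.borel_measurable_nn_integral[OF this] show ?thesis by simp
  qed
  have U_pos: "0 < U x" for x using U_ge[of x] by simp
  fix n :: nat
  show "(\<lambda>\<omega>. ennreal (min (k (X' 0 \<omega>)) (real n) / U (X' 0 \<omega>)) * (ennreal (U (X' t \<omega>))
      + (\<integral>\<^sup>+r\<in>{0..t}. ennreal (\<phi> (X' r \<omega>) * U (X' r \<omega>)) \<partial>lborel))) \<in> borel_measurable M"
    by measurable
  have "(\<integral>\<^sup>+\<omega>. ennreal (min (k (X' 0 \<omega>)) (real n) / U (X' 0 \<omega>)) * (ennreal (U (X' t \<omega>))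
      + (\<integral>\<^sup>+r\<in>{0..t}. ennreal (\<phi> (X' r \<omega>) * U (X' r \<omega>)) \<partial>lborel)) \<partial>M)
    \<le> ennreal ((LINT x|\<mu>. min (k x) (real n) / U x * U x) / (1 - b * t))"
    by (rule lyapunov_bounded_weight[OF X' X'_eq t b gen U_ge \<phi>_meas \<phi>_nonneg drift, where K="real n"
          and \<kappa>="\<lambda>x. min (k x) (real n) / U x"])
      (use U_pos k_nonneg in \<open>simp_all add: less_imp_le less_imp_neq[THEN not_sym]\<close>)
  also have "\<dots> \<le> ennreal ((LINT x|\<mu>. k x) / (1 - b * t))"
  proof (intro ennreal_leI divide_right_mono)
    have "(LINT x|\<mu>. min (k x) (real n) / U x * U x) = (LINT x|\<mu>. min (k x) (real n))"
      using U_pos by (simp add: less_imp_neq[THEN not_sym])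
    also have "\<dots> \<le> (LINT x|\<mu>. k x)"
    proof (rule integral_mono[OF _ k_int])
      show "integrable \<mu> (\<lambda>x. min (k x) (real n))"
        by (rule mu.integrable_const_bound[where B="real n"]) (use k_nonneg in auto)
    qed simp
    finally show "(LINT x|\<mu>. min (k x) (real n) / U x * U x) \<le> (LINT x|\<mu>. k x)" .
  qed (use b in simp)
  finally show "(\<integral>\<^sup>+\<omega>. ennreal (min (k (X' 0 \<omega>)) (real n) / U (X' 0 \<omega>)) * (ennreal (U (X' t \<omega>))
      + (\<integral>\<^sup>+r\<in>{0..t}. ennreal (\<phi> (X' r \<omega>) * U (X' r \<omega>)) \<partial>lborel)) \<partial>M)
    \<le> ennreal ((LINT x|\<mu>. k x) / (1 - b * t))" .
next
  show "AE \<omega> in M. \<forall>\<^sub>F n in sequentially.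
      ennreal (min (k (X' 0 \<omega>)) (real n) / U (X' 0 \<omega>)) * (ennreal (U (X' t \<omega>))
      + (\<integral>\<^sup>+r\<in>{0..t}. ennreal (\<phi> (X' r \<omega>) * U (X' r \<omega>)) \<partial>lborel))
    = ennreal (k (X' 0 \<omega>) / U (X' 0 \<omega>)) * (ennreal (U (X' t \<omega>))
      + (\<integral>\<^sup>+r\<in>{0..t}. ennreal (\<phi> (X' r \<omega>) * U (X' r \<omega>)) \<partial>lborel))"
  proof (rule AE_I2)
    fix \<omega>
    show "\<forall>\<^sub>F n in sequentially.
      ennreal (min (k (X' 0 \<omega>)) (real n) / U (X' 0 \<omega>)) * (ennreal (U (X' t \<omega>))
      + (\<integral>\<^sup>+r\<in>{0..t}. ennreal (\<phi> (X' r \<omega>) * U (X' r \<omega>)) \<partial>lborel))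
    = ennreal (k (X' 0 \<omega>) / U (X' 0 \<omega>)) * (ennreal (U (X' t \<omega>))
      + (\<integral>\<^sup>+r\<in>{0..t}. ennreal (\<phi> (X' r \<omega>) * U (X' r \<omega>)) \<partial>lborel))"
      using eventually_min_real_eq[of "k (X' 0 \<omega>)"] by eventually_elim simp
  qed
qed

text \<open>Reversibility is given on \<open>L2 \<mu>\<close>, so both functions are truncated
  first. One inequality for all pairs suffices, since exchanging the functions yields the other.
  Both sides may be infinite, which matters for \<open>U\<close>.\<close>

lemma two_point_symmetric:
  fixes f g :: "'a \<Rightarrow> real"
  assumes t: "0 \<le> t" and f_meas: "f \<in> borel_measurable borel" and g_meas: "g \<in> borel_measurable borel"
    and nonneg: "\<And>x. 0 \<le> f x" "\<And>x. 0 \<le> g x"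
  shows "(\<integral>\<^sup>+\<omega>. ennreal (f (X 0 \<omega>) * g (X t \<omega>)) \<partial>M) = (\<integral>\<^sup>+\<omega>. ennreal (g (X 0 \<omega>) * f (X t \<omega>)) \<partial>M)"
proof -
  note X_measurable[OF t, measurable] X_measurable[of 0, simplified, measurable]
  have le: "(\<integral>\<^sup>+\<omega>. ennreal (f (X 0 \<omega>) * g (X t \<omega>)) \<partial>M) \<le> (\<integral>\<^sup>+\<omega>. ennreal (g (X 0 \<omega>) * f (X t \<omega>)) \<partial>M)"
    if [measurable]: "f \<in> borel_measurable borel" "g \<in> borel_measurable borel"
      and nonneg: "\<And>x. 0 \<le> f x" "\<And>x. 0 \<le> g x" for f g :: "'a \<Rightarrow> real"
  proof (rule nn_integral_le_eventually_eq)
    fix n :: nat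
    let ?f = "\<lambda>x. min (f x) (real n)" and ?g = "\<lambda>x. min (g x) (real n)"
    show "(\<lambda>\<omega>. ennreal (?f (X 0 \<omega>) * ?g (X t \<omega>))) \<in> borel_measurable M" by measurable
    have L2: "?f \<in> L2 \<mu>" "?g \<in> L2 \<mu>"
      by (rule mu.L2_bounded[where B="real n"]; use nonneg in \<open>simp add: borel_measurable_mu\<close>)+
    have "(\<integral>\<^sup>+\<omega>. ennreal (?f (X 0 \<omega>) * ?g (X t \<omega>)) \<partial>M) = ennreal (LINT \<omega>|M. ?f (X 0 \<omega>) * ?g (X t \<omega>))"
      by (rule nn_integral_eq_integral[OF two_point_integrable[OF t L2]]) (simp add: nonneg)
    also have "(LINT \<omega>|M. ?f (X 0 \<omega>) * ?g (X t \<omega>)) = (LINT x|\<mu>. ?f x * semigroup_op P t ?g x)"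
      by (rule two_point_integral[OF t L2, symmetric])
    also have "\<dots> = (LINT x|\<mu>. semigroup_op P t ?f x * ?g x)"
      by (rule reversible[OF t L2])
    also have "\<dots> = (LINT x|\<mu>. ?g x * semigroup_op P t ?f x)"
      by (simp add: mult.commute)
    also have "\<dots> = (LINT \<omega>|M. ?g (X 0 \<omega>) * ?f (X t \<omega>))"
      by (rule two_point_integral[OF t L2(2,1)])
    also have "ennreal \<dots> = (\<integral>\<^sup>+\<omega>. ennreal (?g (X 0 \<omega>) * ?f (X t \<omega>)) \<partial>M)"
      by (rule nn_integral_eq_integral[OF two_point_integrable[OF t L2(2,1)], symmetric]) (simp add: nonneg)
    also have "\<dots> \<le> (\<integral>\<^sup>+\<omega>. ennreal (g (X 0 \<omega>) * f (X t \<omega>)) \<partial>M)"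
      by (intro nn_integral_mono ennreal_leI mult_mono) (auto simp: nonneg)
    finally show "(\<integral>\<^sup>+\<omega>. ennreal (?f (X 0 \<omega>) * ?g (X t \<omega>)) \<partial>M) \<le> (\<integral>\<^sup>+\<omega>. ennreal (g (X 0 \<omega>) * f (X t \<omega>)) \<partial>M)" .
  next
    show "AE \<omega> in M. \<forall>\<^sub>F n in sequentially. ennreal (min (f (X 0 \<omega>)) (real n) * min (g (X t \<omega>)) (real n))
        = ennreal (f (X 0 \<omega>) * g (X t \<omega>))"
    proof (rule AE_I2)
      fix \<omega>
      show "\<forall>\<^sub>F n in sequentially. ennreal (min (f (X 0 \<omega>)) (real n) * min (g (X t \<omega>)) (real n))
        = ennreal (f (X 0 \<omega>) * g (X t \<omega>))"
        using eventually_min_real_eq[of "f (X 0 \<omega>)"] eventually_min_real_eq[of "g (X t \<omega>)"]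
        by eventually_elim simp
    qed
  qed
  show ?thesis
    using le[OF f_meas g_meas nonneg] le[OF g_meas f_meas nonneg(2,1)] by (rule antisym)
qed

text \<open>Swapping \<open>X 0\<close> and \<open>X t\<close> exchanges the two summands of the
  arithmetic-geometric mean bound, so by symmetry they have equal expectation and the factor 2
  cancels. What remains is the expectation of \<open>U (X t)\<close> with weight
  \<open>h^2 / U\<close> at time 0, the quantity controlled by
  \<open>lyapunov_weight\<close>.\<close>

lemma two_point_amgm:
  fixes U h :: "'a \<Rightarrow> real"
  assumes t: "0 \<le> t" and U_meas [measurable]: "U \<in> borel_measurable borel" and U_ge: "\<And>x. 1 \<le> U x"
    and h: "h \<in> L2 \<mu>"
  shows "ennreal (LINT \<omega>|M. \<bar>h (X 0 \<omega>) * h (X t \<omega>)\<bar>)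
    \<le> (\<integral>\<^sup>+\<omega>. ennreal ((h (X 0 \<omega>))\<^sup>2 / U (X 0 \<omega>) * U (X t \<omega>)) \<partial>M)" (is "?L \<le> ?R")
proof -
  note X_measurable[OF t, measurable] X_measurable[of 0, simplified, measurable]
  have [measurable]: "h \<in> borel_measurable borel"
    using L2_D(1)[OF h] by (simp add: borel_measurable_mu)
  have U_pos: "0 < U x" for x using U_ge[of x] by simp
  have U_nonneg: "0 \<le> U x" for x using U_ge[of x] by simp
  have L_eq: "?L = (\<integral>\<^sup>+\<omega>. ennreal \<bar>h (X 0 \<omega>) * h (X t \<omega>)\<bar> \<partial>M)"
    by (rule nn_integral_eq_integral[symmetric]) (use two_point_integrable[OF t h h] in auto)
  have amgm: "2 * \<bar>p * q\<bar> \<le> p\<^sup>2 / u * v + u * (q\<^sup>2 / v)" if "0 < u" "0 < v" for p q u v :: real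
  proof -
    have "0 \<le> (\<bar>p\<bar> * v - \<bar>q\<bar> * u)\<^sup>2 / (u * v)" using that by simp
    also have "\<dots> = p\<^sup>2 / u * v + u * (q\<^sup>2 / v) - 2 * \<bar>p * q\<bar>"
      using that by (simp add: field_simps power2_eq_square abs_mult)
    finally show ?thesis by simp
  qed
  have "2 * ?L = (\<integral>\<^sup>+\<omega>. 2 * ennreal \<bar>h (X 0 \<omega>) * h (X t \<omega>)\<bar> \<partial>M)"
    unfolding L_eq by (rule nn_integral_cmult[symmetric]) measurable
  also have "\<dots> \<le> (\<integral>\<^sup>+\<omega>. ennreal ((h (X 0 \<omega>))\<^sup>2 / U (X 0 \<omega>) * U (X t \<omega>))
      + ennreal (U (X 0 \<omega>) * ((h (X t \<omega>))\<^sup>2 / U (X t \<omega>))) \<partial>M)"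
  proof (rule nn_integral_mono)
    fix \<omega>
    have "2 * ennreal \<bar>h (X 0 \<omega>) * h (X t \<omega>)\<bar> = ennreal (2 * \<bar>h (X 0 \<omega>) * h (X t \<omega>)\<bar>)"
      by (subst ennreal_mult) auto
    also have "\<dots> \<le> ennreal ((h (X 0 \<omega>))\<^sup>2 / U (X 0 \<omega>) * U (X t \<omega>) + U (X 0 \<omega>) * ((h (X t \<omega>))\<^sup>2 / U (X t \<omega>)))"
      by (intro ennreal_leI amgm U_pos)
    also have "\<dots> = ennreal ((h (X 0 \<omega>))\<^sup>2 / U (X 0 \<omega>) * U (X t \<omega>))
      + ennreal (U (X 0 \<omega>) * ((h (X t \<omega>))\<^sup>2 / U (X t \<omega>)))"
      by (rule ennreal_plus) (simp_all add: U_nonneg)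
    finally show "2 * ennreal \<bar>h (X 0 \<omega>) * h (X t \<omega>)\<bar> \<le> ennreal ((h (X 0 \<omega>))\<^sup>2 / U (X 0 \<omega>) * U (X t \<omega>))
      + ennreal (U (X 0 \<omega>) * ((h (X t \<omega>))\<^sup>2 / U (X t \<omega>)))" .
  qed
  also have "\<dots> = ?R + (\<integral>\<^sup>+\<omega>. ennreal (U (X 0 \<omega>) * ((h (X t \<omega>))\<^sup>2 / U (X t \<omega>))) \<partial>M)"
    by (rule nn_integral_add) measurable
  also have "(\<integral>\<^sup>+\<omega>. ennreal (U (X 0 \<omega>) * ((h (X t \<omega>))\<^sup>2 / U (X t \<omega>))) \<partial>M) = ?R"
    by (rule two_point_symmetric[OF t, of U "\<lambda>x. (h x)\<^sup>2 / U x"]) (simp_all add: U_nonneg)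
  also have "?R + ?R = 2 * ?R" by (simp add: mult_2)
  finally show ?thesis by (simp add: ennreal_mult_le_mult_iff)
qed

text \<open>The approximating form, the inner product of \<open>h - semigroup_op P t h\<close> with
  \<open>h\<close> divided by \<open>t\<close>, written through increments of the stationary
  process. In this shape it is visibly nonnegative and blind to additive constants, so
  \<open>h - c\<close> can be treated without discussing constants in the domain of the
  generator.\<close>

definition energy :: "real \<Rightarrow> ('a \<Rightarrow> real) \<Rightarrow> real" where
  "energy t h = (LINT \<omega>|M. (h (X 0 \<omega>) - h (X t \<omega>))\<^sup>2) / (2 * t)"

lemma energy_nonneg: "0 \<le> t \<Longrightarrow> 0 \<le> energy t h"
  by (simp add: energy_def)

lemma energy_diff_const: "energy t (\<lambda>x. h x - c) = energy t h"
  by (simp add: energy_def)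

lemma energy_eq:
  assumes t: "0 \<le> t" and h: "h \<in> L2 \<mu>"
  shows "(LINT \<omega>|M. (h (X 0 \<omega>) - h (X t \<omega>))\<^sup>2) = 2 * (LINT x|\<mu>. (h x)\<^sup>2) - 2 * (LINT \<omega>|M. h (X 0 \<omega>) * h (X t \<omega>))"
proof -
  have [measurable]: "h \<in> borel_measurable borel"
    using L2_D(1)[OF h] by (simp add: borel_measurable_mu)
  have int: "integrable M (\<lambda>\<omega>. (h (X s \<omega>))\<^sup>2)" "(LINT \<omega>|M. (h (X s \<omega>))\<^sup>2) = (LINT x|\<mu>. (h x)\<^sup>2)" if "0 \<le> s" for s
    using integrable_law[OF that, of "\<lambda>x. (h x)\<^sup>2"] integral_law[OF that, of "\<lambda>x. (h x)\<^sup>2"] L2_D(2)[OF h] by simp_all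
  have "(LINT \<omega>|M. (h (X 0 \<omega>) - h (X t \<omega>))\<^sup>2)
    = (LINT \<omega>|M. (h (X 0 \<omega>))\<^sup>2 - 2 * (h (X 0 \<omega>) * h (X t \<omega>)) + (h (X t \<omega>))\<^sup>2)"
    by (intro Bochner_Integration.integral_cong) (simp_all add: power2_eq_square algebra_simps)
  also have "\<dots> = (LINT \<omega>|M. (h (X 0 \<omega>))\<^sup>2) - 2 * (LINT \<omega>|M. h (X 0 \<omega>) * h (X t \<omega>)) + (LINT \<omega>|M. (h (X t \<omega>))\<^sup>2)"
    using int(1)[of 0] int(1)[OF t] two_point_integrable[OF t h h] by simp
  finally show ?thesis using int(2)[of 0] int(2)[OF t] by simp
qed

text \<open>The bound for \<open>h (X 0) * h (X t)\<close> and the time integral of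
  \<open>\<phi> * U\<close>, both weighted by \<open>h^2 / U\<close> at time 0, add up to the
  left-hand side of \<open>lyapunov_weight\<close> with \<open>k = h^2\<close>. The number
  \<open>m\<close> bounds that time integral from below per unit of time; it is tested on the
  minorants \<kappa> and \<psi> because \<open>h^2 / U\<close> and \<open>\<phi> * U\<close> need
  not lie in \<open>L2 \<mu>\<close>.\<close>

lemma lyapunov_comparison:
  fixes U LU \<phi> h :: "'a \<Rightarrow> real"
  assumes t: "0 < t" and b: "0 \<le> b" "b * t < 1"
    and gen: "extended_generator M F X U LU" and U_ge: "\<And>x. 1 \<le> U x"
    and \<phi>_meas [measurable]: "\<phi> \<in> borel_measurable borel" and \<phi>_nonneg: "\<And>x. 0 \<le> \<phi> x"
    and drift: "AE x in \<mu>. LU x \<le> (b - \<phi> x) * U x"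
    and h: "h \<in> L2 \<mu>"
    and \<kappa>_L2: "\<kappa> \<in> L2 \<mu>" and \<kappa>: "\<And>x. 0 \<le> \<kappa> x" "\<And>x. \<kappa> x \<le> (h x)\<^sup>2 / U x"
    and \<psi>_L2: "\<psi> \<in> L2 \<mu>" and \<psi>: "\<And>x. 0 \<le> \<psi> x" "\<And>x. \<psi> x \<le> \<phi> x * U x"
    and m: "0 \<le> m" "\<And>r. 0 < r \<Longrightarrow> r \<le> t \<Longrightarrow> m \<le> (LINT x|\<mu>. \<kappa> x * semigroup_op P r \<psi> x)"
  shows "m \<le> energy t h + b / (1 - b * t) * (LINT x|\<mu>. (h x)\<^sup>2)"
proof -
  obtain X' where X'[measurable]: "(\<lambda>(s, \<omega>). X' s \<omega>) \<in> borel_measurable (borel \<Otimes>\<^sub>M M)"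
    and X'_eq: "AE \<omega> in M. \<forall>s\<ge>0. X' s \<omega> = X s \<omega>"
    by (rule cadlag_modification)
  interpret L: pair_sigma_finite lborel M ..
  have t0: "0 \<le> t" using t by simp
  have [measurable]: "h \<in> borel_measurable borel" "\<kappa> \<in> borel_measurable borel" "\<psi> \<in> borel_measurable borel"
    using L2_D(1)[OF h] L2_D(1)[OF \<kappa>_L2] L2_D(1)[OF \<psi>_L2] by (simp_all add: borel_measurable_mu)
  have U_meas [measurable]: "U \<in> borel_measurable borel"
    using gen by (auto simp: extended_generator_def intro: borel_measurable_continuous_onI)
  have U_nonneg: "0 \<le> U x" for x using U_ge[of x] by simp
  note X'_comp = measurable_uncurried_compose[OF X']
  have [measurable]: "X' s \<in> borel_measurable M" for s
    by (rule X'_comp[of "\<lambda>_. s" M "\<lambda>\<omega>. \<omega>"]) auto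
  have [measurable]: "(\<lambda>y. X' (snd y) (fst y)) \<in> borel_measurable (M \<Otimes>\<^sub>M lborel)"
    "(\<lambda>y. X' (fst y) (snd y)) \<in> borel_measurable (lborel \<Otimes>\<^sub>M M)"
    by (rule X'_comp; measurable)+
  let ?I = "\<lambda>\<omega>. \<integral>\<^sup>+r\<in>{0..t}. ennreal (\<phi> (X' r \<omega>) * U (X' r \<omega>)) \<partial>lborel"
  have I_meas [measurable]: "?I \<in> borel_measurable M"
  proof -
    have "(\<lambda>(\<omega>, r). ennreal (\<phi> (X' r \<omega>) * U (X' r \<omega>)) * indicator {0..t} r) \<in> borel_measurable (M \<Otimes>\<^sub>M lborel)"
      unfolding case_prod_beta by measurable
    from lborel.borel_measurable_nn_integral[OF this] show ?thesis by simp
  qed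
  let ?k = "\<lambda>\<omega>. (h (X' 0 \<omega>))\<^sup>2 / U (X' 0 \<omega>)"
  \<comment> \<open>Exchanging expectation and time integral requires the jointly measurable
    \<open>X'\<close>; the two-point law is known for \<open>X\<close>, and both agree almost surely
    at the times concerned.\<close>
  have occupation: "ennreal (t * m) \<le> (\<integral>\<^sup>+\<omega>. ennreal (?k \<omega>) * ?I \<omega> \<partial>M)"
  proof -
    \<comment> \<open>The interval is open at 0 because \<open>m\<close> is a lower bound only at
      positive times; its length is still \<open>t\<close>.\<close>
    have "ennreal (t * m) = (\<integral>\<^sup>+r. ennreal m * indicator {0<..t} r \<partial>lborel)"
      using t m by (subst nn_integral_cmult_indicator) (simp_all add: ennreal_mult mult.commute)
    also have "\<dots> \<le> (\<integral>\<^sup>+r. \<integral>\<^sup>+\<omega>. ennreal (\<kappa> (X' 0 \<omega>) * \<psi> (X' r \<omega>)) * indicator {0..t} r \<partial>M \<partial>lborel)"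
    proof (rule nn_integral_mono)
      fix r :: real
      show "ennreal m * indicator {0<..t} r \<le> (\<integral>\<^sup>+\<omega>. ennreal (\<kappa> (X' 0 \<omega>) * \<psi> (X' r \<omega>)) * indicator {0..t} r \<partial>M)"
      proof (cases "r \<in> {0<..t}")
        case True
        then have r: "0 \<le> r" "0 < r" "r \<le> t" by auto
        have "ennreal m \<le> ennreal (LINT x|\<mu>. \<kappa> x * semigroup_op P r \<psi> x)"
          using m(2)[OF r(2,3)] by (rule ennreal_leI)
        also have "\<dots> = ennreal (LINT \<omega>|M. \<kappa> (X 0 \<omega>) * \<psi> (X r \<omega>))"
          by (simp only: two_point_integral[OF r(1) \<kappa>_L2 \<psi>_L2])
        also have "\<dots> = (\<integral>\<^sup>+\<omega>. ennreal (\<kappa> (X 0 \<omega>) * \<psi> (X r \<omega>)) \<partial>M)"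
          by (rule nn_integral_eq_integral[symmetric, OF two_point_integrable[OF r(1) \<kappa>_L2 \<psi>_L2]])
            (simp add: \<kappa> \<psi>)
        also have "\<dots> = (\<integral>\<^sup>+\<omega>. ennreal (\<kappa> (X' 0 \<omega>) * \<psi> (X' r \<omega>)) * indicator {0..t} r \<partial>M)"
          by (rule nn_integral_cong_AE, use X'_eq in eventually_elim) (use r in simp)
        finally show ?thesis using True by simp
      qed simp
    qed
    also have "\<dots> = (\<integral>\<^sup>+\<omega>. \<integral>\<^sup>+r. ennreal (\<kappa> (X' 0 \<omega>) * \<psi> (X' r \<omega>)) * indicator {0..t} r \<partial>lborel \<partial>M)"
      by (rule L.Fubini'[symmetric]) (unfold case_prod_beta, measurable)
    also have "\<dots> \<le> (\<integral>\<^sup>+\<omega>. ennreal (?k \<omega>) * ?I \<omega> \<partial>M)"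
    proof (rule nn_integral_mono)
      fix \<omega> assume \<omega>: "\<omega> \<in> space M"
      have [measurable]: "(\<lambda>s. X' s \<omega>) \<in> borel_measurable borel"
        using \<omega> by (intro X'_comp) auto
      have "(\<integral>\<^sup>+r. ennreal (\<kappa> (X' 0 \<omega>) * \<psi> (X' r \<omega>)) * indicator {0..t} r \<partial>lborel)
        \<le> (\<integral>\<^sup>+r. ennreal (?k \<omega>) * (ennreal (\<phi> (X' r \<omega>) * U (X' r \<omega>)) * indicator {0..t} r) \<partial>lborel)"
      proof (rule nn_integral_mono)
        fix r
        have "ennreal (\<kappa> (X' 0 \<omega>) * \<psi> (X' r \<omega>)) \<le> ennreal (?k \<omega> * (\<phi> (X' r \<omega>) * U (X' r \<omega>)))"
          by (intro ennreal_leI mult_mono \<kappa> \<psi>) (simp_all add: U_nonneg)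
        also have "\<dots> = ennreal (?k \<omega>) * ennreal (\<phi> (X' r \<omega>) * U (X' r \<omega>))"
          by (rule ennreal_mult) (simp_all add: U_nonneg \<phi>_nonneg)
        finally show "ennreal (\<kappa> (X' 0 \<omega>) * \<psi> (X' r \<omega>)) * indicator {0..t} r
          \<le> ennreal (?k \<omega>) * (ennreal (\<phi> (X' r \<omega>) * U (X' r \<omega>)) * indicator {0..t} r)"
          by (simp add: mult.assoc[symmetric] mult_right_mono)
      qed
      also have "\<dots> = ennreal (?k \<omega>) * ?I \<omega>"
        by (rule nn_integral_cmult) measurable
      finally show "(\<integral>\<^sup>+r. ennreal (\<kappa> (X' 0 \<omega>) * \<psi> (X' r \<omega>)) * indicator {0..t} r \<partial>lborel) \<le> ennreal (?k \<omega>) * ?I \<omega>" .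
    qed
    finally show ?thesis .
  qed
  let ?E = "LINT \<omega>|M. \<bar>h (X 0 \<omega>) * h (X t \<omega>)\<bar>"
  have "ennreal (?E + t * m) = ennreal ?E + ennreal (t * m)"
    using t m by (intro ennreal_plus) auto
  also have "\<dots> \<le> (\<integral>\<^sup>+\<omega>. ennreal ((h (X 0 \<omega>))\<^sup>2 / U (X 0 \<omega>) * U (X t \<omega>)) \<partial>M) + (\<integral>\<^sup>+\<omega>. ennreal (?k \<omega>) * ?I \<omega> \<partial>M)"
    by (intro add_mono two_point_amgm[OF t0 U_meas U_ge h] occupation)
  also have "(\<integral>\<^sup>+\<omega>. ennreal ((h (X 0 \<omega>))\<^sup>2 / U (X 0 \<omega>) * U (X t \<omega>)) \<partial>M)
      = (\<integral>\<^sup>+\<omega>. ennreal (?k \<omega>) * ennreal (U (X' t \<omega>)) \<partial>M)"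
    by (rule nn_integral_cong_AE, use X'_eq in eventually_elim)
      (use t0 U_nonneg in \<open>simp add: ennreal_mult[symmetric]\<close>)
  also have "\<dots> + (\<integral>\<^sup>+\<omega>. ennreal (?k \<omega>) * ?I \<omega> \<partial>M) = (\<integral>\<^sup>+\<omega>. ennreal (?k \<omega>) * (ennreal (U (X' t \<omega>)) + ?I \<omega>) \<partial>M)"
    by (subst nn_integral_add[symmetric]) (auto simp: distrib_left)
  also have "\<dots> \<le> ennreal ((LINT x|\<mu>. (h x)\<^sup>2) / (1 - b * t))"
    by (rule lyapunov_weight[OF X' X'_eq t0 b gen U_ge \<phi>_meas \<phi>_nonneg drift L2_D(2)[OF h]]) simp
  finally have "?E + t * m \<le> (LINT x|\<mu>. (h x)\<^sup>2) / (1 - b * t)"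
    using b(2) by (subst (asm) ennreal_le_iff) auto
  moreover have "(LINT \<omega>|M. h (X 0 \<omega>) * h (X t \<omega>)) \<le> ?E"
    using two_point_integrable[OF t0 h h] by (intro integral_mono) auto
  ultimately have "t * m \<le> (LINT x|\<mu>. (h x)\<^sup>2) / (1 - b * t) - (LINT \<omega>|M. h (X 0 \<omega>) * h (X t \<omega>))"
    by simp
  \<comment> \<open>As \<open>1 / (1 - b * t) = 1 + t * (b / (1 - b * t))\<close> and the two-point
    product is the integral of \<open>h^2\<close> minus \<open>t * energy t h\<close>, the terms of
    order zero cancel and a factor \<open>t\<close> splits off.\<close>
  also have "\<dots> = t * (energy t h + b / (1 - b * t) * (LINT x|\<mu>. (h x)\<^sup>2))"
  proof -
    have "(LINT \<omega>|M. h (X 0 \<omega>) * h (X t \<omega>)) = (LINT x|\<mu>. (h x)\<^sup>2) - t * energy t h"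
    proof -
      have "2 * (t * energy t h) = (LINT \<omega>|M. (h (X 0 \<omega>) - h (X t \<omega>))\<^sup>2)"
        using t by (simp add: energy_def)
      then show ?thesis using energy_eq[OF t0 h] by linarith
    qed
    moreover have "(LINT x|\<mu>. (h x)\<^sup>2) / (1 - b * t)
        = (LINT x|\<mu>. (h x)\<^sup>2) + t * (b / (1 - b * t) * (LINT x|\<mu>. (h x)\<^sup>2))"
      using b(2) by (simp add: field_simps)
    ultimately show ?thesis unfolding distrib_left by linarith
  qed
  finally show ?thesis using t by simp
qed

text \<open>Strong continuity at the bounded function \<psi> keeps its inner products with \<kappa>
  above \<open>l - e\<close> on a whole interval to the right of 0, which supplies the uniform lower
  bound \<open>m\<close> of the comparison. The limit \<open>q\<close> is a parameter so that
  shifted functions \<open>u - c\<close> are covered.\<close>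

lemma lyapunov_energy:
  fixes U LU \<phi> h :: "'a \<Rightarrow> real"
  assumes b: "0 \<le> b"
    and gen: "extended_generator M F X U LU" and U_ge: "\<And>x. 1 \<le> U x"
    and \<phi>_meas [measurable]: "\<phi> \<in> borel_measurable borel" and \<phi>_nonneg: "\<And>x. 0 \<le> \<phi> x"
    and drift: "AE x in \<mu>. LU x \<le> (b - \<phi> x) * U x"
    and h: "h \<in> L2 \<mu>" and q: "((\<lambda>t. energy t h) \<longlongrightarrow> q) (at_right 0)"
  shows "(\<integral>\<^sup>+x. ennreal (\<phi> x * (h x)\<^sup>2) \<partial>\<mu>) \<le> ennreal (q + b * (LINT x|\<mu>. (h x)\<^sup>2))"
proof (rule nn_integral_le_eventually_eq)
  have h_meas [measurable]: "h \<in> borel_measurable borel"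
    using L2_D(1)[OF h] by (simp add: borel_measurable_mu)
  have U_meas [measurable]: "U \<in> borel_measurable borel"
    using gen by (auto simp: extended_generator_def intro: borel_measurable_continuous_onI)
  have U_pos: "0 < U x" for x using U_ge[of x] by simp
  fix n :: nat
  \<comment> \<open>The factors \<open>1 / U\<close> and \<open>U\<close> cancel in the product,
    which equals \<open>\<phi> * h^2\<close> as soon as \<open>n\<close> exceeds \<open>h^2\<close>
    and \<open>\<phi> * U\<close> at the point. That \<kappa> is at most \<open>n\<close> relies on
    \<open>U \<ge> 1\<close>.\<close>
  define \<kappa> where "\<kappa> x = min ((h x)\<^sup>2) (real n) / U x" for x
  define \<psi> where "\<psi> x = min (\<phi> x * U x) (real n)" for x
  have \<kappa>_bounds: "0 \<le> \<kappa> x" "\<kappa> x \<le> (h x)\<^sup>2 / U x" "\<kappa> x \<le> real n" for x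
  proof -
    show "0 \<le> \<kappa> x" "\<kappa> x \<le> (h x)\<^sup>2 / U x"
      using U_pos[of x] by (auto simp: \<kappa>_def intro!: divide_right_mono)
    have "\<kappa> x \<le> real n / U x" using U_pos[of x] by (auto simp: \<kappa>_def intro!: divide_right_mono)
    also have "\<dots> \<le> real n" using U_pos[of x] mult_left_mono[OF U_ge[of x], of "real n"] by (simp add: pos_divide_le_eq)
    finally show "\<kappa> x \<le> real n" .
  qed
  have \<psi>_bounds: "0 \<le> \<psi> x" "\<psi> x \<le> \<phi> x * U x" "\<psi> x \<le> real n" for x
    using \<phi>_nonneg[of x] U_pos[of x] by (simp_all add: \<psi>_def less_imp_le)
  have \<kappa>_meas [measurable]: "\<kappa> \<in> borel_measurable borel" and \<psi>_meas [measurable]: "\<psi> \<in> borel_measurable borel"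
    unfolding \<kappa>_def \<psi>_def by measurable
  have \<kappa>_L2: "\<kappa> \<in> L2 \<mu>" and \<psi>_L2: "\<psi> \<in> L2 \<mu>"
    using \<kappa>_bounds \<psi>_bounds by (auto intro!: mu.L2_bounded[where B="real n"] simp: borel_measurable_mu)
  show "(\<lambda>x. ennreal (\<psi> x * \<kappa> x)) \<in> borel_measurable \<mu>" by measurable
  define l where "l = (LINT x|\<mu>. \<psi> x * \<kappa> x)"
  have "((\<lambda>t. LINT x|\<mu>. semigroup_op P t \<psi> x * \<kappa> x) \<longlongrightarrow> l) (at_right 0)"
    unfolding l_def
  proof (rule L2_inner_tendsto[OF _ \<psi>_L2 \<kappa>_L2 strongly_continuous[OF \<psi>_L2]])
    show "\<forall>\<^sub>F t in at_right 0. semigroup_op P t \<psi> \<in> L2 \<mu>"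
      using eventually_at_right_less[of "0::real"] by eventually_elim (auto intro: semigroup_op_L2 \<psi>_L2)
  qed
  then have lim: "((\<lambda>t. LINT x|\<mu>. \<kappa> x * semigroup_op P t \<psi> x) \<longlongrightarrow> l) (at_right 0)"
    by (simp add: mult.commute)
  have l_le: "l \<le> q + b * (LINT x|\<mu>. (h x)\<^sup>2)"
  proof (rule field_le_epsilon)
    fix e :: real assume e: "0 < e"
    have "\<forall>\<^sub>F t in at_right 0. l - e < (LINT x|\<mu>. \<kappa> x * semigroup_op P t \<psi> x)"
      using lim e by (intro order_tendstoD) auto
    then obtain \<delta> where \<delta>: "0 < \<delta>" "\<And>t. 0 < t \<Longrightarrow> t < \<delta> \<Longrightarrow> l - e < (LINT x|\<mu>. \<kappa> x * semigroup_op P t \<psi> x)"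
      by (auto simp: eventually_at_right_field)
    have "((\<lambda>t. b * t) \<longlongrightarrow> b * 0) (at_right 0)"
      by (intro tendsto_intros)
    then have "\<forall>\<^sub>F t in at_right 0. b * t < 1" by (rule order_tendstoD) simp
    moreover have "\<forall>\<^sub>F t in at_right 0. 0 < t \<and> t < \<delta>"
      using \<delta>(1) by (auto simp: eventually_at_right_field)
    ultimately have ev: "\<forall>\<^sub>F t in at_right 0. l - e \<le> energy t h + b / (1 - b * t) * (LINT x|\<mu>. (h x)\<^sup>2)"
    proof eventually_elim
      case (elim t)
      \<comment> \<open>The comparison asks for a nonnegative \<open>m\<close>, since it enters an
        extended nonnegative integral, whereas \<open>l - e\<close> may be negative.\<close>
      have "max 0 (l - e) \<le> energy t h + b / (1 - b * t) * (LINT x|\<mu>. (h x)\<^sup>2)"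
      proof (rule lyapunov_comparison[OF _ b _ gen U_ge \<phi>_meas \<phi>_nonneg drift h
            \<kappa>_L2 \<kappa>_bounds(1,2) \<psi>_L2 \<psi>_bounds(1,2)])
        fix r assume r: "0 < r" "r \<le> t"
        have "0 \<le> semigroup_op P r \<psi> x" for x
          unfolding semigroup_op_def by (rule integral_nonneg_AE) (simp add: \<psi>_bounds)
        then have "0 \<le> (LINT x|\<mu>. \<kappa> x * semigroup_op P r \<psi> x)"
          by (intro integral_nonneg_AE) (simp add: \<kappa>_bounds)
        moreover have "l - e < (LINT x|\<mu>. \<kappa> x * semigroup_op P r \<psi> x)"
          using r elim by (intro \<delta>(2)) auto
        ultimately show "max 0 (l - e) \<le> (LINT x|\<mu>. \<kappa> x * semigroup_op P r \<psi> x)" by simp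
      qed (use elim in auto)
      then show ?case by simp
    qed
    have "((\<lambda>t. energy t h + b / (1 - b * t) * (LINT x|\<mu>. (h x)\<^sup>2))
        \<longlongrightarrow> q + b / (1 - b * 0) * (LINT x|\<mu>. (h x)\<^sup>2)) (at_right 0)"
      by (intro tendsto_intros q) simp
    from tendsto_lowerbound[OF this ev] show "l \<le> q + b * (LINT x|\<mu>. (h x)\<^sup>2) + e"
      by simp
  qed
  have "(\<integral>\<^sup>+x. ennreal (\<psi> x * \<kappa> x) \<partial>\<mu>) = ennreal l"
    unfolding l_def by (rule nn_integral_eq_integral[OF L2_mult_integrable[OF \<psi>_L2 \<kappa>_L2]])
      (simp add: \<kappa>_bounds \<psi>_bounds)
  also have "\<dots> \<le> ennreal (q + b * (LINT x|\<mu>. (h x)\<^sup>2))"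
    by (rule ennreal_leI[OF l_le])
  finally show "(\<integral>\<^sup>+x. ennreal (\<psi> x * \<kappa> x) \<partial>\<mu>) \<le> ennreal (q + b * (LINT x|\<mu>. (h x)\<^sup>2))" .
next
  show "AE x in \<mu>. \<forall>\<^sub>F n in sequentially.
    ennreal (min (\<phi> x * U x) (real n) * (min ((h x)\<^sup>2) (real n) / U x)) = ennreal (\<phi> x * (h x)\<^sup>2)"
  proof (rule AE_I2)
    fix x
    have U_nz: "U x \<noteq> 0" using U_ge[of x] by auto
    show "\<forall>\<^sub>F n in sequentially.
      ennreal (min (\<phi> x * U x) (real n) * (min ((h x)\<^sup>2) (real n) / U x)) = ennreal (\<phi> x * (h x)\<^sup>2)"
      using eventually_min_real_eq[of "\<phi> x * U x"] eventually_min_real_eq[of "(h x)\<^sup>2"]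
    proof eventually_elim
      case (elim n)
      then show ?case using U_nz by (simp only: elim) simp
    qed
  qed
qed

end

subsection \<open>The Dirichlet form\<close>

text \<open>With \<open>v\<close> the image of \<open>u\<close> under the generator this is the
  quadratic form at \<open>u\<close>. The image is a separate argument because
  \<open>L2_generator\<close> is a relation between representatives.\<close>

definition form_value :: "'a measure \<Rightarrow> ('a \<Rightarrow> real) \<Rightarrow> ('a \<Rightarrow> real) \<Rightarrow> real" where
  "form_value \<mu> u v = (LINT x|\<mu>. - v x * u x)"

lemma L2_norm_cmult: "L2_norm \<mu> (\<lambda>x. c * f x) = \<bar>c\<bar> * L2_norm \<mu> f"
  by (simp add: L2_norm_def power_mult_distrib real_sqrt_mult)

lemma L2_norm_cong_AE:
  assumes "f \<in> borel_measurable \<mu>" "g \<in> borel_measurable \<mu>" "AE x in \<mu>. f x = g x"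
  shows "L2_norm \<mu> f = L2_norm \<mu> g"
  unfolding L2_norm_def
  by (rule arg_cong[where f=sqrt], rule integral_cong_AE) (use assms in auto)

text \<open>The reverse triangle inequality of a seminorm reduced to three numbers: \<open>A\<close>
  and \<open>B\<close> are the squared seminorms of two vectors and \<open>c\<close> their inner
  product.\<close>

lemma abs_diff_le_sqrt_of_psd:
  fixes A B c :: real
  assumes A: "0 \<le> A" and B: "0 \<le> B" and c: "c\<^sup>2 \<le> A * B"
  shows "\<bar>sqrt A - sqrt B\<bar> \<le> sqrt (A - 2 * c + B)"
proof -
  have "\<bar>c\<bar> \<le> sqrt (A * B)"
    using real_sqrt_le_mono[OF c] by simp
  then have "c \<le> sqrt A * sqrt B" by (simp add: real_sqrt_mult)
  then have "(sqrt A - sqrt B)\<^sup>2 \<le> A - 2 * c + B"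
    using A B by (simp add: power2_diff)
  from real_sqrt_le_mono[OF this] show ?thesis by simp
qed

section \<open>Positivity, symmetry and closability of the form\<close>

context reversible_markov_process
begin

lemma generator_L2:
  assumes "L2_generator \<mu> P u v"
  shows "u \<in> L2 \<mu>" "v \<in> L2 \<mu>"
  using assms by (simp_all add: L2_generator_def)

lemma difference_quotient_L2:
  assumes "0 \<le> t" "u \<in> L2 \<mu>"
  shows "(\<lambda>x. (semigroup_op P t u x - u x) / t) \<in> L2 \<mu>"
  using L2_cmult[OF L2_diff[OF semigroup_op_L2[OF assms] assms(2)], of "1 / t"] by simp

lemma eventually_pos_at_right_0: "\<forall>\<^sub>F t in at_right 0. (0::real) < t"
  by (rule eventually_at_right_less)

text \<open>The semigroup is linear only up to null sets, so the difference quotients are compared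
  after taking the \<open>L2_norm\<close>, which does not see such sets.\<close>

lemma generator_lincomb:
  assumes g: "L2_generator \<mu> P u v" and g': "L2_generator \<mu> P u' v'"
  shows "L2_generator \<mu> P (\<lambda>x. a * u x + c * u' x) (\<lambda>x. a * v x + c * v' x)"
proof -
  let ?D = "\<lambda>u v t x. (semigroup_op P t u x - u x) / t - v x"
  let ?u = "\<lambda>x. a * u x + c * u' x" and ?v = "\<lambda>x. a * v x + c * v' x"
  note L2s = generator_L2[OF g] generator_L2[OF g']
  have D_L2: "?D f k t \<in> L2 \<mu>" if "0 \<le> t" "f \<in> L2 \<mu>" "k \<in> L2 \<mu>" for f k t
    using that by (intro L2_diff difference_quotient_L2)
  have uv: "?u \<in> L2 \<mu>" "?v \<in> L2 \<mu>" using L2s by (simp_all add: L2_lincomb)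
  have lim: "((\<lambda>t. \<bar>a\<bar> * L2_norm \<mu> (?D u v t) + \<bar>c\<bar> * L2_norm \<mu> (?D u' v' t)) \<longlongrightarrow> \<bar>a\<bar> * 0 + \<bar>c\<bar> * 0) (at_right 0)"
    using g g' by (intro tendsto_intros) (auto simp: L2_generator_def)
  have "((\<lambda>t. L2_norm \<mu> (?D ?u ?v t)) \<longlongrightarrow> 0) (at_right 0)"
  proof (rule Lim_null_comparison)
    show "((\<lambda>t. \<bar>a\<bar> * L2_norm \<mu> (?D u v t) + \<bar>c\<bar> * L2_norm \<mu> (?D u' v' t)) \<longlongrightarrow> 0) (at_right 0)"
      using lim by simp
    show "\<forall>\<^sub>F t in at_right 0. norm (L2_norm \<mu> (?D ?u ?v t)) \<le> \<bar>a\<bar> * L2_norm \<mu> (?D u v t) + \<bar>c\<bar> * L2_norm \<mu> (?D u' v' t)"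
      using eventually_pos_at_right_0
    proof eventually_elim
      case (elim t)
      then have t: "0 \<le> t" by simp
      have "AE x in \<mu>. ?D ?u ?v t x = a * ?D u v t x + c * ?D u' v' t x"
        using semigroup_op_lincomb[OF t mu.L2_integrable[OF L2s(1)] mu.L2_integrable[OF L2s(3)], of a c]
        by eventually_elim (use elim in \<open>simp add: field_simps\<close>)
      then have "L2_norm \<mu> (?D ?u ?v t) = L2_norm \<mu> (\<lambda>x. a * ?D u v t x + c * ?D u' v' t x)"
        using D_L2[OF t] L2s uv by (intro L2_norm_cong_AE L2_D(1) L2_lincomb) auto
      also have "\<dots> \<le> L2_norm \<mu> (\<lambda>x. a * ?D u v t x) + L2_norm \<mu> (\<lambda>x. c * ?D u' v' t x)"
        using D_L2[OF t] L2s by (intro L2_norm_triangle L2_cmult)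
      also have "\<dots> = \<bar>a\<bar> * L2_norm \<mu> (?D u v t) + \<bar>c\<bar> * L2_norm \<mu> (?D u' v' t)"
        by (simp only: L2_norm_cmult)
      finally show ?case by simp
    qed
  qed
  then show ?thesis using uv by (simp add: L2_generator_def)
qed

lemma generator_diff:
  assumes "L2_generator \<mu> P u v" "L2_generator \<mu> P u' v'"
  shows "L2_generator \<mu> P (\<lambda>x. u x - u' x) (\<lambda>x. v x - v' x)"
  using generator_lincomb[OF assms, of 1 "-1"] by simp

lemma generator_inner_tendsto:
  assumes g: "L2_generator \<mu> P u v" and h: "h \<in> L2 \<mu>"
  shows "((\<lambda>t. LINT x|\<mu>. (semigroup_op P t u x - u x) / t * h x) \<longlongrightarrow> (LINT x|\<mu>. v x * h x)) (at_right 0)"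
proof (rule L2_inner_tendsto[OF _ generator_L2(2)[OF g] h])
  show "\<forall>\<^sub>F t in at_right 0. (\<lambda>x. (semigroup_op P t u x - u x) / t) \<in> L2 \<mu>"
    using eventually_pos_at_right_0
    by eventually_elim (use difference_quotient_L2 generator_L2(1)[OF g] in auto)
  show "((\<lambda>t. L2_norm \<mu> (\<lambda>x. (semigroup_op P t u x - u x) / t - v x)) \<longlongrightarrow> 0) (at_right 0)"
    using g by (simp add: L2_generator_def)
qed

lemma difference_quotient_inner:
  assumes t: "0 \<le> t" and u: "u \<in> L2 \<mu>" and h: "h \<in> L2 \<mu>"
  shows "(LINT x|\<mu>. (semigroup_op P t u x - u x) / t * h x)
    = ((LINT x|\<mu>. semigroup_op P t u x * h x) - (LINT x|\<mu>. u x * h x)) / t"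
proof -
  have "(LINT x|\<mu>. (semigroup_op P t u x - u x) / t * h x)
    = (LINT x|\<mu>. (semigroup_op P t u x * h x - u x * h x) / t)"
    by (intro Bochner_Integration.integral_cong) (simp_all add: field_simps)
  also have "\<dots> = (LINT x|\<mu>. semigroup_op P t u x * h x - u x * h x) / t"
    by simp
  also have "(LINT x|\<mu>. semigroup_op P t u x * h x - u x * h x)
      = (LINT x|\<mu>. semigroup_op P t u x * h x) - (LINT x|\<mu>. u x * h x)"
    by (intro Bochner_Integration.integral_diff L2_mult_integrable semigroup_op_L2 t u h)
  finally show ?thesis .
qed

text \<open>Reversibility makes the difference quotients symmetric at positive times, and each side
  of that identity is an inner product with a fixed function, so it survives the limit.\<close>

lemma generator_symmetric:
  assumes g: "L2_generator \<mu> P u v" and g': "L2_generator \<mu> P u' v'"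
  shows "(LINT x|\<mu>. v x * u' x) = (LINT x|\<mu>. u x * v' x)"
proof -
  note u = generator_L2(1)[OF g] and u' = generator_L2(1)[OF g']
  have "\<forall>\<^sub>F t in at_right 0. (LINT x|\<mu>. (semigroup_op P t u' x - u' x) / t * u x)
      = (LINT x|\<mu>. (semigroup_op P t u x - u x) / t * u' x)"
    using eventually_pos_at_right_0
  proof eventually_elim
    case (elim t)
    then have t: "0 \<le> t" by simp
    show ?case
      unfolding difference_quotient_inner[OF t u u'] difference_quotient_inner[OF t u' u]
      using reversible[OF t u u'] by (simp add: mult.commute)
  qed
  from tendsto_cong[OF this] generator_inner_tendsto[OF g' u]
  have "((\<lambda>t. LINT x|\<mu>. (semigroup_op P t u x - u x) / t * u' x) \<longlongrightarrow> (LINT x|\<mu>. v' x * u x)) (at_right 0)"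
    by simp
  from tendsto_unique[OF _ generator_inner_tendsto[OF g u'] this] show ?thesis
    by (simp add: mult.commute)
qed

text \<open>By stationarity the energy equals minus the inner product of the difference quotient
  with \<open>u\<close>, exactly, for each \<open>t > 0\<close>. Besides the limit this provides
  positivity of the form, which is not visible from the product of \<open>- v\<close> and
  \<open>u\<close>.\<close>

lemma energy_tendsto_form_value:
  assumes g: "L2_generator \<mu> P u v"
  shows "((\<lambda>t. energy t u) \<longlongrightarrow> form_value \<mu> u v) (at_right 0)"
proof -
  note u = generator_L2(1)[OF g]
  have "((\<lambda>t. - (LINT x|\<mu>. (semigroup_op P t u x - u x) / t * u x)) \<longlongrightarrow> - (LINT x|\<mu>. v x * u x)) (at_right 0)"
    by (intro tendsto_minus generator_inner_tendsto g u)
  moreover have "\<forall>\<^sub>F t in at_right 0. - (LINT x|\<mu>. (semigroup_op P t u x - u x) / t * u x) = energy t u"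
    using eventually_pos_at_right_0
  proof eventually_elim
    case (elim t)
    then have t: "0 \<le> t" by simp
    have "(LINT x|\<mu>. semigroup_op P t u x * u x) = (LINT \<omega>|M. u (X 0 \<omega>) * u (X t \<omega>))"
      using two_point_integral[OF t u u] by (simp add: mult.commute)
    then show ?case
      unfolding difference_quotient_inner[OF t u u] energy_def energy_eq[OF t u]
      using elim by (simp add: field_simps power2_eq_square)
  qed
  ultimately have "((\<lambda>t. energy t u) \<longlongrightarrow> - (LINT x|\<mu>. v x * u x)) (at_right 0)"
    using tendsto_cong by force
  then show ?thesis by (simp add: form_value_def)
qed

lemma form_value_nonneg:
  assumes g: "L2_generator \<mu> P u v"
  shows "0 \<le> form_value \<mu> u v"
  by (rule tendsto_lowerbound[OF energy_tendsto_form_value[OF g]],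
      rule eventually_mono[OF eventually_pos_at_right_0]) (simp_all add: energy_nonneg)

lemma form_value_lincomb:
  assumes g: "L2_generator \<mu> P u v" and g': "L2_generator \<mu> P u' v'"
  shows "form_value \<mu> (\<lambda>x. a * u x + c * u' x) (\<lambda>x. a * v x + c * v' x)
    = a\<^sup>2 * form_value \<mu> u v + 2 * a * c * (LINT x|\<mu>. - v x * u' x) + c\<^sup>2 * form_value \<mu> u' v'"
proof -
  note L2s = generator_L2[OF g] generator_L2[OF g']
  note ints = L2_mult_integrable[OF L2s(2) L2s(1)] L2_mult_integrable[OF L2s(2) L2s(3)]
    L2_mult_integrable[OF L2s(1) L2s(4)] L2_mult_integrable[OF L2s(4) L2s(3)]
  have "form_value \<mu> (\<lambda>x. a * u x + c * u' x) (\<lambda>x. a * v x + c * v' x)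
    = (LINT x|\<mu>. - (a\<^sup>2 * (v x * u x) + a * c * (v x * u' x) + a * c * (u x * v' x) + c\<^sup>2 * (v' x * u' x)))"
    unfolding form_value_def
    by (intro Bochner_Integration.integral_cong) (simp_all add: power2_eq_square algebra_simps)
  also have "\<dots> = - (a\<^sup>2 * (LINT x|\<mu>. v x * u x) + a * c * (LINT x|\<mu>. v x * u' x)
      + a * c * (LINT x|\<mu>. u x * v' x) + c\<^sup>2 * (LINT x|\<mu>. v' x * u' x))"
    using ints by simp
  finally show ?thesis
    unfolding generator_symmetric[OF g g', symmetric] by (simp add: form_value_def)
qed

text \<open>The form is symmetric and positive semidefinite, hence its square root is a seminorm.
  Convergence of the values along an approximating sequence and their independence of the sequence
  both rest on this bound.\<close>

lemma form_value_sqrt_diff: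
  assumes g: "L2_generator \<mu> P u v" and g': "L2_generator \<mu> P u' v'"
  shows "\<bar>sqrt (form_value \<mu> u v) - sqrt (form_value \<mu> u' v')\<bar>
    \<le> sqrt (form_value \<mu> (\<lambda>x. u x - u' x) (\<lambda>x. v x - v' x))"
proof -
  let ?c = "LINT x|\<mu>. - v x * u' x"
  have "?c\<^sup>2 \<le> form_value \<mu> u v * form_value \<mu> u' v'"
    by (rule psd_cross_term_bound)
      (unfold form_value_lincomb[OF g g', symmetric], rule form_value_nonneg[OF generator_lincomb[OF g g']])
  from abs_diff_le_sqrt_of_psd[OF form_value_nonneg[OF g] form_value_nonneg[OF g'] this]
  show ?thesis
    using form_value_lincomb[OF g g', of 1 "-1"] by simp
qed

lemma form_approx_form_value:
  assumes "form_approx \<mu> P f u v"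
  shows "\<And>n. L2_generator \<mu> P (u n) (v n)" "(\<lambda>n. L2_norm \<mu> (\<lambda>x. u n x - f x)) \<longlonglongrightarrow> 0"
    "\<And>e. 0 < e \<Longrightarrow> \<exists>N. \<forall>m\<ge>N. \<forall>n\<ge>N. form_value \<mu> (\<lambda>x. u m x - u n x) (\<lambda>x. v m x - v n x) < e"
  using assms by (auto simp: form_approx_def form_value_def)

text \<open>Differences are controlled at the level of the seminorm, so the square roots of the
  values are Cauchy; squaring gives back the values.\<close>

lemma form_approx_convergent:
  assumes fa: "form_approx \<mu> P f u v"
  shows "convergent (\<lambda>n. form_value \<mu> (u n) (v n))"
proof -
  note gen = form_approx_form_value(1)[OF fa]
  have "Cauchy (\<lambda>n. sqrt (form_value \<mu> (u n) (v n)))"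
    unfolding Cauchy_def
  proof (intro allI impI)
    fix e :: real assume e: "0 < e"
    then obtain N where N: "\<And>m n. m \<ge> N \<Longrightarrow> n \<ge> N \<Longrightarrow> form_value \<mu> (\<lambda>x. u m x - u n x) (\<lambda>x. v m x - v n x) < e\<^sup>2"
      using form_approx_form_value(3)[OF fa, of "e\<^sup>2"] by auto
    have "dist (sqrt (form_value \<mu> (u m) (v m))) (sqrt (form_value \<mu> (u n) (v n))) < e" if "m \<ge> N" "n \<ge> N" for m n
    proof -
      have "dist (sqrt (form_value \<mu> (u m) (v m))) (sqrt (form_value \<mu> (u n) (v n)))
        \<le> sqrt (form_value \<mu> (\<lambda>x. u m x - u n x) (\<lambda>x. v m x - v n x))"
        unfolding dist_real_def by (rule form_value_sqrt_diff[OF gen gen])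
      also have "\<dots> < sqrt (e\<^sup>2)" by (rule real_sqrt_less_mono[OF N[OF that]])
      finally show ?thesis using e by simp
    qed
    then show "\<exists>M. \<forall>m\<ge>M. \<forall>n\<ge>M. dist (sqrt (form_value \<mu> (u m) (v m))) (sqrt (form_value \<mu> (u n) (v n))) < e"
      by blast
  qed
  then obtain l where "(\<lambda>n. sqrt (form_value \<mu> (u n) (v n))) \<longlonglongrightarrow> l"
    using Cauchy_convergent convergent_def by blast
  then have "(\<lambda>n. (sqrt (form_value \<mu> (u n) (v n)))\<^sup>2) \<longlonglongrightarrow> l\<^sup>2" by (rule tendsto_power)
  then show ?thesis
    using form_value_nonneg[OF gen] by (auto simp: convergent_def)
qed

text \<open>Closability: for \<open>w\<^sub>n = u\<^sub>n - u'\<^sub>n \<rightarrow> 0\<close> the cross term \<open>\<langle>-\<L>w\<^sub>n, w\<^sub>m\<rangle>\<close> vanishes as \<open>m \<rightarrow> \<infinity>\<close>, so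
  \<open>\<E>(w\<^sub>n) \<le> limsup\<^sub>m \<E>(w\<^sub>n - w\<^sub>m)\<close>.\<close>

lemma form_approx_closable:
  assumes f: "f \<in> L2 \<mu>" and fa: "form_approx \<mu> P f u v" and fa': "form_approx \<mu> P f u' v'"
  shows "(\<lambda>n. form_value \<mu> (\<lambda>x. u n x - u' n x) (\<lambda>x. v n x - v' n x)) \<longlonglongrightarrow> 0"
proof -
  note gen = form_approx_form_value(1)[OF fa] and gen' = form_approx_form_value(1)[OF fa']
  define w where "w n x = u n x - u' n x" for n x
  define z where "z n x = v n x - v' n x" for n x
  have wz: "L2_generator \<mu> P (w n) (z n)" for n
    unfolding w_def z_def by (rule generator_diff[OF gen gen'])
  note w_L2 = generator_L2(1)[OF wz] and z_L2 = generator_L2(2)[OF wz]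
  have w_lim: "(\<lambda>n. L2_norm \<mu> (w n)) \<longlonglongrightarrow> 0"
  proof (rule Lim_null_comparison)
    show "(\<lambda>n. L2_norm \<mu> (\<lambda>x. u n x - f x) + L2_norm \<mu> (\<lambda>x. f x - u' n x)) \<longlonglongrightarrow> 0"
      using tendsto_add[OF form_approx_form_value(2)[OF fa] form_approx_form_value(2)[OF fa']]
      by (simp add: L2_norm_minus_commute[of \<mu> f])
    have "L2_norm \<mu> (w n) \<le> L2_norm \<mu> (\<lambda>x. u n x - f x) + L2_norm \<mu> (\<lambda>x. f x - u' n x)" for n
      using L2_norm_triangle[OF L2_diff[OF generator_L2(1)[OF gen[of n]] f] L2_diff[OF f generator_L2(1)[OF gen'[of n]]]]
      by (simp add: w_def[abs_def])
    then show "\<forall>\<^sub>F n in sequentially. norm (L2_norm \<mu> (w n)) \<le> L2_norm \<mu> (\<lambda>x. u n x - f x) + L2_norm \<mu> (\<lambda>x. f x - u' n x)"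
      by simp
  qed
  have cross_lim: "(\<lambda>m. LINT x|\<mu>. - z n x * w m x) \<longlonglongrightarrow> 0" for n
  proof (rule Lim_null_comparison)
    show "(\<lambda>m. L2_norm \<mu> (z n) * L2_norm \<mu> (w m)) \<longlonglongrightarrow> 0"
      by (rule tendsto_mult_right_zero[OF w_lim])
    show "\<forall>\<^sub>F m in sequentially. norm (LINT x|\<mu>. - z n x * w m x) \<le> L2_norm \<mu> (z n) * L2_norm \<mu> (w m)"
      using L2_Cauchy_Schwarz[OF z_L2 w_L2] by simp
  qed
  have diff_small: "\<exists>N. \<forall>m\<ge>N. \<forall>n\<ge>N. form_value \<mu> (\<lambda>x. w n x - w m x) (\<lambda>x. z n x - z m x) \<le> e" if "0 < e" for e
  proof -
    have e: "0 < e / 4" using that by simp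
    from form_approx_form_value(3)[OF fa e] form_approx_form_value(3)[OF fa' e]
    obtain N N' where N: "\<And>m n. m \<ge> N \<Longrightarrow> n \<ge> N \<Longrightarrow> form_value \<mu> (\<lambda>x. u m x - u n x) (\<lambda>x. v m x - v n x) < e / 4"
      and N': "\<And>m n. m \<ge> N' \<Longrightarrow> n \<ge> N' \<Longrightarrow> form_value \<mu> (\<lambda>x. u' m x - u' n x) (\<lambda>x. v' m x - v' n x) < e / 4"
      by blast
    have "form_value \<mu> (\<lambda>x. w n x - w m x) (\<lambda>x. z n x - z m x) \<le> e" if "m \<ge> max N N'" "n \<ge> max N N'" for m n
    proof -
      note G = generator_diff[OF gen[of n] gen[of m]] and G' = generator_diff[OF gen'[of n] gen'[of m]]
      let ?A = "form_value \<mu> (\<lambda>x. u n x - u m x) (\<lambda>x. v n x - v m x)"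
        and ?B = "form_value \<mu> (\<lambda>x. u' n x - u' m x) (\<lambda>x. v' n x - v' m x)"
      have "form_value \<mu> (\<lambda>x. w n x - w m x) (\<lambda>x. z n x - z m x)
        = form_value \<mu> (\<lambda>x. 1 * (u n x - u m x) + - 1 * (u' n x - u' m x))
            (\<lambda>x. 1 * (v n x - v m x) + - 1 * (v' n x - v' m x))"
        by (simp add: w_def z_def algebra_simps)
      \<comment> \<open>Positivity of the form at the sum of the two differences bounds the mixed
        term, as in the parallelogram identity. With \<open>e / 4\<close> for each sequence the
        total is at most \<open>e\<close>.\<close>
      also have "\<dots> \<le> 2 * ?A + 2 * ?B"
        using form_value_nonneg[OF generator_lincomb[OF G G', of 1 1]]
        unfolding form_value_lincomb[OF G G'] by simp
      also have "\<dots> \<le> e" using N[of n m] N'[of n m] that by simp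
      finally show ?thesis .
    qed
    then show ?thesis by blast
  qed
  have "(\<lambda>n. form_value \<mu> (w n) (z n)) \<longlonglongrightarrow> 0"
  proof (rule LIMSEQ_I)
    fix e :: real assume e: "0 < e"
    then obtain N where N: "\<And>m n. m \<ge> N \<Longrightarrow> n \<ge> N \<Longrightarrow> form_value \<mu> (\<lambda>x. w n x - w m x) (\<lambda>x. z n x - z m x) \<le> e / 2"
      using diff_small[of "e / 2"] by auto
    have "form_value \<mu> (w n) (z n) \<le> e / 2" if n: "n \<ge> N" for n
    proof -
      \<comment> \<open>Expanding the form at \<open>w n - w m\<close> and dropping its nonnegative
        value at \<open>w m\<close> isolates the cross term, which vanishes as \<open>m\<close>
        grows with \<open>n\<close> fixed.\<close>
      have le: "form_value \<mu> (w n) (z n) \<le> e / 2 + 2 * (LINT x|\<mu>. - z n x * w m x)" if "m \<ge> N" for m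
      proof -
        have "form_value \<mu> (\<lambda>x. 1 * w n x + - 1 * w m x) (\<lambda>x. 1 * z n x + - 1 * z m x) \<le> e / 2"
          using N[OF that n] by simp
        then show ?thesis
          unfolding form_value_lincomb[OF wz wz] using form_value_nonneg[OF wz[of m]] by simp
      qed
      have "(\<lambda>m. e / 2 + 2 * (LINT x|\<mu>. - z n x * w m x)) \<longlonglongrightarrow> e / 2 + 2 * 0"
        by (intro tendsto_intros cross_lim)
      then show ?thesis
        using le by (intro tendsto_lowerbound[where F=sequentially and a="form_value \<mu> (w n) (z n)"])
          (auto simp: eventually_sequentially)
    qed
    then have "\<forall>n\<ge>N. norm (form_value \<mu> (w n) (z n) - 0) < e"
      using e form_value_nonneg[OF wz] by (force intro: le_less_trans)
    then show "\<exists>no. \<forall>n\<ge>no. norm (form_value \<mu> (w n) (z n) - 0) < e" by blast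
  qed
  then show ?thesis by (simp add: w_def[abs_def] z_def[abs_def])
qed

text \<open>\<open>dirichlet_form\<close> is a definite description and can be evaluated only after
  existence and uniqueness of the limit: existence is convergence along one sequence, uniqueness is
  closability applied to two.\<close>

lemma form_value_tendsto_dirichlet_form:
  assumes f: "f \<in> L2 \<mu>" and fa: "form_approx \<mu> P f u v"
  shows "(\<lambda>n. form_value \<mu> (u n) (v n)) \<longlonglongrightarrow> dirichlet_form \<mu> P f"
proof -
  obtain e where e: "(\<lambda>n. form_value \<mu> (u n) (v n)) \<longlonglongrightarrow> e"
    using form_approx_convergent[OF fa] by (auto simp: convergent_def)
  have uniq: "e' = e"
    if fa': "form_approx \<mu> P f u' v'" and e': "(\<lambda>n. form_value \<mu> (u' n) (v' n)) \<longlonglongrightarrow> e'" for u' v' e'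
  proof -
    note gen = form_approx_form_value(1)[OF fa] and gen' = form_approx_form_value(1)[OF fa']
    have "(\<lambda>n. sqrt (form_value \<mu> (u n) (v n)) - sqrt (form_value \<mu> (u' n) (v' n))) \<longlonglongrightarrow> 0"
    proof (rule Lim_null_comparison)
      show "(\<lambda>n. sqrt (form_value \<mu> (\<lambda>x. u n x - u' n x) (\<lambda>x. v n x - v' n x))) \<longlonglongrightarrow> 0"
        using tendsto_real_sqrt[OF form_approx_closable[OF f fa fa']] by simp
      show "\<forall>\<^sub>F n in sequentially. norm (sqrt (form_value \<mu> (u n) (v n)) - sqrt (form_value \<mu> (u' n) (v' n)))
        \<le> sqrt (form_value \<mu> (\<lambda>x. u n x - u' n x) (\<lambda>x. v n x - v' n x))"
        using form_value_sqrt_diff[OF gen gen'] by simp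
    qed
    from LIMSEQ_unique[OF this tendsto_diff[OF tendsto_real_sqrt[OF e] tendsto_real_sqrt[OF e']]]
    show "e' = e" by simp
  qed
  have "dirichlet_form \<mu> P f = e"
    unfolding dirichlet_form_def form_value_def[symmetric]
    by (rule the_equality) (use fa e uniq in blast)+
  with e show ?thesis by simp
qed

text \<open>The constant sequence approximates \<open>u\<close>. This ties the Poincare inequality,
  phrased through \<open>dirichlet_form\<close>, to the explicit \<open>form_value\<close>.\<close>

lemma dirichlet_form_generator:
  assumes g: "L2_generator \<mu> P u v"
  shows "dirichlet_form \<mu> P u = form_value \<mu> u v"
proof -
  have "form_approx \<mu> P u (\<lambda>_. u) (\<lambda>_. v)"
    using g by (simp add: form_approx_def L2_norm_def)
  from form_value_tendsto_dirichlet_form[OF generator_L2(1)[OF g] this]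
  show ?thesis by (simp add: LIMSEQ_const_iff)
qed

end

subsection \<open>The transportation-information inequalities\<close>

text \<open>Integrability of \<open>u\<close> for both measures merges the two integrals into one
  against \<open>f - 1\<close>, where \<open>\<bar>u\<bar> \<le> \<psi>\<close> applies
  pointwise.\<close>

lemma weighted_tv_le_density:
  fixes \<mu> \<nu> :: "'a measure"
  assumes \<mu>: "prob_space \<mu>" and \<nu>: "prob_space \<nu>" "sets \<nu> = sets \<mu>" "absolutely_continuous \<mu> \<nu>"
    and \<psi>: "\<psi> \<in> borel_measurable \<mu>"
  defines "f \<equiv> \<lambda>x. enn2real (RN_deriv \<mu> \<nu> x)"
  shows "weighted_tv \<psi> \<nu> \<mu> \<le> (\<integral>\<^sup>+x. ennreal (\<psi> x * \<bar>f x - 1\<bar>) \<partial>\<mu>)"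
    and "integrable \<mu> f" and "(LINT x|\<mu>. f x) = 1"
proof -
  interpret mu: prob_space \<mu> by fact
  interpret nu: prob_space \<nu> by fact
  have f_meas [measurable]: "f \<in> borel_measurable \<mu>" unfolding f_def by measurable
  have f_nonneg: "0 \<le> f x" for x by (simp add: f_def)
  \<comment> \<open>\<open>enn2real\<close> sends \<infinity> to 0, so \<open>f\<close> might lose
    mass; finiteness of \<nu> makes the derivative finite almost everywhere.\<close>
  obtain D where D: "AE x in \<mu>. RN_deriv \<mu> \<nu> x = ennreal (D x)" "\<And>x. 0 \<le> D x"
    by (rule mu.real_RN_deriv[OF nu.finite_measure \<nu>(3,2)]) blast
  have "AE x in \<mu>. RN_deriv \<mu> \<nu> x = ennreal (f x)"
    using D(1) by eventually_elim (simp add: f_def D(2))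
  then have "density \<mu> (RN_deriv \<mu> \<nu>) = density \<mu> (\<lambda>x. ennreal (f x))"
    by (intro density_cong) auto
  then have dens: "\<nu> = density \<mu> (\<lambda>x. ennreal (f x))"
    using mu.density_RN_deriv[OF \<nu>(3,2)] by simp
  have int_eq: "integrable \<nu> u \<longleftrightarrow> integrable \<mu> (\<lambda>x. f x * u x)"
    "(LINT x|\<nu>. u x) = (LINT x|\<mu>. f x * u x)" if "u \<in> borel_measurable \<mu>" for u :: "'a \<Rightarrow> real"
    using that integrable_density[of u \<mu> f] integral_density[of u \<mu> f] f_nonneg
    by (simp_all add: dens[symmetric])
  show "integrable \<mu> f" using int_eq(1)[of "\<lambda>_. 1"] by simp
  show "(LINT x|\<mu>. f x) = 1" using int_eq(2)[of "\<lambda>_. 1"] by (simp add: nu.prob_space)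
  show "weighted_tv \<psi> \<nu> \<mu> \<le> (\<integral>\<^sup>+x. ennreal (\<psi> x * \<bar>f x - 1\<bar>) \<partial>\<mu>)"
    unfolding weighted_tv_def
  proof (rule SUP_least)
    fix u assume "u \<in> {u \<in> borel_measurable \<mu>. (\<forall>x. \<bar>u x\<bar> \<le> \<psi> x) \<and> integrable \<mu> u \<and> integrable \<nu> u}"
    then have u [measurable]: "u \<in> borel_measurable \<mu>" and u_le: "\<And>x. \<bar>u x\<bar> \<le> \<psi> x"
      and u_int: "integrable \<mu> u" "integrable \<mu> (\<lambda>x. f x * u x)"
      using int_eq(1) by auto
    have diff_int: "integrable \<mu> (\<lambda>x. f x * u x - u x)" using u_int by simp
    have "ennreal ((LINT x|\<nu>. u x) - (LINT x|\<mu>. u x)) = ennreal (LINT x|\<mu>. f x * u x - u x)"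
      using u_int by (simp add: int_eq(2)[OF u])
    also have "\<dots> \<le> ennreal (LINT x|\<mu>. \<bar>f x * u x - u x\<bar>)"
      using diff_int by (intro ennreal_leI integral_mono) auto
    also have "\<dots> = (\<integral>\<^sup>+x. ennreal \<bar>f x * u x - u x\<bar> \<partial>\<mu>)"
      using diff_int by (intro nn_integral_eq_integral[symmetric]) auto
    also have "\<dots> \<le> (\<integral>\<^sup>+x. ennreal (\<psi> x * \<bar>f x - 1\<bar>) \<partial>\<mu>)"
    proof (intro nn_integral_mono ennreal_leI)
      fix x
      have "\<bar>f x * u x - u x\<bar> = \<bar>u x\<bar> * \<bar>f x - 1\<bar>"
        by (simp add: abs_mult[symmetric] algebra_simps)
      also have "\<dots> \<le> \<psi> x * \<bar>f x - 1\<bar>"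
        by (rule mult_right_mono[OF u_le]) simp
      finally show "\<bar>f x * u x - u x\<bar> \<le> \<psi> x * \<bar>f x - 1\<bar>" .
    qed
    finally show "ennreal ((LINT x|\<nu>. u x) - (LINT x|\<mu>. u x)) \<le> (\<integral>\<^sup>+x. ennreal (\<psi> x * \<bar>f x - 1\<bar>) \<partial>\<mu>)" .
  qed
qed

section \<open>Passage of the Poincare and Lyapunov inequalities to the form domain\<close>

context reversible_markov_process
begin

lemma variance_eq:
  assumes "u \<in> L2 \<mu>"
  shows "(LINT x|\<mu>. (u x - (LINT y|\<mu>. u y))\<^sup>2) = (LINT x|\<mu>. (u x)\<^sup>2) - (LINT x|\<mu>. u x)\<^sup>2"
  by (rule mu.variance_eq[OF mu.L2_integrable[OF assms] L2_D(2)[OF assms]])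

text \<open>The best constant is an infimum, so the definition provides an admissible constant only
  below each \<open>cP + \<epsilon>\<close>; the inequality with \<open>cP\<close> itself follows as
  \<epsilon> tends to 0.\<close>

lemma poincare_generator:
  assumes pc: "poincare_constant \<mu> P = ennreal cP" and cP: "0 \<le> cP"
    and g: "L2_generator \<mu> P u v"
  shows "(LINT x|\<mu>. (u x)\<^sup>2) - (LINT x|\<mu>. u x)\<^sup>2 \<le> cP * form_value \<mu> u v"
proof -
  let ?V = "(LINT x|\<mu>. (u x)\<^sup>2) - (LINT x|\<mu>. u x)\<^sup>2" and ?E = "form_value \<mu> u v"
  have E: "0 \<le> ?E" by (rule form_value_nonneg[OF g])
  have bound: "?V \<le> (cP + \<epsilon>) * ?E" if \<epsilon>: "0 < \<epsilon>" for \<epsilon>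
  proof -
    have "poincare_constant \<mu> P < ennreal (cP + \<epsilon>)"
      using \<epsilon> cP by (simp add: pc ennreal_less_iff)
    then obtain c where c: "\<And>g h. L2_generator \<mu> P g h \<Longrightarrow>
        ennreal (LINT x|\<mu>. (g x - (LINT y|\<mu>. g y))\<^sup>2) \<le> c * ennreal (dirichlet_form \<mu> P g)"
      and c_less: "c < ennreal (cP + \<epsilon>)"
      unfolding poincare_constant_def Inf_less_iff by blast
    have "ennreal ?V \<le> c * ennreal ?E"
      using c[OF g] by (simp add: variance_eq[OF generator_L2(1)[OF g]] dirichlet_form_generator[OF g])
    also have "\<dots> \<le> ennreal (cP + \<epsilon>) * ennreal ?E"
      using c_less by (intro mult_right_mono) auto
    also have "\<dots> = ennreal ((cP + \<epsilon>) * ?E)"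
      using E cP \<epsilon> by (simp add: ennreal_mult)
    finally show ?thesis
      using E cP \<epsilon> by (simp add: ennreal_le_iff)
  qed
  have "((\<lambda>\<epsilon>. (cP + \<epsilon>) * ?E) \<longlongrightarrow> (cP + 0) * ?E) (at_right 0)"
    by (intro tendsto_intros)
  moreover have "\<forall>\<^sub>F \<epsilon> in at_right 0. ?V \<le> (cP + \<epsilon>) * ?E"
    using eventually_pos_at_right_0 by eventually_elim (rule bound)
  ultimately have "?V \<le> (cP + 0) * ?E"
    by (intro tendsto_lowerbound) auto
  then show ?thesis by simp
qed

lemma form_approx_moments_tendsto:
  assumes f: "f \<in> L2 \<mu>" and fa: "form_approx \<mu> P f u v"
  shows "(\<lambda>n. LINT x|\<mu>. (u n x - c)\<^sup>2) \<longlonglongrightarrow> (LINT x|\<mu>. (f x - c)\<^sup>2)"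
    and "(\<lambda>n. LINT x|\<mu>. u n x) \<longlonglongrightarrow> (LINT x|\<mu>. f x)"
proof -
  note u = generator_L2(1)[OF form_approx_form_value(1)[OF fa]]
  note lim = form_approx_form_value(2)[OF fa]
  have "(\<lambda>n. L2_norm \<mu> (\<lambda>x. u n x - c)) \<longlonglongrightarrow> L2_norm \<mu> (\<lambda>x. f x - c)"
    using lim by (intro L2_norm_tendsto always_eventually allI L2_diff u f mu.L2_const) simp
  then have "(\<lambda>n. (L2_norm \<mu> (\<lambda>x. u n x - c))\<^sup>2) \<longlonglongrightarrow> (L2_norm \<mu> (\<lambda>x. f x - c))\<^sup>2"
    by (rule tendsto_power)
  then show "(\<lambda>n. LINT x|\<mu>. (u n x - c)\<^sup>2) \<longlonglongrightarrow> (LINT x|\<mu>. (f x - c)\<^sup>2)"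
    by (simp add: L2_norm_sq)
  show "(\<lambda>n. LINT x|\<mu>. u n x) \<longlonglongrightarrow> (LINT x|\<mu>. f x)"
    using L2_inner_tendsto[OF always_eventually f mu.L2_const[of 1] lim] u by simp
qed

lemma dirichlet_form_nonneg:
  assumes "f \<in> dirichlet_domain \<mu> P"
  shows "0 \<le> dirichlet_form \<mu> P f"
proof -
  obtain u v where f: "f \<in> L2 \<mu>" and fa: "form_approx \<mu> P f u v"
    using assms by (auto simp: dirichlet_domain_def)
  show ?thesis
    by (rule LIMSEQ_le_const[OF form_value_tendsto_dirichlet_form[OF f fa]])
      (use form_value_nonneg[OF form_approx_form_value(1)[OF fa]] in auto)
qed

lemma poincare_dirichlet:
  assumes pc: "poincare_constant \<mu> P = ennreal cP" and cP: "0 \<le> cP"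
    and "f \<in> dirichlet_domain \<mu> P"
  shows "(LINT x|\<mu>. (f x)\<^sup>2) - (LINT x|\<mu>. f x)\<^sup>2 \<le> cP * dirichlet_form \<mu> P f"
proof -
  obtain u v where f: "f \<in> L2 \<mu>" and fa: "form_approx \<mu> P f u v"
    using assms(3) by (auto simp: dirichlet_domain_def)
  have "(\<lambda>n. (LINT x|\<mu>. (u n x - 0)\<^sup>2) - (LINT x|\<mu>. u n x)\<^sup>2) \<longlonglongrightarrow> (LINT x|\<mu>. (f x - 0)\<^sup>2) - (LINT x|\<mu>. f x)\<^sup>2"
    by (intro tendsto_intros form_approx_moments_tendsto[OF f fa])
  moreover have "(\<lambda>n. cP * form_value \<mu> (u n) (v n)) \<longlonglongrightarrow> cP * dirichlet_form \<mu> P f"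
    by (intro tendsto_intros form_value_tendsto_dirichlet_form[OF f fa])
  ultimately show ?thesis
    using poincare_generator[OF pc cP form_approx_form_value(1)[OF fa]]
    by (intro LIMSEQ_le) auto
qed

text \<open>Convergence of \<open>u n\<close> in \<open>L2 \<mu>\<close> does not control the
  integral of \<open>\<phi> * (u n - c)^2\<close> for unbounded \<phi>. Truncation at
  \<open>K\<close> makes the weight a bounded multiplier, so the limit in \<open>n\<close> can be
  taken on both sides; \<open>K\<close> tends to infinity afterwards.\<close>

lemma lyapunov_dirichlet:
  fixes U LU \<phi> f :: "'a \<Rightarrow> real"
  assumes b: "0 \<le> b"
    and gen: "extended_generator M F X U LU" and U_ge: "\<And>x. 1 \<le> U x"
    and \<phi>_meas [measurable]: "\<phi> \<in> borel_measurable borel" and \<phi>_nonneg: "\<And>x. 0 \<le> \<phi> x"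
    and drift: "AE x in \<mu>. LU x \<le> (b - \<phi> x) * U x"
    and dom: "f \<in> dirichlet_domain \<mu> P"
  shows "(\<integral>\<^sup>+x. ennreal (\<phi> x * (f x - c)\<^sup>2) \<partial>\<mu>)
    \<le> ennreal (dirichlet_form \<mu> P f + b * (LINT x|\<mu>. (f x - c)\<^sup>2))"
proof (rule nn_integral_le_eventually_eq)
  obtain u v where f: "f \<in> L2 \<mu>" and fa: "form_approx \<mu> P f u v"
    using dom by (auto simp: dirichlet_domain_def)
  note uv = form_approx_form_value(1)[OF fa] and lim = form_approx_form_value(2)[OF fa]
  note u = generator_L2(1)[OF uv]
  let ?C = "dirichlet_form \<mu> P f + b * (LINT x|\<mu>. (f x - c)\<^sup>2)"
  have [measurable]: "f \<in> borel_measurable borel"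
    using L2_D(1)[OF f] by (simp add: borel_measurable_mu)
  fix K :: nat
  show "(\<lambda>x. ennreal (min (\<phi> x) (real K) * (f x - c)\<^sup>2)) \<in> borel_measurable \<mu>" by measurable
  \<comment> \<open>The square root turns the weighted integral into a squared
    \<open>L2_norm\<close>, to which continuity of the norm applies.\<close>
  define s where "s x = sqrt (min (\<phi> x) (real K))" for x
  have s_sq: "(s x)\<^sup>2 = min (\<phi> x) (real K)" for x by (simp add: s_def \<phi>_nonneg)
  have s_bounds: "0 \<le> s x" "s x \<le> sqrt (real K)" for x by (simp_all add: s_def \<phi>_nonneg)
  have s_meas [measurable]: "s \<in> borel_measurable borel" unfolding s_def by measurable
  have s_L2: "(\<lambda>x. s x * h x) \<in> L2 \<mu>" if h: "h \<in> L2 \<mu>" for h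
  proof (rule L2_mono[OF L2_cmult[OF h, of "sqrt (real K)"]])
    show "(\<lambda>x. s x * h x) \<in> borel_measurable \<mu>" using L2_D(1)[OF h] by measurable
    show "\<bar>s x * h x\<bar> \<le> \<bar>sqrt (real K) * h x\<bar>" for x
      using s_bounds[of x] by (auto simp: abs_mult intro!: mult_right_mono)
  qed
  note uc = L2_diff[OF u mu.L2_const[of c]] and fc = L2_diff[OF f mu.L2_const[of c]]
  have bound: "(L2_norm \<mu> (\<lambda>x. s x * (u n x - c)))\<^sup>2 \<le> form_value \<mu> (u n) (v n) + b * (LINT x|\<mu>. (u n x - c)\<^sup>2)" for n
  proof -
    have q: "((\<lambda>t. energy t (\<lambda>x. u n x - c)) \<longlongrightarrow> form_value \<mu> (u n) (v n)) (at_right 0)"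
      unfolding energy_diff_const by (rule energy_tendsto_form_value[OF uv])
    have "ennreal ((L2_norm \<mu> (\<lambda>x. s x * (u n x - c)))\<^sup>2) = (\<integral>\<^sup>+x. ennreal ((s x * (u n x - c))\<^sup>2) \<partial>\<mu>)"
      unfolding L2_norm_sq by (rule nn_integral_eq_integral[symmetric, OF L2_D(2)[OF s_L2[OF uc]]]) simp
    also have "\<dots> \<le> (\<integral>\<^sup>+x. ennreal (\<phi> x * (u n x - c)\<^sup>2) \<partial>\<mu>)"
      by (intro nn_integral_mono ennreal_leI) (simp add: power_mult_distrib s_sq mult_right_mono)
    also have "\<dots> \<le> ennreal (form_value \<mu> (u n) (v n) + b * (LINT x|\<mu>. (u n x - c)\<^sup>2))"
      by (rule lyapunov_energy[OF b gen U_ge \<phi>_meas \<phi>_nonneg drift uc q])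
    finally show ?thesis
      using form_value_nonneg[OF uv] b by (subst (asm) ennreal_le_iff) auto
  qed
  have "(\<lambda>n. L2_norm \<mu> (\<lambda>x. s x * (u n x - c))) \<longlonglongrightarrow> L2_norm \<mu> (\<lambda>x. s x * (f x - c))"
  proof (rule L2_norm_tendsto)
    show "\<forall>\<^sub>F n in sequentially. (\<lambda>x. s x * (u n x - c)) \<in> L2 \<mu>" using s_L2[OF uc] by simp
    show "(\<lambda>x. s x * (f x - c)) \<in> L2 \<mu>" by (rule s_L2[OF fc])
    show "(\<lambda>n. L2_norm \<mu> (\<lambda>x. s x * (u n x - c) - s x * (f x - c))) \<longlonglongrightarrow> 0"
    proof (rule Lim_null_comparison)
      show "(\<lambda>n. sqrt (real K) * L2_norm \<mu> (\<lambda>x. u n x - f x)) \<longlonglongrightarrow> 0"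
        by (rule tendsto_mult_right_zero[OF lim])
      have "L2_norm \<mu> (\<lambda>x. s x * (u n x - c) - s x * (f x - c)) \<le> sqrt (real K) * L2_norm \<mu> (\<lambda>x. u n x - f x)" for n
      proof -
        have "L2_norm \<mu> (\<lambda>x. s x * (u n x - c) - s x * (f x - c)) = L2_norm \<mu> (\<lambda>x. s x * (u n x - f x))"
          by (simp add: algebra_simps)
        also have "\<dots> \<le> L2_norm \<mu> (\<lambda>x. sqrt (real K) * (u n x - f x))"
          unfolding L2_norm_def
        proof (intro real_sqrt_le_mono integral_mono)
          show "integrable \<mu> (\<lambda>x. (s x * (u n x - f x))\<^sup>2)"
            by (rule L2_D(2)[OF s_L2[OF L2_diff[OF u f]]])
          show "integrable \<mu> (\<lambda>x. (sqrt (real K) * (u n x - f x))\<^sup>2)"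
            by (rule L2_D(2)[OF L2_cmult[OF L2_diff[OF u f]]])
          show "(s x * (u n x - f x))\<^sup>2 \<le> (sqrt (real K) * (u n x - f x))\<^sup>2" for x
            by (simp add: power_mult_distrib s_sq mult_right_mono)
        qed
        also have "\<dots> = sqrt (real K) * L2_norm \<mu> (\<lambda>x. u n x - f x)"
          by (simp add: L2_norm_cmult)
        finally show ?thesis .
      qed
      then show "\<forall>\<^sub>F n in sequentially. norm (L2_norm \<mu> (\<lambda>x. s x * (u n x - c) - s x * (f x - c)))
          \<le> sqrt (real K) * L2_norm \<mu> (\<lambda>x. u n x - f x)"
        by simp
    qed
  qed
  then have "(\<lambda>n. (L2_norm \<mu> (\<lambda>x. s x * (u n x - c)))\<^sup>2) \<longlonglongrightarrow> (L2_norm \<mu> (\<lambda>x. s x * (f x - c)))\<^sup>2"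
    by (rule tendsto_power)
  moreover have "(\<lambda>n. form_value \<mu> (u n) (v n) + b * (LINT x|\<mu>. (u n x - c)\<^sup>2)) \<longlonglongrightarrow> ?C"
    by (intro tendsto_intros form_value_tendsto_dirichlet_form[OF f fa] form_approx_moments_tendsto[OF f fa])
  ultimately have le: "(L2_norm \<mu> (\<lambda>x. s x * (f x - c)))\<^sup>2 \<le> ?C"
    by (rule LIMSEQ_le) (use bound in auto)
  have "(\<integral>\<^sup>+x. ennreal (min (\<phi> x) (real K) * (f x - c)\<^sup>2) \<partial>\<mu>) = (\<integral>\<^sup>+x. ennreal ((s x * (f x - c))\<^sup>2) \<partial>\<mu>)"
    by (simp add: power_mult_distrib s_sq)
  also have "\<dots> = ennreal ((L2_norm \<mu> (\<lambda>x. s x * (f x - c)))\<^sup>2)"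
    unfolding L2_norm_sq by (rule nn_integral_eq_integral[OF L2_D(2)[OF s_L2[OF fc]]]) simp
  also have "\<dots> \<le> ennreal ?C" by (rule ennreal_leI[OF le])
  finally show "(\<integral>\<^sup>+x. ennreal (min (\<phi> x) (real K) * (f x - c)\<^sup>2) \<partial>\<mu>) \<le> ennreal ?C" .
next
  show "AE x in \<mu>. \<forall>\<^sub>F K in sequentially. ennreal (min (\<phi> x) (real K) * (f x - c)\<^sup>2) = ennreal (\<phi> x * (f x - c)\<^sup>2)"
  proof (rule AE_I2)
    fix x
    show "\<forall>\<^sub>F K in sequentially. ennreal (min (\<phi> x) (real K) * (f x - c)\<^sup>2) = ennreal (\<phi> x * (f x - c)\<^sup>2)"
      using eventually_min_real_eq[of "\<phi> x"] by eventually_elim simp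
  qed
qed

end

text \<open>\<open>\<bar>g^2 - 1\<bar>\<close> is \<open>(g + 1) * \<bar>g - 1\<bar>\<close>, and
  \<open>g + 1 \<le> \<bar>g - 1\<bar> + 2\<close>. The condition on \<open>a\<close> gives
  \<open>2 \<le> a\<close>, and the first coefficient is at least 1.\<close>

lemma abs_square_diff_one_le:
  fixes a g :: real
  assumes a: "2 \<le> a" and g: "0 \<le> g"
  shows "\<bar>g\<^sup>2 - 1\<bar> \<le> (a + 1) / (a - 1) * (g - 1)\<^sup>2 + a * \<bar>g - 1\<bar>"
proof -
  have \<rho>: "1 \<le> (a + 1) / (a - 1)" using a by (simp add: pos_le_divide_eq)
  have "\<bar>g - 1\<bar> \<le> (a + 1) / (a - 1) * \<bar>g - 1\<bar>"
    using mult_right_mono[OF \<rho>, of "\<bar>g - 1\<bar>"] by simp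
  moreover have "g + 1 \<le> \<bar>g - 1\<bar> + a"
    using a by linarith
  ultimately have "g + 1 \<le> (a + 1) / (a - 1) * \<bar>g - 1\<bar> + a" by linarith
  then have "(g + 1) * \<bar>g - 1\<bar> \<le> ((a + 1) / (a - 1) * \<bar>g - 1\<bar> + a) * \<bar>g - 1\<bar>"
    by (rule mult_right_mono) simp
  also have "\<dots> = (a + 1) / (a - 1) * (g - 1)\<^sup>2 + a * \<bar>g - 1\<bar>"
    by (simp add: distrib_right mult.assoc abs_mult_self_eq power2_eq_square)
  also have "(g + 1) * \<bar>g - 1\<bar> = \<bar>g\<^sup>2 - 1\<bar>"
  proof -
    have "g\<^sup>2 - 1 = (g + 1) * (g - 1)" by (simp add: power2_eq_square algebra_simps)
    then show ?thesis using g by (simp add: abs_mult)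
  qed
  finally show ?thesis .
qed

theorem theorem5p1:
  fixes M :: "'w measure" and F :: "ennreal \<Rightarrow> 'w measure"
    and X :: "real \<Rightarrow> 'w \<Rightarrow> 'a::polish_space"
    and P :: "real \<Rightarrow> 'a \<Rightarrow> 'a measure" and \<mu> \<nu> :: "'a measure"
    and U LU \<phi> :: "'a \<Rightarrow> real" and a b cP :: real
  assumes process: "reversible_markov_process M F X P \<mu>"
    and cP_nonneg: "0 \<le> cP"
    and poincare: "poincare_constant \<mu> P = ennreal cP"
    and U_ge_1: "\<And>x. 1 \<le> U x"
    and U_domain: "extended_generator M F X U LU"
    and phi_measurable: "\<phi> \<in> borel_measurable borel"
    and phi_nonneg: "\<And>x. 0 \<le> \<phi> x"
    and b_pos: "0 < b"
    and lyapunov: "AE x in \<mu>. - LU x / U x \<ge> \<phi> x - b"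
    and phi_L2: "\<phi> \<in> L2 \<mu>"
    and a_ge_2: "2 \<le> a"
    and nu: "prob_space \<nu>" "sets \<nu> = sets borel"
  shows
    "weighted_tv \<phi> \<nu> \<mu>
       \<le> ennreal ((1 + 2 * b * cP) * ((a + 1) / (a - 1))) * fisher_information \<mu> P \<nu>
         + ennreal (a * sqrt 2 * L2_norm \<mu> \<phi>) * ennsqrt (ennreal cP * fisher_information \<mu> P \<nu>) \<and>
     (weighted_tv (\<lambda>x. sqrt (\<phi> x)) \<nu> \<mu>)\<^sup>2
       \<le> ennreal (2 * (3 * (1 + 2 * b * cP) + 2 * sqrt 2 * L2_norm \<mu> \<phi> * cP))
         * fisher_information \<mu> P \<nu>"
proof -
  interpret reversible_markov_process M F X P \<mu> by (rule process)
  define r where "r = (\<lambda>x. sqrt (enn2real (RN_deriv \<mu> \<nu> x)))"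
  define k where "k = 1 + 2 * b * cP"
  define \<rho> where "\<rho> = (a + 1) / (a - 1)"
  have k: "1 \<le> k" using b_pos cP_nonneg by (simp add: k_def)
  have \<rho>: "1 \<le> \<rho>" using a_ge_2 by (simp add: \<rho>_def pos_le_divide_eq)
  \<comment> \<open>\<open>4 * k\<close> is the constant that the argument for the second inequality
    produces.\<close>
  have C2: "4 * k \<le> 2 * (3 * k + 2 * sqrt 2 * L2_norm \<mu> \<phi> * cP)"
    using k cP_nonneg by simp
  show ?thesis
  proof (cases "absolutely_continuous \<mu> \<nu> \<and> r \<in> dirichlet_domain \<mu> P")
    case False
    then have top: "fisher_information \<mu> P \<nu> = \<infinity>"
      by (simp add: fisher_information_def r_def Let_def)
    \<comment> \<open>Strict positivity of the coefficients matters: in \<open>ennreal\<close> the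
      product of 0 and \<infinity> is 0.\<close>
    have "0 < k * \<rho>" using k \<rho> by simp
    then have "ennreal (k * \<rho>) * fisher_information \<mu> P \<nu> = \<infinity>"
      by (auto simp: top ennreal_mult_eq_top_iff ennreal_eq_0_iff)
    moreover have "ennreal (2 * (3 * k + 2 * sqrt 2 * L2_norm \<mu> \<phi> * cP)) * fisher_information \<mu> P \<nu> = \<infinity>"
      using C2 k by (auto simp: top ennreal_mult_eq_top_iff ennreal_eq_0_iff)
    ultimately show ?thesis by (simp add: k_def \<rho>_def)
  next
    case True
    then have ac: "absolutely_continuous \<mu> \<nu>" and dom: "r \<in> dirichlet_domain \<mu> P" by auto
    define e where "e = dirichlet_form \<mu> P r"
    have fisher: "fisher_information \<mu> P \<nu> = ennreal e"
      using True by (simp add: fisher_information_def r_def e_def Let_def)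
    have e: "0 \<le> e" unfolding e_def by (rule dirichlet_form_nonneg[OF dom])
    have sets_nu: "sets \<nu> = sets \<mu>" using nu sets_mu by simp
    have r_L2: "r \<in> L2 \<mu>" using dom by (simp add: dirichlet_domain_def)
    have r_meas [measurable]: "r \<in> borel_measurable \<mu>" by (rule L2_D(1)[OF r_L2])
    have r_nonneg: "0 \<le> r x" for x by (simp add: r_def)
    have r_sq: "(r x)\<^sup>2 = enn2real (RN_deriv \<mu> \<nu> x)" for x by (simp add: r_def)
    have phi_meas [measurable]: "\<phi> \<in> borel_measurable \<mu>" by (rule L2_D(1)[OF phi_L2])
    note tv = weighted_tv_le_density[OF prob_space_mu nu(1) sets_nu ac, folded r_sq]
    have r_int: "integrable \<mu> r" by (rule mu.L2_integrable[OF r_L2])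
    have r_sq_int: "(LINT x|\<mu>. (r x)\<^sup>2) = 1" by (rule tv(3)[OF phi_meas])
    define m where "m = (LINT x|\<mu>. r x)"
    have m_nonneg: "0 \<le> m" unfolding m_def by (rule integral_nonneg_AE) (simp add: r_nonneg)
    have m_sq_le: "m\<^sup>2 \<le> 1"
    proof -
      have "(LINT x|\<mu>. (r x - m)\<^sup>2) = 1 - m\<^sup>2"
        using variance_eq[OF r_L2] by (simp add: m_def[symmetric] r_sq_int)
      moreover have "0 \<le> (LINT x|\<mu>. (r x - m)\<^sup>2)" by (rule integral_nonneg_AE) simp
      ultimately show ?thesis by linarith
    qed
    then have m_le: "m \<le> 1" by (intro power2_le_imp_le[of m 1]) simp_all
    have r_shift: "(LINT x|\<mu>. (r x + c)\<^sup>2) = 1 + 2 * c * m + c\<^sup>2" for c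
      using L2_lincomb_integral[OF r_L2 mu.L2_const[of c], of 1 1] r_int
      by (simp add: r_sq_int m_def mu.prob_space)
    define d where "d = (LINT x|\<mu>. (r x - 1)\<^sup>2)"
    have d_nonneg: "0 \<le> d" by (simp add: d_def)
    have d_le: "d \<le> 2 * (cP * e)"
    proof -
      have "d = 2 - 2 * m" using r_shift[of "-1"] by (simp add: d_def)
      \<comment> \<open>Here \<open>m^2 \<le> m\<close>, because \<open>m\<close> lies between 0 and
        1; and \<open>1 - m^2\<close> is the variance of \<open>r\<close>, whose square has integral
        1.\<close>
      also have "\<dots> \<le> 2 * (1 - m\<^sup>2)"
        using m_nonneg m_le by (simp add: power2_eq_square mult_left_le)
      also have "\<dots> \<le> 2 * (cP * e)"
        using poincare_dirichlet[OF poincare cP_nonneg dom] by (simp add: r_sq_int m_def e_def)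
      finally show ?thesis .
    qed
    have drift: "AE x in \<mu>. LU x \<le> (b - \<phi> x) * U x"
      using lyapunov
    proof eventually_elim
      case (elim x)
      have "0 < U x" using U_ge_1[of x] by simp
      with elim have "(\<phi> x - b) * U x \<le> - LU x" by (simp only: pos_le_divide_eq)
      then show ?case by (simp add: algebra_simps)
    qed
    have key: "(\<integral>\<^sup>+x. ennreal (\<phi> x * (r x - 1)\<^sup>2) \<partial>\<mu>) \<le> ennreal (k * e)"
    proof -
      have "(\<integral>\<^sup>+x. ennreal (\<phi> x * (r x - 1)\<^sup>2) \<partial>\<mu>) \<le> ennreal (e + b * d)"
        unfolding e_def d_def
        by (rule lyapunov_dirichlet[OF less_imp_le[OF b_pos] U_domain U_ge_1 phi_measurable phi_nonneg drift dom])
      \<comment> \<open>The constant \<open>k = 1 + 2 * b * cP\<close> originates here, from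
        \<open>d \<le> 2 * (cP * e)\<close>.\<close>
      also have "e + b * d \<le> k * e"
        using mult_left_mono[OF d_le less_imp_le[OF b_pos]] by (simp add: k_def algebra_simps)
      then have "ennreal (e + b * d) \<le> ennreal (k * e)" by (rule ennreal_leI)
      finally show ?thesis .
    qed
    note r1_L2 = L2_diff[OF r_L2 mu.L2_const[of 1]]
    have "weighted_tv \<phi> \<nu> \<mu> \<le> (\<integral>\<^sup>+x. ennreal (\<phi> x * \<bar>(r x)\<^sup>2 - 1\<bar>) \<partial>\<mu>)"
      by (rule tv(1)) measurable
    also have "\<dots> \<le> (\<integral>\<^sup>+x. ennreal \<rho> * ennreal (\<phi> x * (r x - 1)\<^sup>2) + ennreal (a * (\<phi> x * \<bar>r x - 1\<bar>)) \<partial>\<mu>)"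
    proof (rule nn_integral_mono)
      fix x
      have "\<phi> x * \<bar>(r x)\<^sup>2 - 1\<bar> \<le> \<phi> x * (\<rho> * (r x - 1)\<^sup>2 + a * \<bar>r x - 1\<bar>)"
        unfolding \<rho>_def by (intro mult_left_mono abs_square_diff_one_le a_ge_2 r_nonneg phi_nonneg)
      also have "\<dots> = \<rho> * (\<phi> x * (r x - 1)\<^sup>2) + a * (\<phi> x * \<bar>r x - 1\<bar>)"
        by (simp add: algebra_simps)
      finally have "ennreal (\<phi> x * \<bar>(r x)\<^sup>2 - 1\<bar>) \<le> ennreal (\<rho> * (\<phi> x * (r x - 1)\<^sup>2) + a * (\<phi> x * \<bar>r x - 1\<bar>))"
        by (rule ennreal_leI)
      also have "\<dots> = ennreal \<rho> * ennreal (\<phi> x * (r x - 1)\<^sup>2) + ennreal (a * (\<phi> x * \<bar>r x - 1\<bar>))"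
        using \<rho> a_ge_2 phi_nonneg[of x] by (subst ennreal_plus) (auto simp: ennreal_mult)
      finally show "ennreal (\<phi> x * \<bar>(r x)\<^sup>2 - 1\<bar>)
        \<le> ennreal \<rho> * ennreal (\<phi> x * (r x - 1)\<^sup>2) + ennreal (a * (\<phi> x * \<bar>r x - 1\<bar>))" .
    qed
    also have "\<dots> = ennreal \<rho> * (\<integral>\<^sup>+x. ennreal (\<phi> x * (r x - 1)\<^sup>2) \<partial>\<mu>) + (\<integral>\<^sup>+x. ennreal (a * (\<phi> x * \<bar>r x - 1\<bar>)) \<partial>\<mu>)"
      by (subst nn_integral_add) (auto simp: nn_integral_cmult)
    also have "\<dots> \<le> ennreal (k * \<rho>) * fisher_information \<mu> P \<nu>
        + ennreal (a * sqrt 2 * L2_norm \<mu> \<phi>) * ennsqrt (ennreal cP * fisher_information \<mu> P \<nu>)"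
    proof (rule add_mono)
      have "ennreal \<rho> * (\<integral>\<^sup>+x. ennreal (\<phi> x * (r x - 1)\<^sup>2) \<partial>\<mu>) \<le> ennreal \<rho> * ennreal (k * e)"
        by (intro mult_left_mono key) simp
      also have "\<dots> = ennreal (k * \<rho>) * fisher_information \<mu> P \<nu>"
        using \<rho> k e by (simp add: fisher ennreal_mult[symmetric] algebra_simps)
      finally show "ennreal \<rho> * (\<integral>\<^sup>+x. ennreal (\<phi> x * (r x - 1)\<^sup>2) \<partial>\<mu>) \<le> ennreal (k * \<rho>) * fisher_information \<mu> P \<nu>" .
      note abs_L2 = L2_abs[OF r1_L2]
      have "(\<integral>\<^sup>+x. ennreal (a * (\<phi> x * \<bar>r x - 1\<bar>)) \<partial>\<mu>) = ennreal (LINT x|\<mu>. a * (\<phi> x * \<bar>r x - 1\<bar>))"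
        using a_ge_2 phi_nonneg
        by (intro nn_integral_eq_integral integrable_mult_right L2_mult_integrable phi_L2 abs_L2) simp
      also have "(LINT x|\<mu>. a * (\<phi> x * \<bar>r x - 1\<bar>)) = a * (LINT x|\<mu>. \<phi> x * \<bar>r x - 1\<bar>)" by simp
      \<comment> \<open>Cauchy-Schwarz between \<phi> and \<open>\<bar>r - 1\<bar>\<close>, whose
        norm is the square root of \<open>d\<close>; the bound on \<open>d\<close> is the source of
        \<open>sqrt 2\<close> in the statement.\<close>
      also have "(LINT x|\<mu>. \<phi> x * \<bar>r x - 1\<bar>) \<le> L2_norm \<mu> \<phi> * sqrt (2 * (cP * e))"
      proof -
        have "(LINT x|\<mu>. \<phi> x * \<bar>r x - 1\<bar>) \<le> L2_norm \<mu> \<phi> * L2_norm \<mu> (\<lambda>x. \<bar>r x - 1\<bar>)"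
          using L2_Cauchy_Schwarz[OF phi_L2 abs_L2] by simp
        also have "L2_norm \<mu> (\<lambda>x. \<bar>r x - 1\<bar>) \<le> sqrt (2 * (cP * e))"
          using d_le by (simp add: L2_norm_def d_def)
        finally show ?thesis by (simp add: mult_left_mono)
      qed
      finally have "(\<integral>\<^sup>+x. ennreal (a * (\<phi> x * \<bar>r x - 1\<bar>)) \<partial>\<mu>) \<le> ennreal (a * (L2_norm \<mu> \<phi> * sqrt (2 * (cP * e))))"
        using a_ge_2 by (simp add: ennreal_leI mult_left_mono)
      also have "\<dots> = ennreal (a * sqrt 2 * L2_norm \<mu> \<phi>) * ennreal (sqrt (cP * e))"
        using a_ge_2 cP_nonneg e by (simp add: ennreal_mult[symmetric] real_sqrt_mult algebra_simps)
      also have "ennreal (sqrt (cP * e)) = ennsqrt (ennreal cP * fisher_information \<mu> P \<nu>)"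
        using cP_nonneg e by (simp add: fisher ennreal_mult[symmetric] ennsqrt_def)
      finally show "(\<integral>\<^sup>+x. ennreal (a * (\<phi> x * \<bar>r x - 1\<bar>)) \<partial>\<mu>)
        \<le> ennreal (a * sqrt 2 * L2_norm \<mu> \<phi>) * ennsqrt (ennreal cP * fisher_information \<mu> P \<nu>)" .
    qed
    finally have first: "weighted_tv \<phi> \<nu> \<mu> \<le> ennreal (k * \<rho>) * fisher_information \<mu> P \<nu>
        + ennreal (a * sqrt 2 * L2_norm \<mu> \<phi>) * ennsqrt (ennreal cP * fisher_information \<mu> P \<nu>)" .
    \<comment> \<open>The whole weight \<open>sqrt \<phi>\<close> is attached to the factor
      \<open>\<bar>r - 1\<bar>\<close>: then \<open>s^2\<close> is the integrand of
      \<open>key\<close>, and the other factor \<open>r + 1\<close> carries no weight.\<close>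
    define s where "s x = sqrt (\<phi> x) * \<bar>r x - 1\<bar>" for x
    have s_meas [measurable]: "s \<in> borel_measurable \<mu>" unfolding s_def by measurable
    have s_sq: "(s x)\<^sup>2 = \<phi> x * (r x - 1)\<^sup>2" for x
      by (simp add: s_def power_mult_distrib phi_nonneg)
    have s_int: "integrable \<mu> (\<lambda>x. (s x)\<^sup>2)"
    proof (rule integrableI_bounded)
      have "(\<integral>\<^sup>+x. ennreal (norm ((s x)\<^sup>2)) \<partial>\<mu>) = (\<integral>\<^sup>+x. ennreal (\<phi> x * (r x - 1)\<^sup>2) \<partial>\<mu>)"
        by (simp add: s_sq phi_nonneg)
      also have "\<dots> < \<infinity>" using key by (rule le_less_trans) simp
      finally show "(\<integral>\<^sup>+x. ennreal (norm ((s x)\<^sup>2)) \<partial>\<mu>) < \<infinity>" .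
    qed measurable
    then have s_L2: "s \<in> L2 \<mu>" by (simp add: L2_def)
    have s_norm: "L2_norm \<mu> s \<le> sqrt (k * e)"
    proof -
      have "ennreal (LINT x|\<mu>. (s x)\<^sup>2) \<le> ennreal (k * e)"
        by (subst nn_integral_eq_integral[OF s_int, symmetric]) (simp_all only: s_sq key, simp add: phi_nonneg)
      then show ?thesis using k e by (simp add: L2_norm_def ennreal_le_iff)
    qed
    note r1_L2' = L2_add[OF r_L2 mu.L2_const[of 1]]
    \<comment> \<open>The square of \<open>r + 1\<close> integrates to \<open>2 + 2 * m\<close>, at
      most 4, since \<open>r\<close> has norm 1 and mean at most 1.\<close>
    have r1_norm: "L2_norm \<mu> (\<lambda>x. r x + 1) \<le> 2"
    proof -
      have "(LINT x|\<mu>. (r x + 1)\<^sup>2) \<le> 2\<^sup>2" using r_shift[of 1] m_le by simp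
      then show ?thesis unfolding L2_norm_def by (intro real_le_lsqrt) auto
    qed
    have "weighted_tv (\<lambda>x. sqrt (\<phi> x)) \<nu> \<mu> \<le> (\<integral>\<^sup>+x. ennreal (sqrt (\<phi> x) * \<bar>(r x)\<^sup>2 - 1\<bar>) \<partial>\<mu>)"
      by (rule tv(1)) measurable
    also have "\<dots> = (\<integral>\<^sup>+x. ennreal (s x * (r x + 1)) \<partial>\<mu>)"
    proof (intro nn_integral_cong arg_cong[where f=ennreal])
      fix x
      have "(r x)\<^sup>2 - 1 = (r x - 1) * (r x + 1)" by (simp add: power2_eq_square algebra_simps)
      then show "sqrt (\<phi> x) * \<bar>(r x)\<^sup>2 - 1\<bar> = s x * (r x + 1)"
        using r_nonneg[of x] by (simp add: s_def abs_mult)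
    qed
    also have "\<dots> = ennreal (LINT x|\<mu>. s x * (r x + 1))"
      by (rule nn_integral_eq_integral[OF L2_mult_integrable[OF s_L2 r1_L2']])
        (simp add: s_def r_nonneg phi_nonneg)
    also have "\<dots> \<le> ennreal (sqrt (k * e) * 2)"
    proof (rule ennreal_leI)
      have "(LINT x|\<mu>. s x * (r x + 1)) \<le> L2_norm \<mu> s * L2_norm \<mu> (\<lambda>x. r x + 1)"
        using L2_Cauchy_Schwarz[OF s_L2 r1_L2'] by simp
      also have "\<dots> \<le> sqrt (k * e) * 2"
        using k e by (intro mult_mono s_norm r1_norm) auto
      finally show "(LINT x|\<mu>. s x * (r x + 1)) \<le> sqrt (k * e) * 2" .
    qed
    finally have "(weighted_tv (\<lambda>x. sqrt (\<phi> x)) \<nu> \<mu>)\<^sup>2 \<le> (ennreal (sqrt (k * e) * 2))\<^sup>2"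
      by (rule power_mono) simp
    also have "\<dots> = ennreal ((sqrt (k * e) * 2)\<^sup>2)"
      using k e by (subst ennreal_power) auto
    also have "(sqrt (k * e) * 2)\<^sup>2 = 4 * k * e"
      using k e by (simp add: power_mult_distrib)
    also have "ennreal (4 * k * e) \<le> ennreal (2 * (3 * k + 2 * sqrt 2 * L2_norm \<mu> \<phi> * cP) * e)"
      using mult_right_mono[OF C2 e] by (rule ennreal_leI)
    also have "\<dots> = ennreal (2 * (3 * k + 2 * sqrt 2 * L2_norm \<mu> \<phi> * cP)) * fisher_information \<mu> P \<nu>"
      unfolding fisher using C2 k e by (intro ennreal_mult) auto
    finally have second: "(weighted_tv (\<lambda>x. sqrt (\<phi> x)) \<nu> \<mu>)\<^sup>2
      \<le> ennreal (2 * (3 * k + 2 * sqrt 2 * L2_norm \<mu> \<phi> * cP)) * fisher_information \<mu> P \<nu>" .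
    show ?thesis
      using first second unfolding k_def \<rho>_def by blast
  qed
qed

end
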